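(* Let $\rho$ and $\sigma$ be odd partitions with no part equal to $1$. Then for every integer $n\ge0$, $$\mathbb{E}_n[\mathfrak{p}_\rho\mathfrak{p}_\sigma]=\delta_{\rho,\sigma}\,2^{|\rho|-\ell(\rho)}z_\rho\,n^{\downarrow|\rho|}.$$
   Context: Partitions are finite weakly decreasing sequences of positive integers; $\ell$ = length, $|\cdot|$ = size; strict = distinct parts, odd = all parts odd; $\mathcal{SP}_k,\mathcal{OP}_k$ the strict/odd partitions of $k$. $x^{\downarrow k}=x(x-1)\cdots(x-k+1)$, $x^{\downarrow0}=1$. Shifted diagram $S(\lambda)=\{(i,j):1\le i\le\ell(\lambda),\ i\le j\le\lambda_i+i-1\}$; $g^\lambda$ = number of chains $\emptyset=\lambda^{(0)},\dots,\lambda^{(|\lambda|)}=\lambda$ of strict partitions each obtained from the previous by adding one box to the shifted diagram. $\mathbb{E}_n[\varphi]=\sum_{\lambda\in\mathcal{SP}_n}\frac{2^{n-\ell(\lambda)}(g^\lambda)^2}{n!}\varphi(\lambda)$. $p_r=\sum_ix_i^r$; $\Gamma$ = $\mathbb{Q}$-algebra generated by $p_1,p_3,\dots$; for $f\in\Gamma$, $f(\lambda)=f(\lambda_1,\dots,\lambda_{\ell(\lambda)},0,\dots)$. For $\rho\in\mathcal{OP}$: $p_\rho=\prod_ip_{\rho_i}$, $z_\rho=\prod_rr^{m_r(\rho)}m_r(\rho)!$ ($m_r$ = multiplicity of $r$); scalar product $\langle p_\rho,p_\sigma\rangle=2^{-\ell(\rho)}z_\rho\delta_{\rho\sigma}$.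 For strict $\lambda$ of length $l$, $P_\lambda(x_1,\dots,x_N)=\frac1{(N-l)!}\sum_{\omega\in S_N}\omega\big(x_1^{\lambda_1}\cdots x_l^{\lambda_l}\prod_{1\le i\le l,\,i<j\le N}\frac{x_i+x_j}{x_i-x_j}\big)$ ($N\ge l$; zero if $N<l$), $Q_\lambda=2^{\ell(\lambda)}P_\lambda$, and $P^*_\lambda$ is the same formula with $x_i^{\lambda_i}$ replaced by $x_i^{\downarrow\lambda_i}$. $X^\lambda_\rho=\langle p_\rho,Q_\lambda\rangle$, and $\mathfrak{p}_\rho=\sum_{\lambda\in\mathcal{SP}_{|\rho|}}X^\lambda_\rho P^*_\lambda\in\Gamma$ ($\mathfrak p_\emptyset=1$). *)

theory Defs
  imports
    Complex_Main
    "HOL-Library.Multiset"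
    "HOL-Library.Poly_Mapping"
    "HOL-Computational_Algebra.Fraction_Field"
    "HOL-Combinatorics.Permutations"
begin

section \<open>Partitions\<close>

definition is_partition :: "nat list \<Rightarrow> bool" where
  "is_partition \<mu> \<longleftrightarrow> sorted_wrt (\<ge>) \<mu> \<and> 0 \<notin> set \<mu>"

definition strict_partition :: "nat list \<Rightarrow> bool" where
  "strict_partition \<mu> \<longleftrightarrow> is_partition \<mu> \<and> distinct \<mu>"

definition odd_partition :: "nat list \<Rightarrow> bool" where
  "odd_partition \<rho> \<longleftrightarrow> is_partition \<rho> \<and> (\<forall>r\<in>set \<rho>. odd r)"

definition SP :: "nat \<Rightarrow> nat list set" where
  "SP k = {\<mu>. strict_partition \<mu> \<and> sum_list \<mu> = k}"

definition z_part :: "nat list \<Rightarrow> nat" where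
  "z_part \<rho> = (\<Prod>r\<in>set \<rho>. r ^ count_list \<rho> r * fact (count_list \<rho> r))"

definition falling :: "'a::comm_ring_1 \<Rightarrow> nat \<Rightarrow> 'a" where
  "falling x k = (\<Prod>i<k. x - of_nat i)"

text \<open>Rows and columns are numbered from 1, lists from 0.\<close>
definition shifted_diagram :: "nat list \<Rightarrow> (nat \<times> nat) set" where
  "shifted_diagram \<mu> =
     {(i, j). 1 \<le> i \<and> i \<le> length \<mu> \<and> i \<le> j \<and> j \<le> \<mu> ! (i - 1) + i - 1}"

definition adds_box :: "nat list \<Rightarrow> nat list \<Rightarrow> bool" where
  "adds_box \<mu> \<nu> \<longleftrightarrow>
     (\<exists>b. b \<notin> shifted_diagram \<mu> \<and> shifted_diagram \<nu> = insert b (shifted_diagram \<mu>))"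

definition chains :: "nat list \<Rightarrow> nat list list set" where
  "chains \<mu> = {c. length c = Suc (sum_list \<mu>) \<and> c ! 0 = [] \<and> c ! sum_list \<mu> = \<mu> \<and>
     (\<forall>\<nu>\<in>set c. strict_partition \<nu>) \<and> (\<forall>k<sum_list \<mu>. adds_box (c ! k) (c ! Suc k))}"

definition g_count :: "nat list \<Rightarrow> nat" where
  "g_count \<mu> = card (chains \<mu>)"

definition E_strict :: "nat \<Rightarrow> (nat list \<Rightarrow> rat) \<Rightarrow> rat" where
  "E_strict n \<phi> = (\<Sum>\<mu>\<in>SP n. 2 ^ (n - length \<mu>) * (of_nat (g_count \<mu>))\<^sup>2 / fact n * \<phi> \<mu>)"

text \<open>The sum in \<open>E_strict\<close> and the cardinality in \<open>g_count\<close> range over finite sets.\<close>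

lemma length_le_sum_list_partition: "is_partition \<mu> \<Longrightarrow> length \<mu> \<le> sum_list \<mu>"
  unfolding is_partition_def by (induction \<mu>) (auto simp: Suc_le_eq)

lemma finite_SP: "finite (SP k)"
proof (rule finite_subset)
  show "SP k \<subseteq> {\<mu>. set \<mu> \<subseteq> {..k} \<and> length \<mu> \<le> k}"
    using length_le_sum_list_partition member_le_sum_list
    by (fastforce simp: SP_def strict_partition_def)
  show "finite {\<mu>. set \<mu> \<subseteq> {..k} \<and> length \<mu> \<le> k}"
    by (rule finite_lists_length_le) simp
qed

lemma card_shifted_diagram: "is_partition \<mu> \<Longrightarrow> finite (shifted_diagram \<mu>) \<and>
    card (shifted_diagram \<mu>) = sum_list \<mu>"
proof -
  assume p: "is_partition \<mu>"
  have eq: "shifted_diagram \<mu> = (SIGMA i:{1..length \<mu>}. {i..\<mu> ! (i - 1) + i - 1})"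
    unfolding shifted_diagram_def by auto
  have "card (shifted_diagram \<mu>) = (\<Sum>i\<in>{1..length \<mu>}. card {i..\<mu> ! (i - 1) + i - 1})"
    unfolding eq by (rule card_SigmaI) auto
  also have "\<dots> = (\<Sum>i\<in>{1..length \<mu>}. \<mu> ! (i - 1))"
    by (rule sum.cong) auto
  also have "\<dots> = (\<Sum>i<length \<mu>. \<mu> ! i)"
    by (rule sum.reindex_bij_witness[of _ "\<lambda>i. i + 1" "\<lambda>i. i - 1"]) auto
  also have "\<dots> = sum_list \<mu>"
    by (simp add: sum_list_sum_nth atLeast0LessThan)
  finally show ?thesis unfolding eq by auto
qed

lemma finite_chains: "finite (chains \<mu>)"
proof (rule finite_subset)
  let ?A = "\<Union>k\<le>sum_list \<mu>. SP k"
  show "chains \<mu> \<subseteq> {c. set c \<subseteq> ?A \<and> length c \<le> Suc (sum_list \<mu>)}"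
  proof
    fix c assume c: "c \<in> chains \<mu>"
    have "k \<le> sum_list \<mu> \<Longrightarrow> c ! k \<in> SP k" for k
    proof (induction k)
      case 0
      then show ?case using c
        by (auto simp: chains_def SP_def strict_partition_def is_partition_def)
    next
      case (Suc k)
      then have ih: "c ! k \<in> SP k" by simp
      have st: "strict_partition (c ! Suc k)" and ab: "adds_box (c ! k) (c ! Suc k)"
        using c Suc.prems by (auto simp: chains_def)
      from ab obtain b where "b \<notin> shifted_diagram (c ! k)"
        "shifted_diagram (c ! Suc k) = insert b (shifted_diagram (c ! k))"
        unfolding adds_box_def by auto
      then have "sum_list (c ! Suc k) = Suc k"
        using card_shifted_diagram[of "c ! k"] card_shifted_diagram[of "c ! Suc k"] ih st
        by (auto simp: SP_def strict_partition_def)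
      then show ?case using st by (simp add: SP_def)
    qed
    then show "c \<in> {c. set c \<subseteq> ?A \<and> length c \<le> Suc (sum_list \<mu>)}"
      using c by (fastforce simp: chains_def in_set_conv_nth less_Suc_eq_le)
  qed
  show "finite {c. set c \<subseteq> ?A \<and> length c \<le> Suc (sum_list \<mu>)}"
    by (rule finite_lists_length_le) (simp add: finite_SP)
qed

section \<open>Symmetric functions\<close>

text \<open>Polynomials over the rationals; the variable \<open>x\<^sub>i\<close> (numbered from 1) is \<open>Var (i - 1)\<close>.\<close>

type_synonym mpoly = "(nat \<Rightarrow>\<^sub>0 nat) \<Rightarrow>\<^sub>0 rat"

definition Const :: "rat \<Rightarrow> mpoly" where
  "Const c = Poly_Mapping.single 0 c"

definition Var :: "nat \<Rightarrow> mpoly" where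
  "Var i = Poly_Mapping.single (Poly_Mapping.single i 1) 1"

definition poly_eval :: "(nat \<Rightarrow> rat) \<Rightarrow> mpoly \<Rightarrow> rat" where
  "poly_eval \<alpha> p = (\<Sum>m\<in>Poly_Mapping.keys p.
     Poly_Mapping.lookup p m * (\<Prod>i\<in>Poly_Mapping.keys m. \<alpha> i ^ Poly_Mapping.lookup m i))"

text \<open>A symmetric function \<open>f\<close> is represented by its restrictions to finitely many variables:
  \<open>f N\<close> is the polynomial \<open>f(x\<^sub>1, \<dots>, x\<^sub>N, 0, 0, \<dots>)\<close>. Algebraic operations are pointwise in \<open>N\<close>.\<close>

type_synonym symfun = "nat \<Rightarrow> mpoly"

definition power_sum :: "nat \<Rightarrow> symfun" where
  "power_sum r = (\<lambda>N. \<Sum>i<N. Var i ^ r)"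

inductive_set Gamma_alg :: "symfun set" where
  const: "(\<lambda>N. Const c) \<in> Gamma_alg"
| power_sum: "odd r \<Longrightarrow> power_sum r \<in> Gamma_alg"
| add: "f \<in> Gamma_alg \<Longrightarrow> h \<in> Gamma_alg \<Longrightarrow> (\<lambda>N. f N + h N) \<in> Gamma_alg"
| mult: "f \<in> Gamma_alg \<Longrightarrow> h \<in> Gamma_alg \<Longrightarrow> (\<lambda>N. f N * h N) \<in> Gamma_alg"

text \<open>\<open>f(\<mu>\<^sub>1, \<dots>, \<mu>\<^sub>\<ell>, 0, 0, \<dots>)\<close>: with \<open>\<ell>\<close> the length of \<open>\<mu>\<close>, this is the value of \<open>f \<ell>\<close>.\<close>
definition sym_eval :: "symfun \<Rightarrow> nat list \<Rightarrow> rat" where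
  "sym_eval f \<mu> = poly_eval (\<lambda>i. of_nat (\<mu> ! i)) (f (length \<mu>))"

definition p_prod :: "nat list \<Rightarrow> symfun" where
  "p_prod \<rho> = (\<lambda>N. \<Prod>r\<leftarrow>\<rho>. power_sum r N)"

text \<open>The scalar product on \<open>Gamma_alg\<close>: the elements \<open>p_prod \<rho>\<close> with \<open>\<rho>\<close> odd form a basis,
  \<open>p_coeffs f\<close> are the coordinates of \<open>f\<close>, and the form is the bilinear extension of
  \<open>\<langle>p\<^sub>\<rho>, p\<^sub>\<sigma>\<rangle> = 2 ^ (- length \<rho>) z\<^sub>\<rho> \<delta>\<^sub>\<rho>\<^sub>\<sigma>\<close>.\<close>

definition p_comb :: "(nat list \<Rightarrow>\<^sub>0 rat) \<Rightarrow> symfun" where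
  "p_comb c = (\<lambda>N. \<Sum>\<rho>\<in>Poly_Mapping.keys c. Const (Poly_Mapping.lookup c \<rho>) * p_prod \<rho> N)"

lemma p_comb_superset:
  assumes "finite A" "Poly_Mapping.keys c \<subseteq> A"
  shows "p_comb c N = (\<Sum>\<rho>\<in>A. Const (Poly_Mapping.lookup c \<rho>) * p_prod \<rho> N)"
  unfolding p_comb_def using assms
  by (intro sum.mono_neutral_left) (auto simp: in_keys_iff Const_def)

lemma p_comb_add: "p_comb (c + d) N = p_comb c N + p_comb d N"
proof -
  let ?A = "Poly_Mapping.keys c \<union> Poly_Mapping.keys d"
  have "Poly_Mapping.keys (c + d) \<subseteq> ?A" by (rule Poly_Mapping.keys_add)
  then show ?thesis
    using p_comb_superset[of ?A c N] p_comb_superset[of ?A d N] p_comb_superset[of ?A "c + d" N]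
    by (simp add: lookup_add Const_def single_add distrib_right sum.distrib)
qed

lemma p_comb_sum: "p_comb (\<Sum>i\<in>I. c i) N = (\<Sum>i\<in>I. p_comb (c i) N)"
  by (induction I rule: infinite_finite_induct) (auto simp: p_comb_add, auto simp: p_comb_def)

lemma p_comb_single: "p_comb (Poly_Mapping.single \<rho> a) N = Const a * p_prod \<rho> N"
  by (auto simp: p_comb_def Const_def)

lemma p_prod_mult: "p_prod (rev (sort (\<rho> @ \<sigma>))) N = p_prod \<rho> N * p_prod \<sigma> N"
proof -
  have "p_prod \<tau> N = prod_mset (image_mset (\<lambda>r. power_sum r N) (mset \<tau>))" for \<tau>
    by (simp add: p_prod_def flip: prod_mset_prod_list)
  then show ?thesis by simp
qed

lemma odd_partition_merge:
  "odd_partition \<rho> \<Longrightarrow> odd_partition \<sigma> \<Longrightarrow> odd_partition (rev (sort (\<rho> @ \<sigma>)))"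
  by (auto simp: odd_partition_def is_partition_def sorted_wrt_rev simp del: sort_append)

lemma p_prod_Gamma_alg: "\<forall>r\<in>set \<rho>. odd r \<Longrightarrow> p_prod \<rho> \<in> Gamma_alg"
proof (induction \<rho>)
  case Nil
  then show ?case using Gamma_alg.const[of 1] by (simp add: p_prod_def Const_def)
next
  case (Cons r \<rho>)
  then show ?case
    using Gamma_alg.mult[OF Gamma_alg.power_sum[of r], of "p_prod \<rho>"] by (simp add: p_prod_def)
qed

lemma sum_Gamma_alg:
  "(\<And>i. i \<in> I \<Longrightarrow> f i \<in> Gamma_alg) \<Longrightarrow> (\<lambda>N. \<Sum>i\<in>I. f i N) \<in> Gamma_alg"
proof (induction I rule: infinite_finite_induct)
  case (insert i I)
  then show ?case using Gamma_alg.add[of "f i" "\<lambda>N. \<Sum>i\<in>I. f i N"] by simp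
qed (use Gamma_alg.const[of 0] in \<open>auto simp: Const_def\<close>)

lemma Gamma_alg_iff:
  "f \<in> Gamma_alg \<longleftrightarrow> (\<exists>c. Poly_Mapping.keys c \<subseteq> Collect odd_partition \<and> f = p_comb c)"
proof
  assume "f \<in> Gamma_alg"
  then show "\<exists>c. Poly_Mapping.keys c \<subseteq> Collect odd_partition \<and> f = p_comb c"
  proof induction
    case (const a)
    then show ?case
      by (intro exI[of _ "Poly_Mapping.single [] a"])
        (auto simp: p_comb_single p_prod_def odd_partition_def is_partition_def)
  next
    case (power_sum r)
    then show ?case
      by (intro exI[of _ "Poly_Mapping.single [r] 1"])
        (auto simp: p_comb_single p_prod_def odd_partition_def is_partition_def Const_def
          intro!: Nat.gr0I)
  next
    case (add f h)
    then obtain c d where "Poly_Mapping.keys c \<subseteq> Collect odd_partition" "f = p_comb c"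
      "Poly_Mapping.keys d \<subseteq> Collect odd_partition" "h = p_comb d" by blast
    then show ?case
      using Poly_Mapping.keys_add[of c d] by (intro exI[of _ "c + d"]) (auto simp: p_comb_add)
  next
    case (mult f h)
    then obtain c d where cd: "Poly_Mapping.keys c \<subseteq> Collect odd_partition" "f = p_comb c"
      "Poly_Mapping.keys d \<subseteq> Collect odd_partition" "h = p_comb d" by blast
    define e where "e = (\<Sum>\<rho>\<in>Poly_Mapping.keys c. \<Sum>\<sigma>\<in>Poly_Mapping.keys d.
      Poly_Mapping.single (rev (sort (\<rho> @ \<sigma>)))
        (Poly_Mapping.lookup c \<rho> * Poly_Mapping.lookup d \<sigma>))"
    have "Poly_Mapping.keys e \<subseteq> (\<Union>\<rho>\<in>Poly_Mapping.keys c. \<Union>\<sigma>\<in>Poly_Mapping.keys d.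
        {rev (sort (\<rho> @ \<sigma>))})"
      unfolding e_def
      by (intro order.trans[OF keys_sum] UN_mono order.refl) (auto split: if_splits)
    also have "\<dots> \<subseteq> Collect odd_partition"
      using cd(1,3) odd_partition_merge by blast
    finally have "Poly_Mapping.keys e \<subseteq> Collect odd_partition" .
    moreover have "f N * h N = p_comb e N" for N
    proof -
      have C: "Const (a * b) * (p * q) = (Const a * p) * (Const b * q)" for a b p q
      proof -
        have "Const (a * b) = Const a * Const b" by (simp add: Const_def mult_single)
        then show ?thesis by (simp add: ac_simps)
      qed
      show ?thesis
        by (simp only: cd(2,4) e_def p_comb_sum p_comb_single p_prod_mult C
            sum_product p_comb_def[of c] p_comb_def[of d])
    qed
    ultimately show ?case by auto
  qed
next
  assume "\<exists>c. Poly_Mapping.keys c \<subseteq> Collect odd_partition \<and> f = p_comb c"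
  then obtain c where c: "Poly_Mapping.keys c \<subseteq> Collect odd_partition" "f = p_comb c" by blast
  have "(\<lambda>N. \<Sum>\<rho>\<in>Poly_Mapping.keys c. Const (Poly_Mapping.lookup c \<rho>) * p_prod \<rho> N) \<in> Gamma_alg"
    using c(1) by (intro sum_Gamma_alg Gamma_alg.mult Gamma_alg.const p_prod_Gamma_alg)
      (auto simp: odd_partition_def)
  then show "f \<in> Gamma_alg" unfolding c(2) p_comb_def .
qed

definition p_coeffs :: "symfun \<Rightarrow> nat list \<Rightarrow>\<^sub>0 rat" where
  "p_coeffs f = (THE c. Poly_Mapping.keys c \<subseteq> Collect odd_partition \<and> f = p_comb c)"

definition scalar_prod :: "symfun \<Rightarrow> symfun \<Rightarrow> rat" where
  "scalar_prod f h = (\<Sum>\<rho>\<in>Poly_Mapping.keys (p_coeffs f).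
     Poly_Mapping.lookup (p_coeffs f) \<rho> * Poly_Mapping.lookup (p_coeffs h) \<rho> *
     (of_nat (z_part \<rho>) / 2 ^ length \<rho>))"

section \<open>Schur P- and Q-functions and factorial P-functions\<close>

text \<open>The symmetrization formula common to the P-functions (\<open>pw x k = x ^ k\<close>) and the factorial
  P-functions (\<open>pw = falling\<close>), for \<open>N \<ge> length \<mu>\<close>.\<close>
definition symmetrization ::
    "('a::field \<Rightarrow> nat \<Rightarrow> 'a) \<Rightarrow> nat \<Rightarrow> nat list \<Rightarrow> (nat \<Rightarrow> 'a) \<Rightarrow> 'a" where
  "symmetrization pw N \<mu> x = (1 / of_nat (fact (N - length \<mu>))) *
     (\<Sum>\<omega> | \<omega> permutes {..<N}.
        (\<Prod>i<length \<mu>. pw (x (\<omega> i)) (\<mu> ! i)) *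
        (\<Prod>i<length \<mu>. \<Prod>j\<in>{i<..<N}. (x (\<omega> i) + x (\<omega> j)) / (x (\<omega> i) - x (\<omega> j))))"

text \<open>The formula is an identity of rational functions whose value is a polynomial; the description
  operator picks that polynomial (unique, since polynomials embed in rational functions).\<close>
definition symmetrized_poly ::
    "(mpoly fract \<Rightarrow> nat \<Rightarrow> mpoly fract) \<Rightarrow> nat list \<Rightarrow> symfun" where
  "symmetrized_poly pw \<mu> = (\<lambda>N. if N < length \<mu> then 0 else
     (THE q. Fract q 1 = symmetrization pw N \<mu> (\<lambda>i. Fract (Var i) 1)))"

definition schur_P :: "nat list \<Rightarrow> symfun" where
  "schur_P = symmetrized_poly (\<lambda>x k. x ^ k)"

definition schur_Q :: "nat list \<Rightarrow> symfun" where
  "schur_Q \<mu> = (\<lambda>N. 2 ^ length \<mu> * schur_P \<mu> N)"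

definition factorial_P :: "nat list \<Rightarrow> symfun" where
  "factorial_P = symmetrized_poly falling"

definition X_char :: "nat list \<Rightarrow> nat list \<Rightarrow> rat" where
  "X_char \<mu> \<rho> = scalar_prod (p_prod \<rho>) (schur_Q \<mu>)"

definition frak_p :: "nat list \<Rightarrow> symfun" where
  "frak_p \<rho> = (\<lambda>N. \<Sum>\<mu>\<in>SP (sum_list \<rho>). Const (X_char \<mu> \<rho>) * factorial_P \<mu> N)"

end

theory Submission
  imports
    Defs
    "HOL-Library.FSet"
    "HOL-Library.Nat_Bijection"
    "HOL-Combinatorics.Multiset_Permutations"
    "Jordan_Normal_Form.Determinant"
begin

text \<open>
  Strict partitions index a basis of the Fock space of neutral fermions \<open>\<phi>\<^sub>n\<close>, on which the
  currents \<open>\<alpha>\<^sub>r = \<Sum>\<^sub>j (-1)\<^sup>j \<phi>\<^bsub>r-j\<^esub> \<phi>\<^sub>j\<close> (\<open>r\<close> an odd integer) satisfy \<open>[\<alpha>\<^sub>r, \<phi>\<^sub>n] = \<phi>\<^bsub>n+r\<^esub>\<close>. Hence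
  \<open>[\<alpha>\<^sub>-\<^sub>r, \<alpha>\<^sub>s]\<close> commutes with all fermions and is the scalar \<open>r/2\<close> if \<open>r = s\<close>, and \<open>0\<close> otherwise. As \<open>\<alpha>\<^sub>-\<^sub>r\<close> is
  adjoint to \<open>\<alpha>\<^sub>r\<close> for the weight \<open>2\<^bsup>-\<ell>\<^esup>\<close>, the vectors \<open>Y\<^sub>\<rho> = \<alpha>\<^bsub>\<rho>\<^sub>1\<^esub> \<alpha>\<^bsub>\<rho>\<^sub>2\<^esub> \<cdots> 1\<close> are orthogonal with
  squared norms \<open>2\<^bsup>-\<ell>(\<rho>)\<^esup> z\<^sub>\<rho>\<close>.

  Creating a part corresponds to one step of the symmetrization that defines the P-functions,
  and under this correspondence \<open>\<alpha>\<^sub>r\<close> becomes multiplication by \<open>p\<^sub>r\<close>, by a partial fraction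
  identity; so \<open>p\<^sub>\<rho> = \<Sum>\<^sub>\<lambda> Y\<^sub>\<rho>(\<lambda>) P\<^sub>\<lambda>\<close>, and orthogonality together with \<open>|SP\<^sub>n| \<le> |OP\<^sub>n|\<close> gives
  \<open>X\<^sup>\<lambda>\<^sub>\<rho> = Y\<^sub>\<rho>(\<lambda>)\<close>. For the factorial P-functions \<open>\<alpha>\<^sub>1\<close> becomes, in degree \<open>k\<close>, multiplication by
  \<open>p\<^sub>1 - k\<close>; evaluating at \<open>\<lambda>\<close> with \<open>|\<lambda>| = n\<close> and iterating until the vanishing property
  leaves only \<open>P\<^sup>*\<^sub>\<lambda>(\<lambda>)\<close>, one finds that the value of \<open>\<pp>\<^sub>\<rho>\<close> at \<open>\<lambda>\<close> times \<open>g\<^sup>\<lambda>\<close> is the falling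
  factorial of \<open>n\<close> of length \<open>|\<rho>|\<close> times the value of \<open>Y\<close> at \<open>\<lambda>\<close> for \<open>\<rho>\<close> with \<open>n - |\<rho>|\<close> parts \<open>1\<close> added. The
  expectation is then the inner product of two such vectors.
\<close>

section \<open>Neutral fermions\<close>

text \<open>A finite set \<open>S\<close> of positive integers stands for the strict partition with set of parts \<open>S\<close>,
  and a function of \<open>S\<close> for its coefficients in the basis of decreasing wedge products.
  For \<open>n > 0\<close>, \<open>\<phi>\<^sub>n\<close> creates the part \<open>n\<close> and \<open>\<phi>\<^sub>-\<^sub>n\<close> is \<open>(-1)\<^sup>n / 2\<close> times its annihilation,
  while \<open>\<phi>\<^sub>0\<close> is half the parity operator: in this normalisation
  \<open>\<phi>\<^sub>m \<phi>\<^sub>n + \<phi>\<^sub>n \<phi>\<^sub>m = (-1)\<^sup>m / 2\<close> if \<open>m + n = 0\<close> and \<open>0\<close> otherwise, for all integers.\<close>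

definition above_sign :: "nat \<Rightarrow> nat fset \<Rightarrow> rat" where
  "above_sign n S = (-1) ^ card {m \<in> fset S. n < m}"

definition alt_sign :: "int \<Rightarrow> rat" where
  "alt_sign j = (if even j then 1 else -1)"

text \<open>Operators act on coefficient functions, so they are read backwards: the value at
  \<open>S\<close> comes from the one basis vector that is sent to a multiple of \<open>S\<close>.
  Creating \<open>k\<close> looks at \<open>S\<close> without \<open>k\<close>, annihilating a part
  looks at \<open>S\<close> with that part added.\<close>

definition fermion_target :: "int \<Rightarrow> nat fset \<Rightarrow> nat fset" where
  "fermion_target k S =
     (if k > 0 then S |-| {|nat k|} else if k = 0 then S else finsert (nat (- k)) S)"

definition fermion_coef :: "int \<Rightarrow> nat fset \<Rightarrow> rat" where
  "fermion_coef k S =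
     (if k > 0 then (if nat k |\<in>| S then above_sign (nat k) S else 0)
      else if k = 0 then (-1) ^ fcard S / 2
      else (if nat (- k) |\<in>| S then 0 else alt_sign k / 2 * above_sign (nat (- k)) S))"

definition fermion :: "int \<Rightarrow> (nat fset \<Rightarrow> rat) \<Rightarrow> nat fset \<Rightarrow> rat" where
  "fermion k f S = fermion_coef k S * f (fermion_target k S)"

lemma fermion_add: "fermion k (\<lambda>S. f S + g S) = (\<lambda>S. fermion k f S + fermion k g S)"
  by (simp add: fun_eq_iff fermion_def algebra_simps)

lemma fermion_diff: "fermion k (\<lambda>S. f S - g S) = (\<lambda>S. fermion k f S - fermion k g S)"
  by (simp add: fun_eq_iff fermion_def algebra_simps)

lemma fermion_scale: "fermion k (\<lambda>S. c * f S) = (\<lambda>S. c * fermion k f S)"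
  by (simp add: fermion_def fun_eq_iff)

lemma fermion_zero: "fermion k (\<lambda>S. 0) = (\<lambda>S. 0)"
  by (simp add: fermion_def fun_eq_iff)

lemma above_sign_finsert:
  "k |\<notin>| S \<Longrightarrow> above_sign n (finsert k S) = (if n < k then - above_sign n S else above_sign n S)"
proof -
  assume k: "k |\<notin>| S"
  have "{m \<in> fset (finsert k S). n < m} =
      (if n < k then insert k {m \<in> fset S. n < m} else {m \<in> fset S. n < m})"
    by auto
  then show ?thesis using k by (simp add: above_sign_def)
qed

lemma above_sign_fminus:
  "k |\<in>| S \<Longrightarrow> above_sign n (S |-| {|k|}) = (if n < k then - above_sign n S else above_sign n S)"
  using above_sign_finsert[of k "S |-| {|k|}" n] by (auto simp: finsert_absorb split: if_splits)

lemma above_sign_square [simp]: "above_sign n S * above_sign n S = 1"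
  by (simp add: above_sign_def flip: power_mult_distrib)

lemma fcard_fminus: "k |\<in>| S \<Longrightarrow> (-1::rat) ^ fcard (S |-| {|k|}) = - ((-1) ^ fcard S)"
proof -
  assume "k |\<in>| S"
  then have "fcard S = Suc (fcard (S |-| {|k|}))" by (metis fcard_Suc_fminus1)
  then show ?thesis by simp
qed

lemma fcard_finsert: "k |\<notin>| S \<Longrightarrow> (-1::rat) ^ fcard (finsert k S) = - ((-1) ^ fcard S)"
  by (simp add: fcard_finsert_disjoint)

lemma alt_sign_simps [simp]:
  "alt_sign (- j) = alt_sign j" "alt_sign 0 = 1" "alt_sign j * alt_sign j = 1"
  "alt_sign j * (alt_sign j * x) = x"
  by (auto simp: alt_sign_def)

lemma alt_sign_diff: "alt_sign (i - j) = alt_sign i * alt_sign j"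
  by (auto simp: alt_sign_def)


lemma int_sign_cases:
  obtains (pos) a where "k = int a" "a > 0" | (zero) "k = 0" | (neg) a where "k = - int a" "a > 0"
proof (cases k "0::int" rule: linorder_cases)
  case less
  then obtain a where "- k = int a" "a > 0" by (metis zero_less_imp_eq_int neg_0_less_iff_less)
  then show ?thesis using neg[of a] by simp
next
  case greater
  then show ?thesis using pos by (metis zero_less_imp_eq_int)
qed (use zero in simp)

section \<open>Clifford relations\<close>

lemma fermion_pos:
  "a > 0 \<Longrightarrow> fermion (int a) f S = (if a |\<in>| S then above_sign a S * f (S |-| {|a|}) else 0)"
  by (simp add: fermion_def fermion_coef_def fermion_target_def)

lemma fermion_0: "fermion 0 f S = (-1) ^ fcard S / 2 * f S"
  by (simp add: fermion_def fermion_coef_def fermion_target_def)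

lemma fermion_neg:
  "a > 0 \<Longrightarrow> fermion (- int a) f S =
     (if a |\<in>| S then 0 else alt_sign (int a) / 2 * above_sign a S * f (finsert a S))"
  by (simp add: fermion_def fermion_coef_def fermion_target_def)

lemma clifford_pos_pos:
  assumes "a > 0" "b > 0"
  shows "fermion (int a) (fermion (int b) f) S = - fermion (int b) (fermion (int a) f) S"
proof -
  have "S |-| {|a|} |-| {|b|} = S |-| {|b|} |-| {|a|}" by auto
  then show ?thesis using assms
    by (auto simp: fermion_pos above_sign_fminus)
qed

lemma clifford_neg_neg:
  assumes "a > 0" "b > 0"
  shows "fermion (- int a) (fermion (- int b) f) S = - fermion (- int b) (fermion (- int a) f) S"
proof -
  have "finsert a (finsert b S) = finsert b (finsert a S)" by auto
  then show ?thesis using assms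
    by (auto simp: fermion_neg above_sign_finsert)
qed

text \<open>For \<open>a = b\<close> exactly one order survives at \<open>S\<close>, depending on
  whether \<open>a\<close> lies in \<open>S\<close>, and its two signs cancel. For
  \<open>a \<noteq> b\<close> the sign of the smaller index changes when the larger part is inserted
  or removed, so the two orders cancel.\<close>

lemma clifford_pos_neg:
  assumes "a > 0" "b > 0"
  shows "fermion (int a) (fermion (- int b) f) S + fermion (- int b) (fermion (int a) f) S =
    (if a = b then alt_sign (int a) / 2 * f S else 0)"
proof (cases "a = b")
  case True
  have "a |\<in>| S \<Longrightarrow> finsert a (S |-| {|a|}) = S" "a |\<notin>| S \<Longrightarrow> finsert a S |-| {|a|} = S" by auto
  then show ?thesis using assms True
    by (auto simp: fermion_pos fermion_neg above_sign_fminus above_sign_finsert)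
next
  case False
  then have "finsert b S |-| {|a|} = finsert b (S |-| {|a|})" by auto
  then show ?thesis using assms False
    by (auto simp: fermion_pos fermion_neg above_sign_fminus above_sign_finsert)
qed

lemma clifford:
  "fermion m (fermion n f) S + fermion n (fermion m f) S = (if m + n = 0 then alt_sign m / 2 * f S else 0)"
proof (cases m rule: int_sign_cases; cases n rule: int_sign_cases)
  fix a b assume "m = int a" "a > 0" "n = - int b" "b > 0"
  then show ?thesis using clifford_pos_neg[of a b f S] by simp
next
  fix a b assume "m = - int a" "a > 0" "n = int b" "b > 0"
  then show ?thesis using clifford_pos_neg[of b a f S] by (auto simp: add.commute)
next
  fix a b assume "m = int a" "a > 0" "n = int b" "b > 0"
  then show ?thesis using clifford_pos_pos[of a b f S] by simp
next
  fix a b assume "m = - int a" "a > 0" "n = - int b" "b > 0"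
  then show ?thesis using clifford_neg_neg[of a b f S] by simp
next
  fix a assume "m = int a" "a > 0" "n = 0"
  then show ?thesis by (simp add: fermion_pos fermion_0 fcard_fminus del: fcard_fminus_finsert)
next
  fix a assume "m = 0" "n = int a" "a > 0"
  then show ?thesis by (simp add: fermion_pos fermion_0 fcard_fminus del: fcard_fminus_finsert)
next
  fix a assume "m = - int a" "a > 0" "n = 0"
  then show ?thesis by (simp add: fermion_neg fermion_0 fcard_finsert)
next
  fix a assume "m = 0" "n = - int a" "a > 0"
  then show ?thesis by (simp add: fermion_neg fermion_0 fcard_finsert)
next
  assume "m = 0" "n = 0"
  have "(-1::rat) ^ fcard S * (-1) ^ fcard S = 1" by (simp flip: power_mult_distrib)
  then show ?thesis using \<open>m = 0\<close> \<open>n = 0\<close> by (simp add: fermion_0 field_simps)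
qed

lemma clifford_move:
  "fermion m (fermion n f) S = (if m + n = 0 then alt_sign m / 2 * f S else 0) - fermion n (fermion m f) S"
  using clifford[of m n f S] by linarith

text \<open>The infinite sum \<open>\<Sum>\<^sub>j (-1)\<^sup>j \<phi>\<^bsub>r-j\<^esub> \<phi>\<^sub>j\<close>, truncated: for odd \<open>r\<close> the summands with
  \<open>\<bar>j\<bar> > current_bound r S\<close> vanish at \<open>S\<close>.\<close>

definition current_bound :: "int \<Rightarrow> nat fset \<Rightarrow> int" where
  "current_bound r S = int (Max (insert 0 (fset S))) + \<bar>r\<bar>"

definition current :: "int \<Rightarrow> (nat fset \<Rightarrow> rat) \<Rightarrow> nat fset \<Rightarrow> rat" where
  "current r f S =
     (\<Sum>j\<in>{- current_bound r S..current_bound r S}. alt_sign j * fermion (r - j) (fermion j f) S)"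

lemma le_current_bound: "m |\<in>| S \<Longrightarrow> int m + \<bar>r\<bar> \<le> current_bound r S"
  by (simp add: current_bound_def)

lemma current_bound_nonneg: "\<bar>r\<bar> \<le> current_bound r S"
  by (simp add: current_bound_def)

text \<open>Beyond the bound one factor creates a part larger than all parts of \<open>S\<close>. If
  that factor acts first, the other one annihilates a different part because
  \<open>r \<noteq> 0\<close>, so the large part stays.\<close>

lemma current_summand_eq_0:
  assumes "odd r" "j \<notin> {- current_bound r S..current_bound r S}"
  shows "fermion (r - j) (fermion j f) S = 0"
proof (cases "j > current_bound r S")
  case True
  with current_bound_nonneg[of r S] have "j > 0" "r - j < 0" by linarith+
  then obtain a b where a: "j = int a" "a > 0" and b: "r - j = - int b" "b > 0"
    by (metis (no_types, opaque_lifting) add.inverse_inverse neg_0_less_iff_less zero_less_imp_eq_int)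
  have "a \<noteq> b" using a b assms(1) by auto
  moreover have "a |\<notin>| S" using le_current_bound[of a S r] True a by force
  ultimately show ?thesis unfolding b unfolding a using a b by (simp add: fermion_neg fermion_pos)
next
  case False
  then have j: "r - j > current_bound r S - \<bar>r\<bar>" using assms(2) by auto
  moreover have "r - j > 0" using False assms(2) current_bound_nonneg[of r S] by auto
  then obtain a where a: "r - j = int a" "a > 0" by (metis zero_less_imp_eq_int)
  have "a |\<notin>| S" using le_current_bound[of a S r] j a by force
  then show ?thesis unfolding a using a by (simp add: fermion_pos)
qed

text \<open>Allows currents at different sets, whose truncations differ, to be expanded over one
  common range.\<close>

lemma current_eq:
  assumes "odd r" "finite J" "{- current_bound r S..current_bound r S} \<subseteq> J"
  shows "current r f S = (\<Sum>j\<in>J. alt_sign j * fermion (r - j) (fermion j f) S)"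
  unfolding current_def using assms
  by (intro sum.mono_neutral_left) (auto simp: current_summand_eq_0)

lemma current_add: "current r (\<lambda>S. f S + g S) = (\<lambda>S. current r f S + current r g S)"
  by (simp add: fun_eq_iff current_def fermion_add sum.distrib distrib_left)

lemma current_scale: "current r (\<lambda>S. c * f S) = (\<lambda>S. c * current r f S)"
  by (simp add: fun_eq_iff current_def fermion_scale sum_distrib_left mult.left_commute)

lemma current_zero: "current r (\<lambda>S. 0) = (\<lambda>S. 0)"
  by (simp add: fun_eq_iff current_def fermion_zero)

lemma current_sum: "current r (\<lambda>S. \<Sum>i\<in>I. f i S) = (\<lambda>S. \<Sum>i\<in>I. current r (f i) S)"
  by (induction I rule: infinite_finite_induct) (simp_all add: current_zero current_add)

text \<open>Moving \<open>fermion n\<close> to the left through both factors of each summand leaves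
  contraction terms only at \<open>j = - n\<close> and \<open>j = r + n\<close>; each contributes
  half of \<open>fermion (n + r)\<close>.\<close>

lemma current_fermion:
  assumes "odd r"
  shows "current r (fermion n f) = (\<lambda>S. fermion n (current r f) S + fermion (n + r) f S)"
proof
  fix S
  \<comment> \<open>The range contains the truncations at \<open>S\<close> and at the set that
    \<open>fermion n\<close> reads, as well as both contraction indices.\<close>
  define L where "L = current_bound r S + current_bound r (fermion_target n S) + \<bar>n\<bar> + \<bar>r\<bar>"
  define J where "J = {- L..L}"
  have nonneg: "0 \<le> current_bound r S" "0 \<le> current_bound r (fermion_target n S)"
    using current_bound_nonneg[of r] by (meson abs_ge_zero order_trans)+
  then have J: "finite J" "{- current_bound r S..current_bound r S} \<subseteq> J"
    "{- current_bound r (fermion_target n S)..current_bound r (fermion_target n S)} \<subseteq> J"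
    "- n \<in> J" "r + n \<in> J"
    unfolding J_def L_def by auto
  let ?d = "\<lambda>j. (if j + n = 0 then alt_sign n / 2 * fermion (r - j) f S else 0)"
  let ?e = "\<lambda>j. (if r - j + n = 0 then alt_sign n / 2 * fermion j f S else 0)"
  have expand: "fermion (r - j) (fermion j (fermion n f)) S =
      fermion n (fermion (r - j) (fermion j f)) S + ?d j - ?e j" for j
  proof -
    have "fermion j (fermion n f) = (\<lambda>S. (if j + n = 0 then alt_sign n / 2 else 0) * f S - fermion n (fermion j f) S)"
      by (auto simp: fun_eq_iff clifford_move[of j n f] alt_sign_def) presburger+
    then have "fermion (r - j) (fermion j (fermion n f)) S =
        (if j + n = 0 then alt_sign n / 2 else 0) * fermion (r - j) f S - fermion (r - j) (fermion n (fermion j f)) S"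
      by (simp only: fermion_diff fermion_scale)
    also have "fermion (r - j) (fermion n (fermion j f)) S = ?e j - fermion n (fermion (r - j) (fermion j f)) S"
    proof -
      have "r - j + n = 0 \<Longrightarrow> alt_sign (r - j) = alt_sign n"
        by (metis add_eq_0_iff2 alt_sign_simps(1))
      then show ?thesis by (simp add: clifford_move[of "r - j" n])
    qed
    finally show ?thesis by simp
  qed
  have 1: "(\<Sum>j\<in>J. alt_sign j * ?d j) = fermion (n + r) f S / 2"
  proof -
    have "(\<Sum>j\<in>J. alt_sign j * ?d j) = (\<Sum>j\<in>J. if j = - n then fermion (n + r) f S / 2 else 0)"
      by (intro sum.cong) (auto simp: add_eq_0_iff2 add.commute)
    then show ?thesis using J by simp
  qed
  \<comment> \<open>Since \<open>r\<close> is odd, \<open>r + n\<close> and \<open>n\<close> have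
    opposite signs; the subtracted contraction thus supplies the second half with a plus
    sign.\<close>
  have 2: "(\<Sum>j\<in>J. alt_sign j * ?e j) = - fermion (n + r) f S / 2"
  proof -
    have "(\<Sum>j\<in>J. alt_sign j * ?e j) = (\<Sum>j\<in>J. if j = r + n then - fermion (n + r) f S / 2 else 0)"
      using assms by (intro sum.cong) (auto simp: add.commute alt_sign_def)
    then show ?thesis using J by simp
  qed
  have "fermion n (current r f) S =
      (\<Sum>j\<in>J. alt_sign j * fermion n (fermion (r - j) (fermion j f)) S)"
    by (subst fermion_def) (simp add: current_eq[OF assms J(1) J(3)] sum_distrib_left
        fermion_def[of n] mult.left_commute)
  then show "current r (fermion n f) S = fermion n (current r f) S + fermion (n + r) f S"
    using 1 2 by (simp add: current_eq[OF assms J(1) J(2)] expand distrib_left right_diff_distrib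
        sum.distrib sum_subtractf)
qed

section \<open>Commutators of currents\<close>

definition current_comm :: "int \<Rightarrow> int \<Rightarrow> (nat fset \<Rightarrow> rat) \<Rightarrow> nat fset \<Rightarrow> rat" where
  "current_comm r s f = (\<lambda>S. current r (current s f) S - current s (current r f) S)"

text \<open>Jacobi identity: both double commutators with \<open>\<phi>\<^sub>n\<close> are \<open>\<phi>\<^bsub>n+r+s\<^esub>\<close>.\<close>
lemma current_comm_fermion:
  assumes "odd r" "odd s"
  shows "current_comm r s (fermion n f) = fermion n (current_comm r s f)"
  by (simp add: current_comm_def current_fermion assms current_add fermion_diff algebra_simps)

definition vac :: "nat fset \<Rightarrow> rat" where
  "vac S = (if S = {||} then 1 else 0)"

lemma fermion_vac_neg: "n < 0 \<Longrightarrow> fermion n vac = (\<lambda>S. 0)"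
  by (auto simp: fermion_def fermion_target_def vac_def fun_eq_iff)

lemma fermion_vac_0: "fermion 0 vac = (\<lambda>S. vac S / 2)"
  by (auto simp: fermion_0 vac_def fun_eq_iff fcard_fempty)

text \<open>The two indices of a summand add up to \<open>r < 0\<close>, so one of them is negative.
  They anticommute as their sum is nonzero, and the negative one kills the vacuum.\<close>

lemma current_neg_vac:
  assumes "odd r" "r < 0"
  shows "current r vac = (\<lambda>S. 0)"
proof
  fix S
  have "fermion (r - j) (fermion j vac) S = 0" for j
  proof (cases "j > 0")
    case True
    then have "fermion (r - j) (fermion j vac) S = - fermion j (fermion (r - j) vac) S"
      using assms by (simp add: clifford_move[of "r - j" j])
    then show ?thesis using True assms by (simp add: fermion_vac_neg fermion_zero)
  next
    case False
    then show ?thesis using assms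
      by (cases "j = 0") (auto simp: fermion_vac_neg fermion_vac_0 fermion_zero
          fermion_scale[of _ "1/2", simplified])
  qed
  then show "current r vac S = 0" by (simp add: current_def)
qed

text \<open>Summands with a negative index vanish on the vacuum. The end terms \<open>j = 0\<close>
  and \<open>j = r\<close> contain \<open>fermion 0\<close>, which acts on the vacuum as 1/2, and
  together give one \<open>fermion r\<close>.\<close>

lemma current_pos_vac:
  assumes "odd r" "r > 0"
  shows "current r vac =
    (\<lambda>S. fermion r vac S + (\<Sum>j\<in>{0<..<r}. alt_sign j * fermion (r - j) (fermion j vac) S))"
proof
  fix S
  let ?t = "\<lambda>j. alt_sign j * fermion (r - j) (fermion j vac) S"
  define J where "J = {- current_bound r S - r..current_bound r S + r}"
  have J: "finite J" "{- current_bound r S..current_bound r S} \<subseteq> J" "{0..r} \<subseteq> J"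
    using assms current_bound_nonneg[of r S] by (auto simp: J_def)
  have zero: "?t j = 0" if "j \<notin> {0..r}" for j
  proof (cases "j < 0")
    case False
    then have "fermion (r - j) (fermion j vac) S = - fermion j (fermion (r - j) vac) S"
      using assms that by (simp add: clifford_move[of "r - j" j])
    then show ?thesis using False that by (simp add: fermion_vac_neg fermion_zero)
  qed (simp add: fermion_vac_neg fermion_zero)
  have "current r vac S = sum ?t J"
    using assms J by (simp add: current_eq)
  also have "\<dots> = sum ?t {0..r}"
    using J zero by (intro sum.mono_neutral_right) auto
  also have "{0..r} = insert 0 (insert r {0<..<r})" using assms by auto
  also have "sum ?t \<dots> = ?t 0 + ?t r + sum ?t {0<..<r}"
    using assms by (subst sum.insert; simp)+
  also have "?t 0 = fermion r vac S / 2"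
    by (simp add: fermion_vac_0 fermion_scale[of _ "1/2", simplified])
  also have "?t r = fermion r vac S / 2"
    using assms clifford_move[of 0 r vac S]
    by (simp add: fermion_vac_0 fermion_scale[of _ "1/2", simplified] alt_sign_def)
  finally show "current r vac S = fermion r vac S + sum ?t {0<..<r}" by simp
qed


text \<open>The size is an integer so that degrees can be lowered freely; negative degrees are
  empty.\<close>

definition strict_sets :: "int \<Rightarrow> nat fset set" where
  "strict_sets k = {S. 0 |\<notin>| S \<and> int (\<Sum>(fset S)) = k}"

definition homog :: "int \<Rightarrow> (nat fset \<Rightarrow> rat) \<Rightarrow> bool" where
  "homog k f \<longleftrightarrow> (\<forall>S. S \<notin> strict_sets k \<longrightarrow> f S = 0)"

lemma finite_strict_sets: "finite (strict_sets k)"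
proof (rule finite_subset)
  show "strict_sets k \<subseteq> fset -` Pow {..nat k}"
  proof
    fix S assume S: "S \<in> strict_sets k"
    have "m \<le> \<Sum>(fset S)" if "m |\<in>| S" for m
      using that by (intro member_le_sum) auto
    then show "S \<in> fset -` Pow {..nat k}" using S by (auto simp: strict_sets_def simp del: of_nat_sum)
  qed
  show "finite (fset -` Pow {..nat k})"
    by (intro finite_vimageI) (auto simp: inj_on_def fset_inject)
qed

lemma finsert_strict_sets:
  "a |\<notin>| S \<Longrightarrow> a > 0 \<Longrightarrow> finsert a S \<in> strict_sets (k + int a) \<longleftrightarrow> S \<in> strict_sets k"
  by (auto simp: strict_sets_def)

lemma fminus_strict_sets:
  assumes "a |\<in>| S" "a > 0"
  shows "S |-| {|a|} \<in> strict_sets k \<longleftrightarrow> S \<in> strict_sets (k + int a)"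
proof -
  have "finsert a (S |-| {|a|}) = S" using assms by auto
  then show ?thesis using finsert_strict_sets[of a "S |-| {|a|}" k] assms by auto
qed

lemma homog_vac: "homog 0 vac"
  by (auto simp: homog_def vac_def strict_sets_def)

lemma homog_fermion: "homog k f \<Longrightarrow> homog (k + n) (fermion n f)"
proof (cases n rule: int_sign_cases)
  case (pos a)
  assume "homog k f"
  then show ?thesis using pos by (auto simp: homog_def fermion_pos fminus_strict_sets)
next
  case (neg a)
  assume "homog k f"
  then show ?thesis using neg finsert_strict_sets[of a _ "k - int a"]
    by (auto simp: homog_def fermion_neg)
qed (auto simp: homog_def fermion_0)

lemma homog_current:
  assumes "homog k f"
  shows "homog (k + r) (current r f)"
proof -
  have "homog (k + r) (fermion (r - j) (fermion j f))" for j
    using homog_fermion[OF homog_fermion[OF assms, of j], of "r - j"] by simp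
  then show ?thesis by (auto simp: homog_def current_def)
qed

text \<open>A homogeneous vector is a finite combination of basis vectors, and each basis vector is
  obtained from the vacuum by creating its parts one by one, up to signs.\<close>

lemma homog_induct [consumes 1, case_names zero vac fermion scale add]:
  assumes "homog k f"
    and zero: "\<And>k. P k (\<lambda>S. 0)"
    and vac: "P 0 vac"
    and fermion: "\<And>k f n. n > 0 \<Longrightarrow> P k f \<Longrightarrow> P (k + int n) (fermion (int n) f)"
    and scale: "\<And>k f c. P k f \<Longrightarrow> P k (\<lambda>S. c * f S)"
    and add: "\<And>k f g. P k f \<Longrightarrow> P k g \<Longrightarrow> P k (\<lambda>S. f S + g S)"
  shows "P k f"
proof -
  have basis: "0 |\<notin>| T \<Longrightarrow> P (int (\<Sum>(fset T))) (\<lambda>S. if S = T then 1 else 0)" for T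
  proof (induction T)
    case empty
    then show ?case using vac by (simp add: vac_def[abs_def])
  next
    case (insert n T)
    have "finsert n T |-| {|n|} = T" "n |\<in>| S \<Longrightarrow> finsert n (S |-| {|n|}) = S" for S
      using insert.hyps by auto
    then have "(\<lambda>S. if S = finsert n T then 1 else 0) =
        (\<lambda>S. above_sign n (finsert n T) * fermion (int n) (\<lambda>S. if S = T then 1 else 0) S)"
      using insert.prems by (auto simp: fun_eq_iff fermion_pos)
    moreover have "int (\<Sum>(fset (finsert n T))) = int (\<Sum>(fset T)) + int n"
      using insert.hyps by simp
    moreover have "n > 0" using insert.prems by auto
    ultimately show ?case using insert.IH insert.prems by (auto intro!: scale fermion)
  qed
  have fin: "P k (\<lambda>S. \<Sum>T\<in>I. f T * (if S = T then 1 else 0))" if "I \<subseteq> strict_sets k" for I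
    using finite_subset[OF that finite_strict_sets] that
  proof (induction I rule: finite_induct)
    case (insert T I)
    have "P k (\<lambda>S. if S = T then 1 else 0)"
      using basis[of T] insert.prems by (auto simp: strict_sets_def)
    then show ?case using insert by (auto intro!: scale add)
  qed (simp add: zero)
  have "(\<Sum>T\<in>strict_sets k. f T * (if S = T then 1 else 0)) = f S" for S
    using assms(1) finite_strict_sets[of k] by (simp add: homog_def if_distrib[of "(*) _"] cong: if_cong)
  then show ?thesis using fin[OF order.refl] by simp
qed

text \<open>Sets containing 0 stand for no partition. Annihilating positive parts gives no
  information on coefficients there, so these are shown separately to remain zero.\<close>

lemma fermion_contains_0:
  "(\<And>T. 0 |\<in>| T \<Longrightarrow> f T = 0) \<Longrightarrow> 0 |\<in>| S \<Longrightarrow> fermion n f S = 0"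
  by (cases n rule: int_sign_cases) (auto simp: fermion_pos fermion_0 fermion_neg)

lemma current_contains_0:
  "(\<And>T. 0 |\<in>| T \<Longrightarrow> f T = 0) \<Longrightarrow> 0 |\<in>| S \<Longrightarrow> current n f S = 0"
  by (simp add: current_def fermion_contains_0)

text \<open>The commutator commutes with every annihilator, so its value on the vacuum is again
  killed by all of them and must be a multiple of the vacuum.\<close>

lemma current_comm_vac:
  assumes "odd r" "odd s"
  shows "current_comm r s vac = (\<lambda>S. current_comm r s vac {||} * vac S)"
proof
  fix S
  show "current_comm r s vac S = current_comm r s vac {||} * vac S"
  proof (cases "S = {||}")
    case False
    have 0: "0 |\<in>| T \<Longrightarrow> vac T = 0" for T by (auto simp: vac_def)
    have "current_comm r s vac S = 0"
    proof (cases "0 |\<in>| S")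
      case True
      then show ?thesis
        unfolding current_comm_def by (simp add: current_contains_0 0)
    next
      case z: False
      with False obtain n where n: "n |\<in>| S" "n > 0" by (metis all_not_fin_conv gr0I)
      \<comment> \<open>At \<open>S\<close> without \<open>n\<close>, annihilation of
        \<open>n\<close> reads off the coefficient at \<open>S\<close> up to a nonzero
        factor.\<close>
      have "finsert n (S |-| {|n|}) = S" using n by auto
      then have "fermion (- int n) (current_comm r s vac) (S |-| {|n|}) =
          alt_sign (int n) / 2 * above_sign n (S |-| {|n|}) * current_comm r s vac S"
        using n by (simp add: fermion_neg)
      moreover have "fermion (- int n) (current_comm r s vac) = (\<lambda>S. 0)"
        using n assms by (simp add: fermion_vac_neg current_zero
            current_comm_def[of _ _ "\<lambda>S. 0"] flip: current_comm_fermion)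
      ultimately show ?thesis by (auto simp: alt_sign_def above_sign_def split: if_splits)
    qed
    then show ?thesis using False by (simp add: vac_def)
  qed (simp add: vac_def)
qed

text \<open>The scalar found on the vacuum carries over to all vectors since the commutator passes
  through creation operators.\<close>

lemma current_comm_homog:
  assumes "homog k f" "odd r" "odd s"
  shows "current_comm r s f = (\<lambda>S. current_comm r s vac {||} * f S)"
  using assms(1)
proof (induction rule: homog_induct)
  case vac
  then show ?case using current_comm_vac assms by blast
next
  case (fermion k f n)
  then show ?case using assms by (simp add: current_comm_fermion fermion_scale)
next
  case (scale k f c)
  then show ?case by (simp add: current_comm_def current_scale fun_eq_iff right_diff_distrib[symmetric])
next
  case (add k f g)
  then show ?case by (simp add: current_comm_def current_add fun_eq_iff algebra_simps)
qed (simp add: current_comm_def current_zero)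

lemma fermion_fempty: "n > 0 \<Longrightarrow> fermion n f {||} = 0"
  by (simp add: fermion_def fermion_coef_def)

text \<open>The lowering current kills the vacuum, so only its action on
  \<open>current s vac\<close> counts. For \<open>r = s\<close>, \<open>fermion s vac\<close> and
  each of the \<open>s - 1\<close> products in \<open>current_pos_vac\<close> contribute
  1/2.\<close>

lemma current_comm_vac_fempty:
  assumes "odd r" "odd s" "r > 0" "s > 0"
  shows "current_comm (- r) s vac {||} = (if r = s then of_int r / 2 else 0)"
proof -
  have lower: "current (- r) (fermion n f) = (\<lambda>S. fermion n (current (- r) f) S + fermion (n - r) f S)"
    for n f using current_fermion[of "- r" n f] assms by simp
  have neg: "current (- r) vac = (\<lambda>S. 0)" using assms by (simp add: current_neg_vac)
  have one: "fermion (s - r) vac {||} = (if r = s then 1 / 2 else 0)"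
  proof (cases "r < s")
    case False
    then show ?thesis by (cases "r = s") (simp_all add: fermion_vac_0 fermion_vac_neg vac_def)
  qed (simp add: fermion_fempty)
  have two: "current (- r) (fermion (s - j) (fermion j vac)) {||} = (if r = s then alt_sign j / 2 else 0)"
    if "j \<in> {0<..<s}" for j
  proof -
    have "fermion (s - j - r) (fermion j vac) {||} = (if r = s then alt_sign j / 2 else 0)"
      using clifford_move[of "s - j - r" j vac "{||}"] that
      by (auto simp: fermion_fempty vac_def)
    then show ?thesis using that by (simp add: lower fermion_fempty)
  qed
  have "current_comm (- r) s vac {||} = current (- r) (current s vac) {||}"
    by (simp add: current_comm_def neg current_zero)
  also have "\<dots> = current (- r) (fermion s vac) {||} +
      (\<Sum>j\<in>{0<..<s}. alt_sign j * current (- r) (fermion (s - j) (fermion j vac)) {||})"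
    using assms by (simp add: current_pos_vac current_add current_sum current_scale)
  also have "(\<Sum>j\<in>{0<..<s}. alt_sign j * current (- r) (fermion (s - j) (fermion j vac)) {||}) =
      (\<Sum>j\<in>{0<..<s}. if r = s then 1 / 2 else 0)"
    using two by (intro sum.cong) auto
  also have "\<dots> = (if r = s then (of_int s - 1) / 2 else 0)"
    using assms by (simp add: of_nat_diff)
  also have "current (- r) (fermion s vac) {||} = fermion (s - r) vac {||}"
    by (simp add: lower neg fermion_zero)
  finally show ?thesis by (simp add: one field_simps)
qed

lemma current_lower_raise:
  assumes "homog k f" "odd r" "odd s"
  shows "current (- int r) (current (int s) f) =
    (\<lambda>S. current (int s) (current (- int r) f) S + (if r = s then of_nat r / 2 else 0) * f S)"
proof -
  have "r > 0" "s > 0" using assms by (auto intro: Nat.gr0I)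
  then have "current_comm (- int r) (int s) f = (\<lambda>S. (if r = s then of_nat r / 2 else 0) * f S)"
    using current_comm_homog[OF assms(1), of "- int r" "int s"]
      current_comm_vac_fempty[of "int r" "int s"] assms by simp
  then show ?thesis by (auto simp: current_comm_def fun_eq_iff algebra_simps dest: spec)
qed

section \<open>Adjoint operators and orthogonality\<close>

definition fock_inner :: "int \<Rightarrow> (nat fset \<Rightarrow> rat) \<Rightarrow> (nat fset \<Rightarrow> rat) \<Rightarrow> rat" where
  "fock_inner k f h = (\<Sum>S\<in>strict_sets k. f S * h S / 2 ^ fcard S)"

lemma fock_inner_commute: "fock_inner k f h = fock_inner k h f"
  by (simp add: fock_inner_def mult.commute)

text \<open>Deleting \<open>a\<close> matches the sets with \<open>a\<close> to those without it.
  The length drops by one, which the factor 1/2 in \<open>fermion (- int a)\<close> compensates; its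
  sign \<open>alt_sign\<close> remains.\<close>

lemma fock_inner_fermion_pos:
  assumes "a > 0"
  shows "fock_inner (k + int a) (fermion (int a) f) h = alt_sign (int a) * fock_inner k f (fermion (- int a) h)"
proof -
  have "fock_inner (k + int a) (fermion (int a) f) h =
      (\<Sum>S | S \<in> strict_sets (k + int a) \<and> a |\<in>| S. above_sign a S * f (S |-| {|a|}) * h S / 2 ^ fcard S)"
    unfolding fock_inner_def using assms
    by (intro sum.mono_neutral_cong_right) (auto simp: finite_strict_sets fermion_pos)
  also have "\<dots> = (\<Sum>S | S \<in> strict_sets k \<and> a |\<notin>| S.
      above_sign a S * f S * h (finsert a S) / 2 ^ Suc (fcard S))"
    using assms
    by (intro sum.reindex_bij_witness[of _ "finsert a" "\<lambda>S. S |-| {|a|}"])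
      (auto simp: finsert_strict_sets fminus_strict_sets above_sign_fminus finsert_absorb fcard_Suc_fminus1
        simp del: fcard_fminus_finsert power_Suc)
  also have "\<dots> = (\<Sum>S\<in>strict_sets k. alt_sign (int a) * (f S * fermion (- int a) h S / 2 ^ fcard S))"
    using assms by (intro sum.mono_neutral_cong_left) (auto simp: finite_strict_sets fermion_neg)
  finally show ?thesis by (simp add: fock_inner_def sum_distrib_left)
qed

lemma fock_inner_fermion:
  "fock_inner (k + n) (fermion n f) h = alt_sign n * fock_inner k f (fermion (- n) h)"
proof (cases n rule: int_sign_cases)
  case (neg a)
  then show ?thesis
    using fock_inner_fermion_pos[of a "k - int a" h f] by (simp add: fock_inner_commute)
next
  case zero
  then show ?thesis by (simp add: fock_inner_def fermion_0 mult.left_commute mult.assoc)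
qed (use fock_inner_fermion_pos in simp)

lemma fock_inner_sum: "fock_inner k (\<lambda>S. \<Sum>j\<in>J. c j * f j S) h = (\<Sum>j\<in>J. c j * fock_inner k (f j) h)"
  unfolding fock_inner_def sum_distrib_left sum_distrib_right sum_divide_distrib
  by (subst sum.swap) (simp add: mult.assoc)

text \<open>The adjoint of \<open>fermion (r - j)\<close> after \<open>fermion j\<close> is, up to
  sign, \<open>fermion (- j)\<close> after \<open>fermion (j - r)\<close>; replacing
  \<open>j - r\<close> by \<open>j\<close> yields the summands of
  \<open>current (- r)\<close>.\<close>

lemma fock_inner_current:
  assumes "odd r"
  shows "fock_inner (k + r) (current r f) h = fock_inner k f (current (- r) h)"
proof -
  \<comment> \<open>Wide enough that \<open>J\<close> contains all truncations in degree
    \<open>k + r\<close>, and \<open>J\<close> shifted by \<open>r\<close> contains those in degree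
    \<open>k\<close>.\<close>
  define J where "J = {- (\<bar>k\<bar> + 3 * \<bar>r\<bar>)..\<bar>k\<bar> + 3 * \<bar>r\<bar>}"
  have bound: "current_bound s S \<le> \<bar>l\<bar> + \<bar>s\<bar>" if "S \<in> strict_sets l" for S s l
  proof -
    have "m \<le> \<Sum>(fset S)" if "m |\<in>| S" for m
      using that by (intro member_le_sum) auto
    then have "Max (insert 0 (fset S)) \<le> \<Sum>(fset S)" by auto
    then show ?thesis using that by (auto simp: current_bound_def strict_sets_def simp del: of_nat_sum)
  qed
  let ?J = "(\<lambda>j. j - r) ` J"
  have "fock_inner (k + r) (current r f) h =
      fock_inner (k + r) (\<lambda>S. \<Sum>j\<in>J. alt_sign j * fermion (r - j) (fermion j f) S) h"
    unfolding fock_inner_def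
  proof (intro sum.cong refl)
    fix S assume "S \<in> strict_sets (k + r)"
    then have "current r f S = (\<Sum>j\<in>J. alt_sign j * fermion (r - j) (fermion j f) S)"
      using bound[of S "k + r" r] assms by (intro current_eq) (auto simp: J_def)
    then show "current r f S * h S / 2 ^ fcard S =
        (\<Sum>j\<in>J. alt_sign j * fermion (r - j) (fermion j f) S) * h S / 2 ^ fcard S" by simp
  qed
  also have "\<dots> = (\<Sum>j\<in>J. alt_sign j * fock_inner (k + r) (fermion (r - j) (fermion j f)) h)"
    by (rule fock_inner_sum)
  also have "\<dots> = (\<Sum>j\<in>J. alt_sign (j - r) * fock_inner k f (fermion (- j) (fermion (j - r) h)))"
  proof (intro sum.cong refl)
    fix j
    have "fock_inner (k + r) (fermion (r - j) (fermion j f)) h =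
        alt_sign (r - j) * fock_inner (k + j) (fermion j f) (fermion (j - r) h)"
      using fock_inner_fermion[of "k + j" "r - j" "fermion j f" h] by simp
    then show "alt_sign j * fock_inner (k + r) (fermion (r - j) (fermion j f)) h =
        alt_sign (j - r) * fock_inner k f (fermion (- j) (fermion (j - r) h))"
      by (simp add: fock_inner_fermion alt_sign_diff)
  qed
  also have "\<dots> = (\<Sum>j\<in>?J. alt_sign j * fock_inner k (fermion (- r - j) (fermion j h)) f)"
    by (subst sum.reindex) (auto simp: inj_on_def fock_inner_commute)
  also have "\<dots> = fock_inner k (\<lambda>S. \<Sum>j\<in>?J. alt_sign j * fermion (- r - j) (fermion j h) S) f"
    by (rule fock_inner_sum[symmetric])
  also have "\<dots> = fock_inner k (current (- r) h) f"
    unfolding fock_inner_def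
  proof (intro sum.cong refl)
    fix S assume "S \<in> strict_sets k"
    then have "{- current_bound (- r) S..current_bound (- r) S} \<subseteq> {- (\<bar>k\<bar> + \<bar>r\<bar>)..\<bar>k\<bar> + \<bar>r\<bar>}"
      using bound[of S k "- r"] by auto
    also have "\<dots> \<subseteq> ?J"
    proof
      fix j assume "j \<in> {- (\<bar>k\<bar> + \<bar>r\<bar>)..\<bar>k\<bar> + \<bar>r\<bar>}"
      then show "j \<in> ?J" by (intro image_eqI[of _ _ "j + r"]) (auto simp: J_def)
    qed
    finally have "current (- r) h S = (\<Sum>j\<in>?J. alt_sign j * fermion (- r - j) (fermion j h) S)"
      using assms by (intro current_eq) (auto simp: J_def)
    then show "(\<Sum>j\<in>?J. alt_sign j * fermion (- r - j) (fermion j h) S) * f S / 2 ^ fcard S =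
        current (- r) h S * f S / 2 ^ fcard S" by simp
  qed
  finally show ?thesis by (simp add: fock_inner_commute)
qed

text \<open>The vector \<open>Y\<^sub>\<rho>\<close>, which \<open>realize\<close> will send to the
  power sum product \<open>p\<^sub>\<rho>\<close>.\<close>

definition p_vector :: "nat list \<Rightarrow> nat fset \<Rightarrow> rat" where
  "p_vector \<rho> = foldr (\<lambda>r. current (int r)) \<rho> vac"

lemma p_vector_Nil [simp]: "p_vector [] = vac"
  and p_vector_Cons [simp]: "p_vector (r # \<rho>) = current (int r) (p_vector \<rho>)"
  by (simp_all add: p_vector_def)

lemma homog_p_vector: "homog (int (sum_list \<rho>)) (p_vector \<rho>)"
proof (induction \<rho>)
  case (Cons r \<rho>)
  then show ?case using homog_current[of "int (sum_list \<rho>)" "p_vector \<rho>" "int r"] by (simp add: add.commute)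
qed (simp add: homog_vac)

text \<open>A lowering current kills the vacuum and has scalar commutators with raising currents, so
  it acts as the derivation r/2 d/dp_r.\<close>

lemma current_lower_p_vector:
  assumes "odd r" "\<forall>s\<in>set \<sigma>. odd s"
  shows "current (- int r) (p_vector \<sigma>) =
    (\<lambda>S. \<Sum>i<length \<sigma>. if \<sigma> ! i = r then of_nat r / 2 * p_vector (take i \<sigma> @ drop (Suc i) \<sigma>) S else 0)"
  using assms(2)
proof (induction \<sigma>)
  case Nil
  then show ?case using assms by (simp add: current_neg_vac odd_pos)
next
  case (Cons s \<sigma>)
  have "current (int s) (\<lambda>S. \<Sum>i<length \<sigma>. if \<sigma> ! i = r then of_nat r / 2 * p_vector (take i \<sigma> @ drop (Suc i) \<sigma>) S else 0) =
     (\<lambda>S. \<Sum>i<length \<sigma>. if \<sigma> ! i = r then of_nat r / 2 * current (int s) (p_vector (take i \<sigma> @ drop (Suc i) \<sigma>)) S else 0)"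
  proof -
    have "current (int s) (\<lambda>S. if b then c * g S else 0) = (\<lambda>S. if b then c * current (int s) g S else 0)"
      for b c and g
      by (cases b) (simp_all add: current_scale current_zero)
    then show ?thesis by (simp add: current_sum)
  qed
  then have "current (int s) (current (- int r) (p_vector \<sigma>)) =
      (\<lambda>S. \<Sum>i<length \<sigma>. if \<sigma> ! i = r then of_nat r / 2 * current (int s) (p_vector (take i \<sigma> @ drop (Suc i) \<sigma>)) S else 0)"
    using Cons by simp
  then show ?case
    using Cons.prems assms unfolding length_Cons sum.lessThan_Suc_shift
    by (simp add: current_lower_raise[OF homog_p_vector] fun_eq_iff cong: if_cong)
qed

lemma z_part_Cons: "z_part (r # \<rho>) = z_part \<rho> * (r * Suc (count_list \<rho> r))"
proof -
  let ?F = "\<lambda>\<rho> s. s ^ count_list \<rho> s * fact (count_list \<rho> s) :: nat"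
  have rest: "(\<Prod>s\<in>set \<rho> - {r}. ?F (r # \<rho>) s) = (\<Prod>s\<in>set \<rho> - {r}. ?F \<rho> s)"
    by (intro prod.cong) auto
  have "z_part (r # \<rho>) = ?F (r # \<rho>) r * (\<Prod>s\<in>set \<rho> - {r}. ?F (r # \<rho>) s)"
    unfolding z_part_def by (subst prod.remove[of _ r]) simp_all
  also have "?F (r # \<rho>) r = ?F \<rho> r * (r * Suc (count_list \<rho> r))"
    by (simp add: algebra_simps)
  also have "(\<Prod>s\<in>set \<rho> - {r}. ?F (r # \<rho>) s) = (\<Prod>s\<in>set \<rho> - {r}. ?F \<rho> s)"
    by (rule rest)
  also have "?F \<rho> r * (r * Suc (count_list \<rho> r)) * (\<Prod>s\<in>set \<rho> - {r}. ?F \<rho> s) =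
      ?F \<rho> r * (\<Prod>s\<in>set \<rho> - {r}. ?F \<rho> s) * (r * Suc (count_list \<rho> r))"
    by (simp only: ac_simps)
  also have "?F \<rho> r * (\<Prod>s\<in>set \<rho> - {r}. ?F \<rho> s) = z_part \<rho>"
  proof (cases "r \<in> set \<rho>")
    case True
    then show ?thesis unfolding z_part_def by (subst prod.remove[of _ r]) simp_all
  next
    case False
    then show ?thesis unfolding z_part_def by (simp add: count_list_0_iff)
  qed
  finally show ?thesis .
qed

text \<open>The first current of \<open>\<rho>\<close> is moved to the other side, where it deletes
  one part \<open>r\<close> of \<open>\<sigma>\<close> in all possible ways with factor r/2. The
  number of these ways produces the recursion of \<open>z_part\<close>.\<close>

lemma fock_inner_p_vector:
  assumes "\<forall>r\<in>set \<rho>. odd r" "\<forall>s\<in>set \<sigma>. odd s"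
  shows "fock_inner (int (sum_list \<rho>)) (p_vector \<rho>) (p_vector \<sigma>) =
    (if mset \<rho> = mset \<sigma> then of_nat (z_part \<rho>) / 2 ^ length \<rho> else 0)"
  using assms
proof (induction \<rho> arbitrary: \<sigma>)
  case Nil
  have "fock_inner 0 vac f = f {||}" for f
  proof -
    have "fock_inner 0 vac f = (\<Sum>S\<in>{{||}}. vac S * f S / 2 ^ fcard S)"
      unfolding fock_inner_def
      by (intro sum.mono_neutral_right) (auto simp: finite_strict_sets vac_def, auto simp: strict_sets_def)
    then show ?thesis by (simp add: vac_def fcard_fempty)
  qed
  \<comment> \<open>In each summand one of the indices is positive and can be moved to the left, and
    a created part is absent from the empty set.\<close>
  moreover have "current (int s) f {||} = 0" if "odd s" for s f
  proof -
    have "fermion (int s - j) (fermion j f) {||} = 0" for j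
    proof (cases "j < int s")
      case False
      then show ?thesis
        using clifford_move[of "int s - j" j f "{||}"] that odd_pos[OF that]
        by (simp add: fermion_fempty)
    qed (simp add: fermion_fempty)
    then show ?thesis by (simp add: current_def)
  qed
  ultimately show ?case using Nil
    by (cases \<sigma>) (auto simp: vac_def[of "{||}"] z_part_def)
next
  case (Cons r \<rho>)
  let ?drop = "\<lambda>i. take i \<sigma> @ drop (Suc i) \<sigma>"
  let ?c = "if mset (r # \<rho>) = mset \<sigma> then of_nat (z_part \<rho>) / 2 ^ length \<rho> else 0 :: rat"
  have r: "odd r" using Cons.prems by simp
  have "fock_inner (int (sum_list (r # \<rho>))) (p_vector (r # \<rho>)) (p_vector \<sigma>) =
      fock_inner (int (sum_list \<rho>)) (current (- int r) (p_vector \<sigma>)) (p_vector \<rho>)"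
    using fock_inner_current[of "int r" "int (sum_list \<rho>)" "p_vector \<rho>" "p_vector \<sigma>"] r
    by (simp add: add.commute fock_inner_commute)
  also have "current (- int r) (p_vector \<sigma>) =
      (\<lambda>S. \<Sum>i<length \<sigma>. (if \<sigma> ! i = r then of_nat r / 2 else 0) * p_vector (?drop i) S)"
    using current_lower_p_vector[of r \<sigma>] Cons.prems by (auto simp: fun_eq_iff intro!: sum.cong)
  also have "fock_inner (int (sum_list \<rho>)) \<dots> (p_vector \<rho>) =
      (\<Sum>i<length \<sigma>. (if \<sigma> ! i = r then of_nat r / 2 else 0) *
        fock_inner (int (sum_list \<rho>)) (p_vector \<rho>) (p_vector (?drop i)))"
    by (subst fock_inner_sum) (simp add: fock_inner_commute)
  also have "\<dots> = (\<Sum>i<length \<sigma>. if \<sigma> ! i = r then of_nat r / 2 * ?c else 0)"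
  proof (intro sum.cong refl)
    fix i assume i: "i \<in> {..<length \<sigma>}"
    show "(if \<sigma> ! i = r then of_nat r / 2 else 0) *
        fock_inner (int (sum_list \<rho>)) (p_vector \<rho>) (p_vector (?drop i)) =
        (if \<sigma> ! i = r then of_nat r / 2 * ?c else 0)"
    proof (cases "\<sigma> ! i = r")
      case True
      have "mset \<sigma> = add_mset r (mset (?drop i))"
        using i True id_take_nth_drop[of i \<sigma>] by (metis lessThan_iff mset.simps(2) mset_append union_mset_add_mset_right)
      moreover have "\<forall>s\<in>set (?drop i). odd s"
        using Cons.prems by (auto dest: in_set_takeD in_set_dropD)
      ultimately show ?thesis using True Cons.IH[of "?drop i"] Cons.prems by simp
    qed simp
  qed
  also have "\<dots> = of_nat (count_list \<sigma> r) * (of_nat r / 2 * ?c)"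
  proof -
    have "{..<length \<sigma>} \<inter> {i. \<sigma> ! i = r} = {i. i < length \<sigma> \<and> r = \<sigma> ! i}" by auto
    then have "card ({..<length \<sigma>} \<inter> {i. \<sigma> ! i = r}) = count_list \<sigma> r"
      by (simp add: count_list_eq_length_filter length_filter_conv_card)
    then show ?thesis by (simp add: sum.If_cases)
  qed
  also have "\<dots> = (if mset (r # \<rho>) = mset \<sigma> then of_nat (z_part (r # \<rho>)) / 2 ^ length (r # \<rho>) else 0)"
  proof -
    have "count_list \<sigma> r = Suc (count_list \<rho> r)" if "mset (r # \<rho>) = mset \<sigma>"
      using arg_cong[OF that, of "\<lambda>M. count M r"] by (simp add: count_mset)
    then show ?thesis by (simp add: z_part_Cons field_simps)
  qed
  finally show ?case .
qed

section \<open>Schur operators and power sums\<close>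

definition kern :: "'a::field \<Rightarrow> 'a set \<Rightarrow> 'a" where
  "kern x X = (\<Prod>y\<in>X - {x}. (x + y) / (x - y))"

text \<open>One stage of the symmetrization: \<open>x\<close> is the variable receiving the exponent
  \<open>n\<close>, and the rest is symmetrized over the remaining variables. By symmetry a set of
  values suffices, whether these are formal variables or the parts of a partition.\<close>

definition schur_op :: "('a::field \<Rightarrow> nat \<Rightarrow> 'a) \<Rightarrow> nat \<Rightarrow> ('a set \<Rightarrow> 'a) \<Rightarrow> 'a set \<Rightarrow> 'a" where
  "schur_op pw n F X = (\<Sum>x\<in>X. pw x n * kern x X * F (X - {x}))"

definition schur_list :: "('a::field \<Rightarrow> nat \<Rightarrow> 'a) \<Rightarrow> nat list \<Rightarrow> 'a set \<Rightarrow> 'a" where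
  "schur_list pw a = foldr (schur_op pw) a (\<lambda>X. 1)"

definition desc :: "nat fset \<Rightarrow> nat list" where
  "desc S = rev (sorted_list_of_set (fset S))"

text \<open>Makes the factors of \<open>kern\<close> invertible, as the expansion of power sums
  requires.\<close>

definition no_antipodes :: "'a::field set \<Rightarrow> bool" where
  "no_antipodes X \<longleftrightarrow> finite X \<and> (\<forall>x\<in>X. \<forall>y\<in>X. x \<noteq> y \<longrightarrow> x + y \<noteq> 0)"

lemma no_antipodes_Diff: "no_antipodes X \<Longrightarrow> no_antipodes (X - Y)"
  by (auto simp: no_antipodes_def)

lemma schur_list_Nil [simp]: "schur_list pw [] X = 1"
  and schur_list_Cons: "schur_list pw (n # a) = schur_op pw n (schur_list pw a)"
  by (simp_all add: schur_list_def)

lemma schur_op_cong: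
  "finite X \<Longrightarrow> (\<And>Z. finite Z \<Longrightarrow> F Z = G Z) \<Longrightarrow> schur_op pw n F X = schur_op pw n G X"
  by (simp add: schur_op_def)

lemma schur_op_scale: "schur_op pw n (\<lambda>X. c * F X) X = c * schur_op pw n F X"
  by (simp add: schur_op_def sum_distrib_left mult.left_commute)

lemma schur_op_sum: "schur_op pw n (\<lambda>X. \<Sum>i\<in>I. F i X) X = (\<Sum>i\<in>I. schur_op pw n (F i) X)"
  unfolding schur_op_def sum_distrib_left by (rule sum.swap)

lemma kern_remove:
  assumes "finite X" "y \<in> X" "x \<noteq> y"
  shows "kern x X = (x + y) / (x - y) * kern x (X - {y})"
proof -
  have "X - {x} - {y} = X - {y} - {x}" by auto
  then show ?thesis
    unfolding kern_def using assms by (subst prod.remove[of _ y]) auto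
qed

lemma sum_Sigma_remove1:
  "finite X \<Longrightarrow> (\<Sum>x\<in>X. \<Sum>y\<in>X - {x}. G x y) = (\<Sum>x\<in>X. \<Sum>y\<in>X - {x}. G y x)"
  by (simp add: sum.Sigma)
    (rule sum.reindex_bij_witness[of _ "\<lambda>(x, y). (y, x)" "\<lambda>(x, y). (y, x)"], auto)

text \<open>Choosing \<open>x\<close> and then \<open>y\<close> differs from the opposite order only
  in the factor (x + y) / (x - y), which is antisymmetric.\<close>

lemma schur_op_anticommute:
  assumes "finite X"
  shows "schur_op pw m (schur_op pw n F) X = - schur_op pw n (schur_op pw m F) X"
proof -
  let ?K = "\<lambda>x y. kern x (X - {y}) * kern y (X - {x}) * F (X - {x} - {y})"
  let ?G = "\<lambda>m n x y. pw x m * pw y n * ((x + y) / (x - y)) * ?K x y"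
  have expand: "schur_op pw m (schur_op pw n F) X = (\<Sum>x\<in>X. \<Sum>y\<in>X - {x}. ?G m n x y)" for m n
    unfolding schur_op_def sum_distrib_left
  proof (intro sum.cong refl)
    fix x y assume "x \<in> X" "y \<in> X - {x}"
    then have "kern x X = (x + y) / (x - y) * kern x (X - {y})"
      using assms by (intro kern_remove) auto
    then show "pw x m * kern x X * (pw y n * kern y (X - {x}) * F (X - {x} - {y})) = ?G m n x y"
      by simp
  qed
  have "?G m n y x = - ?G n m x y" for x y
  proof -
    have "X - {y} - {x} = X - {x} - {y}" by auto
    moreover have "(y + x) / (y - x) = - ((x + y) / (x - y))"
      by (metis add.commute minus_diff_eq minus_divide_right)
    ultimately show ?thesis by simp
  qed
  then have "(\<Sum>x\<in>X. \<Sum>y\<in>X - {x}. ?G m n y x) = - (\<Sum>x\<in>X. \<Sum>y\<in>X - {x}. ?G n m x y)"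
    by (simp only: sum_negf)
  then show ?thesis unfolding expand using sum_Sigma_remove1[OF assms, of "?G m n"] by simp
qed

text \<open>Partial fraction expansion in \<open>z\<close>.\<close>
lemma prod_diff_over_add:
  assumes "finite Y" "\<And>y. y \<in> Y \<Longrightarrow> z + y \<noteq> 0"
  shows "(\<Prod>y\<in>Y. (z - y) / (z + y)) = 1 - (\<Sum>y\<in>Y. 2 * y / (z + y) * kern y Y)"
  using assms
proof (induction Y arbitrary: z rule: finite_induct)
  case (insert w Y)
  define K where "K y = 2 * y * kern y Y" for y
  \<comment> \<open>The kernel at the new point is the product for \<open>Y\<close> at
    \<open>z = - w\<close>, so the induction hypothesis is applied there too.\<close>
  have kern_w: "kern w (insert w Y) = (\<Prod>y\<in>Y. (- w - y) / (- w + y))"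
    using insert.hyps(2) unfolding kern_def
    by (intro prod.cong) (auto simp: divide_simps, (simp add: algebra_simps)?)
  have w: "(\<Prod>y\<in>Y. (- w - y) / (- w + y)) = 1 - (\<Sum>y\<in>Y. K y / (y - w))"
    using insert.IH[of "- w"] insert.hyps by (force simp: K_def)
  have kern_y: "kern y (insert w Y) = (y + w) / (y - w) * kern y Y" if "y \<in> Y" for y
    using that insert.hyps by (subst kern_remove[of _ w]) auto
  have zw: "z + w \<noteq> 0" using insert.prems by simp
  \<comment> \<open>Separates the poles at \<open>z = - w\<close> and
    \<open>z = - y\<close>.\<close>
  have split: "(z - w) / (z + w) * (K y / (z + y)) =
      (y + w) / (y - w) * (K y / (z + y)) - 2 * w / (z + w) * (K y / (y - w))" if "y \<in> Y" for y
  proof -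
    have "z + y \<noteq> 0" "y - w \<noteq> 0" using insert.prems insert.hyps that by auto
    then show ?thesis using zw by (simp add: divide_simps) (simp add: algebra_simps)
  qed
  have "(\<Prod>y\<in>insert w Y. (z - y) / (z + y)) = (z - w) / (z + w) * (1 - (\<Sum>y\<in>Y. K y / (z + y)))"
    using insert by (simp add: K_def)
  also have "\<dots> = (z - w) / (z + w) - (\<Sum>y\<in>Y. (z - w) / (z + w) * (K y / (z + y)))"
    by (simp add: right_diff_distrib sum_distrib_left)
  also have "\<dots> = (z - w) / (z + w) - ((\<Sum>y\<in>Y. (y + w) / (y - w) * (K y / (z + y)))
      - 2 * w / (z + w) * (\<Sum>y\<in>Y. K y / (y - w)))"
    by (simp only: sum.cong[OF refl split] sum_subtractf sum_distrib_left)
  also have "(z - w) / (z + w) = 1 - 2 * w / (z + w)" using zw by (simp add: field_simps)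
  also have "1 - 2 * w / (z + w) - ((\<Sum>y\<in>Y. (y + w) / (y - w) * (K y / (z + y)))
      - 2 * w / (z + w) * (\<Sum>y\<in>Y. K y / (y - w))) =
      1 - (2 * w / (z + w) * (1 - (\<Sum>y\<in>Y. K y / (y - w))) + (\<Sum>y\<in>Y. (y + w) / (y - w) * (K y / (z + y))))"
    by (simp add: algebra_simps)
  also have "\<dots> = 1 - (\<Sum>y\<in>insert w Y. 2 * y / (z + y) * kern y (insert w Y))"
    using insert.hyps by (simp add: kern_w[unfolded w] kern_y K_def mult.commute mult.left_commute)
  finally show ?case .
qed simp

lemma power_diff_Suc: "i < m \<Longrightarrow> x ^ (m - i) = x * (x::'a::field) ^ (m - Suc i)"
  by (simp flip: power_Suc add: Suc_diff_Suc)

lemma alternating_geometric_sum: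
  fixes x y :: "'a::field"
  assumes "odd r"
  shows "(x + y) * (\<Sum>b\<in>{0<..<r}. (-1) ^ b * (x ^ (r - b) * y ^ b)) = x * y ^ r - x ^ r * y"
proof -
  obtain m where r: "r = Suc (2 * m)" using assms by (metis oddE Suc_eq_plus1)
  have "{0<..<r} = Suc ` {..<2 * m}"
    by (auto simp: r image_iff Suc_less_eq2 gr0_conv_Suc)
  then have "(\<Sum>b\<in>{0<..<r}. (-1) ^ b * (x ^ (r - b) * y ^ b)) =
      - x * y * (\<Sum>i<2 * m. x ^ (2 * m - Suc i) * (- y) ^ i)"
    by (simp add: sum.reindex r sum_distrib_left power_minus[of y] flip: sum_negf)
      (intro sum.cong refl, simp add: power_diff_Suc)
  also have "(x + y) * \<dots> = - x * y * ((x - (- y)) * (\<Sum>i<2 * m. x ^ (2 * m - Suc i) * (- y) ^ i))"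
    by (simp add: algebra_simps)
  also have "\<dots> = - x * y * (x ^ (2 * m) - (- y) ^ (2 * m))"
  proof -
    have "(x - (- y)) * S = - ((- y - x) * S)" for S by (simp add: algebra_simps)
    then show ?thesis by (simp only: power_diff_sumr2[symmetric]) simp
  qed
  finally show ?thesis by (simp add: r algebra_simps)
qed

text \<open>The right-hand side has the shape of \<open>current_pos_vac\<close>. The sum over
  \<open>b\<close> is geometric and absorbs the factor \<open>x + y\<close> of the kernel. After
  symmetrizing in \<open>x\<close> and \<open>y\<close>, the inner sum is the partial fraction
  expansion at \<open>z = x\<close>, whose product is the inverse of
  \<open>kern x X\<close>.\<close>

lemma power_sum_schur_op:
  fixes X :: "'a::field set"
  assumes X: "no_antipodes X" and "odd r"
  shows "(\<Sum>x\<in>X. x ^ r) = schur_op (^) r (\<lambda>X. 1) X +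
    (\<Sum>b\<in>{0<..<r}. (-1) ^ b * schur_op (^) (r - b) (schur_op (^) b (\<lambda>X. 1)) X)"
proof -
  have fin: "finite X" using X by (simp add: no_antipodes_def)
  define K where "K x y = kern x (X - {y}) * kern y (X - {x})" for x y
  have "(\<Sum>b\<in>{0<..<r}. (-1) ^ b * schur_op (^) (r - b) (schur_op (^) b (\<lambda>X. 1)) X) =
      (\<Sum>b\<in>{0<..<r}. \<Sum>x\<in>X. \<Sum>y\<in>X - {x}. (-1) ^ b * (x ^ (r - b) * y ^ b) * (kern x X * kern y (X - {x})))"
    by (simp add: schur_op_def sum_distrib_left ac_simps)
  also have "\<dots> = (\<Sum>x\<in>X. \<Sum>y\<in>X - {x}. \<Sum>b\<in>{0<..<r}. (-1) ^ b * (x ^ (r - b) * y ^ b) * (kern x X * kern y (X - {x})))"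
    by (subst sum.swap, intro sum.cong refl, subst sum.swap) (rule refl)
  also have "\<dots> = (\<Sum>x\<in>X. \<Sum>y\<in>X - {x}. x * y ^ r / (x - y) * K x y + x ^ r * y / (y - x) * K x y)"
  proof (intro sum.cong refl)
    fix x y assume xy: "x \<in> X" "y \<in> X - {x}"
    then have ne: "x + y \<noteq> 0" "x - y \<noteq> 0" "y - x \<noteq> 0" using X by (auto simp: no_antipodes_def)
    have kern_x: "kern x X = (x + y) / (x - y) * kern x (X - {y})"
      using xy fin by (intro kern_remove) auto
    have "(\<Sum>b\<in>{0<..<r}. (-1) ^ b * (x ^ (r - b) * y ^ b) * (kern x X * kern y (X - {x}))) =
        ((x + y) * (\<Sum>b\<in>{0<..<r}. (-1) ^ b * (x ^ (r - b) * y ^ b))) / (x - y) * K x y"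
      unfolding kern_x K_def sum_distrib_right[symmetric] by simp
    also have "\<dots> = x * y ^ r / (x - y) * K x y - x ^ r * y / (x - y) * K x y"
      by (simp add: alternating_geometric_sum[OF assms(2)] diff_divide_distrib left_diff_distrib)
    also have "x ^ r * y / (x - y) = - (x ^ r * y / (y - x))"
      by (metis minus_diff_eq minus_divide_right)
    finally show "(\<Sum>b\<in>{0<..<r}. (-1) ^ b * (x ^ (r - b) * y ^ b) * (kern x X * kern y (X - {x}))) =
        x * y ^ r / (x - y) * K x y + x ^ r * y / (y - x) * K x y" by simp
  qed
  \<comment> \<open>Interchanging \<open>x\<close> and \<open>y\<close> turns the first summand into
    the second.\<close>
  also have "\<dots> = (\<Sum>x\<in>X. \<Sum>y\<in>X - {x}. 2 * (x ^ r * y / (y - x) * K x y))"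
  proof -
    have "(\<Sum>x\<in>X. \<Sum>y\<in>X - {x}. x * y ^ r / (x - y) * K x y) =
        (\<Sum>x\<in>X. \<Sum>y\<in>X - {x}. x ^ r * y / (y - x) * K x y)"
      by (subst sum_Sigma_remove1[OF fin]) (simp add: K_def ac_simps)
    then show ?thesis by (simp add: sum.distrib sum_distrib_left)
  qed
  also have "\<dots> = (\<Sum>x\<in>X. - (x ^ r * kern x X) * (\<Sum>y\<in>X - {x}. 2 * y / (x + y) * kern y (X - {x})))"
    unfolding sum_distrib_left
  proof (intro sum.cong refl)
    fix x y assume xy: "x \<in> X" "y \<in> X - {x}"
    then have ne: "x + y \<noteq> 0" "x - y \<noteq> 0" "y - x \<noteq> 0" using X by (auto simp: no_antipodes_def)
    have "kern x X = (x + y) / (x - y) * kern x (X - {y})"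
      using xy fin by (intro kern_remove) auto
    also have "(x + y) / (x - y) = - ((x + y) / (y - x))"
      by (metis minus_diff_eq minus_divide_right)
    finally have kern_x: "kern x X = - ((x + y) / (y - x)) * kern x (X - {y})" .
    show "2 * (x ^ r * y / (y - x) * K x y) =
        - (x ^ r * kern x X) * (2 * y / (x + y) * kern y (X - {x}))"
      unfolding kern_x using ne by (simp add: K_def)
  qed
  also have "\<dots> = (\<Sum>x\<in>X. - (x ^ r * kern x X) * (1 - (\<Prod>y\<in>X - {x}. (x - y) / (x + y))))"
  proof (intro sum.cong refl)
    fix x assume "x \<in> X"
    then have "x + y \<noteq> 0" if "y \<in> X - {x}" for y using X that by (auto simp: no_antipodes_def)
    then show "- (x ^ r * kern x X) * (\<Sum>y\<in>X - {x}. 2 * y / (x + y) * kern y (X - {x})) =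
        - (x ^ r * kern x X) * (1 - (\<Prod>y\<in>X - {x}. (x - y) / (x + y)))"
      using fin by (subst prod_diff_over_add) auto
  qed
  also have "\<dots> = (\<Sum>x\<in>X. x ^ r) - schur_op (^) r (\<lambda>X. 1) X"
    unfolding schur_op_def sum_subtractf[symmetric]
  proof (intro sum.cong refl)
    fix x assume x: "x \<in> X"
    have "kern x X * (\<Prod>y\<in>X - {x}. (x - y) / (x + y)) = 1"
      unfolding kern_def prod.distrib[symmetric]
      using X x by (intro prod.neutral) (auto simp: no_antipodes_def)
    then show "- (x ^ r * kern x X) * (1 - (\<Prod>y\<in>X - {x}. (x - y) / (x + y))) = x ^ r - x ^ r * kern x X * 1"
      by (simp add: algebra_simps)
  qed
  finally show ?thesis by simp
qed

section \<open>From the Fock space to symmetric functions\<close>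

lemma desc_unique:
  assumes "sorted_wrt (>) a" "set a = fset S"
  shows "desc S = a"
proof -
  have "sorted_wrt (<) (rev a)" using assms(1) by (simp add: sorted_wrt_rev)
  then have "sorted (rev a)" "distinct (rev a)" by (simp_all add: strict_sorted_iff)
  then show ?thesis
    using sorted_list_of_set.idem_if_sorted_distinct[of "rev a"] assms(2) by (simp add: desc_def)
qed

lemma sorted_desc: "sorted_wrt (>) (desc S)"
  by (simp add: desc_def sorted_wrt_rev)

lemma set_desc [simp]: "set (desc S) = fset S"
  by (simp add: desc_def)

text \<open>Fock space coefficients are rational, while variables live in a field over the
  rationals: a field of fractions for identities of polynomials, or the rationals for values at
  partitions. The embedding also forces characteristic 0.\<close>

locale rat_hom =
  fixes h :: "rat \<Rightarrow> 'a::field"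
  assumes one: "h 1 = 1" and add: "h (a + b) = h a + h b" and mult: "h (a * b) = h a * h b"
begin

lemma zero: "h 0 = 0"
proof -
  have "h (0 + 0) = h 0 + h 0" by (rule add)
  then show ?thesis by (metis add_cancel_right_right add.right_neutral)
qed

lemma uminus: "h (- a) = - h a"
  using add[of a "- a"] by (simp add: zero add_eq_0_iff)

lemma sum: "h (\<Sum>i\<in>I. f i) = (\<Sum>i\<in>I. h (f i))"
  by (induction I rule: infinite_finite_induct) (simp_all add: zero add)

lemma power: "h (a ^ n) = h a ^ n"
  by (induction n) (simp_all add: one mult)

lemma of_nat: "h (of_nat n) = of_nat n"
  by (induction n) (simp_all add: zero one add)

lemma of_nat_neq_0: "n \<noteq> 0 \<Longrightarrow> of_nat n \<noteq> (0 :: 'a)"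
proof
  assume n: "n \<noteq> 0" "of_nat n = (0 :: 'a)"
  have "h (of_nat n * (1 / of_nat n)) = 0" unfolding mult of_nat n by simp
  then show False using n one by simp
qed

definition schur_set :: "('a \<Rightarrow> nat \<Rightarrow> 'a) \<Rightarrow> nat fset \<Rightarrow> 'a set \<Rightarrow> 'a" where
  "schur_set pw S = schur_list pw (desc S)"

text \<open>The new operator is carried by anticommutation to its place in the decreasing order,
  with one sign for each larger entry passed. Meeting an equal entry it gives 0, since an operator
  equal to minus itself vanishes in characteristic 0.\<close>

lemma schur_op_desc_list:
  fixes pw :: "'a \<Rightarrow> nat \<Rightarrow> 'a"
  assumes "sorted_wrt (>) a" "finite X"
  shows "schur_op pw n (schur_list pw a) X =
    (if n \<in> set a then 0
     else (-1) ^ length (filter (\<lambda>m. n < m) a) *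
       schur_list pw (filter (\<lambda>m. n < m) a @ n # filter (\<lambda>m. m < n) a) X)"
  using assms
proof (induction a arbitrary: X)
  case (Cons m a)
  consider "n > m" | "n = m" | "n < m" by linarith
  then show ?case
  proof cases
    case 1
    have "filter (\<lambda>m. n < m) a = []" "filter (\<lambda>m. m < n) a = a" "n \<notin> set a"
      using Cons.prems(1) 1 by (fastforce simp: filter_empty_conv filter_id_conv)+
    then show ?thesis using 1 by (simp add: schur_list_Cons)
  next
    case 2
    have "schur_op pw n (schur_op pw n (schur_list pw a)) X = 0"
    proof -
      have "2 * schur_op pw n (schur_op pw n (schur_list pw a)) X = 0"
        using schur_op_anticommute[OF Cons.prems(2), of pw n n "schur_list pw a"] by simp
      then show ?thesis using of_nat_neq_0[of 2] by simp
    qed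
    then show ?thesis using 2 by (simp add: schur_list_Cons)
  next
    case 3
    let ?b = "filter (\<lambda>m. n < m) a @ n # filter (\<lambda>m. m < n) a"
    let ?c = "if n \<in> set a then 0 else (-1) ^ length (filter (\<lambda>m. n < m) a) :: 'a"
    have "schur_op pw n (schur_list pw (m # a)) X = - schur_op pw m (schur_op pw n (schur_list pw a)) X"
      unfolding schur_list_Cons using Cons.prems(2) by (rule schur_op_anticommute)
    also have "schur_op pw m (schur_op pw n (schur_list pw a)) X =
        schur_op pw m (\<lambda>X. ?c * schur_list pw ?b X) X"
      using Cons by (intro schur_op_cong) auto
    also have "\<dots> = ?c * schur_op pw m (schur_list pw ?b) X" by (rule schur_op_scale)
    finally show ?thesis using 3 by (simp add: schur_list_Cons)
  qed
qed (simp add: schur_list_Cons)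

lemma schur_op_schur_set:
  assumes "finite X"
  shows "schur_op pw n (schur_set pw S) X =
    (if n |\<in>| S then 0 else h (above_sign n S) * schur_set pw (finsert n S) X)"
proof (cases "n |\<in>| S")
  case False
  let ?a = "desc S"
  have "sorted_wrt (>) (filter (\<lambda>m. n < m) ?a @ n # filter (\<lambda>m. m < n) ?a)"
    using sorted_desc[of S] by (auto simp: sorted_wrt_append sorted_wrt_filter)
  moreover have "set (filter (\<lambda>m. n < m) ?a @ n # filter (\<lambda>m. m < n) ?a) = fset (finsert n S)"
    using False by auto
  ultimately have "desc (finsert n S) = filter (\<lambda>m. n < m) ?a @ n # filter (\<lambda>m. m < n) ?a"
    by (rule desc_unique)
  moreover have "length (filter (\<lambda>m. n < m) ?a) = card {m \<in> fset S. n < m}"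
    by (subst distinct_length_filter) (auto simp: desc_def Int_def conj_commute)
  ultimately show ?thesis
    using False assms schur_op_desc_list[OF sorted_desc assms, of pw n S]
    by (simp add: schur_set_def above_sign_def power uminus one)
qed (use schur_op_desc_list[OF sorted_desc assms, of pw n S] in \<open>simp add: schur_set_def\<close>)

definition realize :: "('a \<Rightarrow> nat \<Rightarrow> 'a) \<Rightarrow> int \<Rightarrow> (nat fset \<Rightarrow> rat) \<Rightarrow> 'a set \<Rightarrow> 'a" where
  "realize pw k f X = (\<Sum>S\<in>strict_sets k. h (f S) * schur_set pw S X)"

lemma realize_zero: "realize pw k (\<lambda>S. 0) X = 0"
  by (simp add: realize_def zero)

lemma realize_add: "realize pw k (\<lambda>S. f S + g S) X = realize pw k f X + realize pw k g X"
  by (simp add: realize_def add distrib_right sum.distrib)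

lemma realize_scale: "realize pw k (\<lambda>S. c * f S) X = h c * realize pw k f X"
  by (simp add: realize_def mult sum_distrib_left mult.assoc)

lemma realize_sum: "realize pw k (\<lambda>S. \<Sum>i\<in>I. f i S) X = (\<Sum>i\<in>I. realize pw k (f i) X)"
  by (induction I rule: infinite_finite_induct) (simp_all add: realize_zero realize_add)

lemma realize_vac: "realize pw 0 vac X = 1"
proof -
  have "realize pw 0 vac X = (\<Sum>S\<in>{{||}}. h (vac S) * schur_set pw S X)"
    unfolding realize_def by (intro sum.mono_neutral_right)
      (auto simp: finite_strict_sets vac_def zero, auto simp: strict_sets_def)
  then show ?thesis by (simp add: vac_def one schur_set_def desc_def)
qed

lemma realize_fermion:
  assumes "n > 0" "finite X"
  shows "realize pw (k + int n) (fermion (int n) f) X = schur_op pw n (realize pw k f) X"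
proof -
  have "realize pw (k + int n) (fermion (int n) f) X =
      (\<Sum>S | S \<in> strict_sets (k + int n) \<and> n |\<in>| S. h (above_sign n S * f (S |-| {|n|})) * schur_set pw S X)"
    unfolding realize_def using assms
    by (intro sum.mono_neutral_cong_right) (auto simp: finite_strict_sets fermion_pos zero)
  also have "\<dots> = (\<Sum>S | S \<in> strict_sets k \<and> n |\<notin>| S. h (above_sign n S * f S) * schur_set pw (finsert n S) X)"
    using assms
    by (intro sum.reindex_bij_witness[of _ "finsert n" "\<lambda>S. S |-| {|n|}"])
      (auto simp: finsert_strict_sets fminus_strict_sets above_sign_fminus finsert_absorb)
  also have "\<dots> = (\<Sum>S\<in>strict_sets k. h (f S) * schur_op pw n (schur_set pw S) X)"
    using assms by (intro sum.mono_neutral_cong_left)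
      (auto simp: finite_strict_sets schur_op_schur_set mult ac_simps)
  also have "\<dots> = schur_op pw n (realize pw k f) X"
    unfolding realize_def by (simp add: schur_op_sum schur_op_scale)
  finally show ?thesis .
qed

text \<open>Covers powers, with \<open>c\<close> and \<open>d\<close> zero, and falling factorials,
  with \<open>r = 1\<close>, where x - n raises the n-th falling factorial to the next and
  \<open>c\<close> is the degree. Multiplication by p_r obeys the same Leibniz rule as
  \<open>current_fermion\<close>.\<close>

lemma realize_current:
  assumes "odd r" "homog k f" "no_antipodes X"
    and pw: "\<And>x n. pw x n * (x ^ r - d n) = pw x (n + r)"
    and c: "c 0 = 0" "\<And>k n. c (k + int n) = c k + d n"
    and base: "\<And>X. no_antipodes X \<Longrightarrow> (\<Sum>x\<in>X. x ^ r) = realize pw (int r) (current (int r) vac) X"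
  shows "((\<Sum>x\<in>X. x ^ r) - c k) * realize pw k f X = realize pw (k + int r) (current (int r) f) X"
  using assms(2,3)
proof (induction arbitrary: X rule: homog_induct)
  case (fermion k f n)
  have fin: "finite X" using fermion.prems by (simp add: no_antipodes_def)
  let ?p = "\<lambda>X. \<Sum>x\<in>X. x ^ r"
  have "(?p X - c (k + int n)) * realize pw (k + int n) (fermion (int n) f) X =
      (\<Sum>x\<in>X. pw x n * kern x X * ((?p X - c (k + int n)) * realize pw k f (X - {x})))"
    using fermion.hyps fin by (simp add: realize_fermion schur_op_def sum_distrib_left ac_simps)
  also have "\<dots> = (\<Sum>x\<in>X. pw x (n + r) * kern x X * realize pw k f (X - {x}) +
      pw x n * kern x X * realize pw (k + int r) (current (int r) f) (X - {x}))"
  proof (intro sum.cong refl)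
    fix x assume x: "x \<in> X"
    \<comment> \<open>The chosen variable takes the part \<open>d n\<close> of the correction and
      has its exponent raised; the other variables are left to the induction hypothesis.\<close>
    have split: "?p X - c (k + int n) = (x ^ r - d n) + (?p (X - {x}) - c k)"
      using x fin by (simp add: c sum.remove[of X x])
    have "pw x n * kern x X * ((?p X - c (k + int n)) * realize pw k f (X - {x})) =
        (pw x n * (x ^ r - d n)) * kern x X * realize pw k f (X - {x}) +
        pw x n * kern x X * ((?p (X - {x}) - c k) * realize pw k f (X - {x}))"
      unfolding split by (simp add: algebra_simps)
    then show "pw x n * kern x X * ((?p X - c (k + int n)) * realize pw k f (X - {x})) =
        pw x (n + r) * kern x X * realize pw k f (X - {x}) +
        pw x n * kern x X * realize pw (k + int r) (current (int r) f) (X - {x})"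
      using fermion.IH[OF no_antipodes_Diff[OF fermion.prems]] by (simp add: pw)
  qed
  also have "\<dots> = realize pw (k + int (n + r)) (fermion (int (n + r)) f) X +
      realize pw (k + int r + int n) (fermion (int n) (current (int r) f)) X"
    using fermion.hyps fin by (simp add: realize_fermion schur_op_def sum.distrib del: of_nat_add)
  finally show ?case
    using assms(1) by (simp add: current_fermion realize_add algebra_simps)
next
  case (zero k)
  then show ?case by (simp add: realize_zero current_zero)
next
  case vac
  then show ?case using base by (simp add: c realize_vac)
next
  case (scale k f a)
  then show ?case by (simp add: realize_scale current_scale mult.left_commute)
next
  case (add k f g)
  then show ?case by (simp add: realize_add current_add distrib_left)
qed

lemma realize_current_vac:
  assumes "odd r" "finite X"
  shows "realize pw (int r) (current (int r) vac) X = schur_op pw r (\<lambda>X. 1) X +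
    (\<Sum>b\<in>{0<..<r}. (-1) ^ b * schur_op pw (r - b) (schur_op pw b (\<lambda>X. 1)) X)"
proof -
  have r: "r > 0" using assms(1) by (rule odd_pos)
  have one: "realize pw (int n) (fermion (int n) vac) Z = schur_op pw n (\<lambda>X. 1) Z"
    if "n > 0" "finite Z" for n Z
    using realize_fermion[of n Z pw 0 vac] that by (simp add: realize_vac[abs_def])
  have two: "realize pw (int r) (fermion (int r - int b) (fermion (int b) vac)) X =
      schur_op pw (r - b) (schur_op pw b (\<lambda>X. 1)) X" if "b \<in> {0<..<r}" for b
    using that assms(2) realize_fermion[of "r - b" X pw "int b" "fermion (int b) vac"] one
    by (auto simp: of_nat_diff intro: schur_op_cong)
  have "(\<Sum>j\<in>{0<..<int r}. alt_sign j * fermion (int r - j) (fermion j vac) S) =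
      (\<Sum>b\<in>{0<..<r}. (-1) ^ b * fermion (int r - int b) (fermion (int b) vac) S)" for S
    by (rule sum.reindex_bij_witness[of _ int nat]) (auto simp: alt_sign_def minus_one_power_iff even_nat_iff)
  then have "current (int r) vac = (\<lambda>S. fermion (int r) vac S +
      (\<Sum>b\<in>{0<..<r}. (-1) ^ b * fermion (int r - int b) (fermion (int b) vac) S))"
    using assms(1) r by (simp add: current_pos_vac)
  then have "realize pw (int r) (current (int r) vac) X = realize pw (int r) (fermion (int r) vac) X +
      (\<Sum>b\<in>{0<..<r}. h ((-1) ^ b) * realize pw (int r) (fermion (int r - int b) (fermion (int b) vac)) X)"
    by (simp add: realize_add realize_sum realize_scale)
  also have "\<dots> = schur_op pw r (\<lambda>X. 1) X +
    (\<Sum>b\<in>{0<..<r}. (-1) ^ b * schur_op pw (r - b) (schur_op pw b (\<lambda>X. 1)) X)"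
    using r assms(2) one two by (simp add: power uminus rat_hom.one[OF rat_hom_axioms])
  finally show ?thesis .
qed

lemma realize_current_power:
  assumes "odd r" "homog k f" "no_antipodes X"
  shows "realize (^) (k + int r) (current (int r) f) X = (\<Sum>x\<in>X. x ^ r) * realize (^) k f X"
  using realize_current[OF assms, of "(^)" "\<lambda>_. 0" "\<lambda>_. 0"] assms(1)
  by (simp add: power_add power_sum_schur_op realize_current_vac no_antipodes_def)

lemma realize_current_falling:
  assumes "homog k f" "no_antipodes X"
  shows "realize falling (k + 1) (current 1 f) X = ((\<Sum>x\<in>X. x) - of_int k) * realize falling k f X"
proof -
  \<comment> \<open>The first falling factorial is \<open>x\<close> itself, so powers and falling
    factorials share this base case.\<close>
  have "(\<Sum>x\<in>X. x ^ 1) = realize falling (int 1) (current (int 1) vac) X" if "no_antipodes X" for X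
    using power_sum_schur_op[OF that, of 1] that realize_current_vac[of 1 X falling]
    by (simp add: no_antipodes_def schur_op_def falling_def)
  then show ?thesis
    using realize_current[of 1, OF _ assms, of falling of_nat of_int] by (simp add: falling_def)
qed

lemma realize_p_vector:
  assumes "\<forall>r\<in>set \<rho>. odd r" "no_antipodes X"
  shows "realize (^) (int (sum_list \<rho>)) (p_vector \<rho>) X = (\<Prod>r\<leftarrow>\<rho>. \<Sum>x\<in>X. x ^ r)"
  using assms(1)
proof (induction \<rho>)
  case (Cons r \<rho>)
  then show ?case
    using realize_current_power[OF _ homog_p_vector assms(2), of r \<rho>] by (simp add: add.commute)
qed (simp add: realize_vac)

end

section \<open>P-functions and power sums\<close>

subsection \<open>Symmetrization over permutations\<close>

fun sym_term :: "('a::field \<Rightarrow> nat \<Rightarrow> 'a) \<Rightarrow> nat list \<Rightarrow> 'a list \<Rightarrow> 'a" where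
  "sym_term pw [] xs = 1"
| "sym_term pw (n # a) [] = 0"
| "sym_term pw (n # a) (x # xs) = pw x n * (\<Prod>y\<leftarrow>xs. (x + y) / (x - y)) * sym_term pw a xs"

text \<open>Orderings are grouped by their first variable. Variables beyond the length of
  \<open>a\<close> do not influence the term, and the factorial counts their arrangements.\<close>

lemma sum_sym_term_permutations:
  assumes "finite X" "length a \<le> card X"
  shows "(\<Sum>xs\<in>permutations_of_set X. sym_term pw a xs) = of_nat (fact (card X - length a)) * schur_list pw a X"
  using assms
proof (induction a arbitrary: X)
  case (Cons n a)
  have ne: "X \<noteq> {}" using Cons.prems by auto
  have "(\<Sum>xs\<in>permutations_of_set X. sym_term pw (n # a) xs) =
      (\<Sum>x\<in>X. \<Sum>xs\<in>(#) x ` permutations_of_set (X - {x}). sym_term pw (n # a) xs)"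
    unfolding permutations_of_set_nonempty[OF ne] using Cons.prems(1)
    by (intro sum.UNION_disjoint) auto
  also have "\<dots> = (\<Sum>x\<in>X. pw x n * kern x X * (of_nat (fact (card X - Suc (length a))) * schur_list pw a (X - {x})))"
  proof (intro sum.cong refl)
    fix x assume x: "x \<in> X"
    have "(\<Sum>xs\<in>(#) x ` permutations_of_set (X - {x}). sym_term pw (n # a) xs) =
        (\<Sum>xs\<in>permutations_of_set (X - {x}). pw x n * kern x X * sym_term pw a xs)"
    proof (subst sum.reindex)
      have "(\<Prod>y\<leftarrow>xs. (x + y) / (x - y)) = kern x X" if "xs \<in> permutations_of_set (X - {x})" for xs
        using that prod.distinct_set_conv_list[of xs "\<lambda>y. (x + y) / (x - y)"]
        by (simp add: permutations_of_set_def kern_def)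
      then show "sum (sym_term pw (n # a) \<circ> (#) x) (permutations_of_set (X - {x})) =
          (\<Sum>xs\<in>permutations_of_set (X - {x}). pw x n * kern x X * sym_term pw a xs)"
        by (intro sum.cong) simp_all
    qed simp
    also have "\<dots> = pw x n * kern x X * (of_nat (fact (card (X - {x}) - length a)) * schur_list pw a (X - {x}))"
    proof -
      have "length a \<le> card (X - {x})" using Cons.prems x by simp
      then show ?thesis using Cons.prems(1) Cons.IH[of "X - {x}"] by (simp flip: sum_distrib_left)
    qed
    finally show "(\<Sum>xs\<in>(#) x ` permutations_of_set (X - {x}). sym_term pw (n # a) xs) =
        pw x n * kern x X * (of_nat (fact (card X - Suc (length a))) * schur_list pw a (X - {x}))"
      using x Cons.prems(1) by simp
  qed
  finally show ?case
    by (simp add: schur_list_Cons schur_op_def sum_distrib_left ac_simps)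
qed (simp add: card_permutations_of_set)

lemma sym_term_eq_prod:
  "length a \<le> length xs \<Longrightarrow> sym_term pw a xs =
    (\<Prod>i<length a. pw (xs ! i) (a ! i)) *
    (\<Prod>i<length a. \<Prod>j\<in>{i<..<length xs}. (xs ! i + xs ! j) / (xs ! i - xs ! j))"
proof (induction pw a xs rule: sym_term.induct)
  case (3 pw n a x xs)
  have "{0<..<Suc (length xs)} = Suc ` {..<length xs}"
    by (auto simp: image_iff gr0_conv_Suc)
  then have 1: "(\<Prod>j\<in>{0<..<Suc (length xs)}. (x + (x # xs) ! j) / (x - (x # xs) ! j)) =
      (\<Prod>y\<leftarrow>xs. (x + y) / (x - y))"
    by (simp add: prod.reindex prod.list_conv_set_nth atLeast0LessThan)
  have "{Suc i<..<Suc (length xs)} = Suc ` {i<..<length xs}" for i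
    by (auto simp: image_iff Suc_less_eq2)
  then have 2: "(\<Prod>j\<in>{Suc i<..<Suc (length xs)}. (xs ! i + (x # xs) ! j) / (xs ! i - (x # xs) ! j)) =
      (\<Prod>j\<in>{i<..<length xs}. (xs ! i + xs ! j) / (xs ! i - xs ! j))" for i
    by (simp add: prod.reindex)
  show ?case
    using 3 unfolding list.size(4) add_0_right add_Suc_right prod.lessThan_Suc_shift nth_Cons_0 nth_Cons_Suc 1 2
    by simp
qed simp_all

lemma sum_permutes_eq_permutations_of_set:
  assumes "inj_on x {..<N}"
  shows "(\<Sum>\<omega> | \<omega> permutes {..<N}. F (map (\<lambda>i. x (\<omega> i)) [0..<N])) =
    (\<Sum>xs\<in>permutations_of_set (x ` {..<N}). F xs)"
proof -
  let ?f = "\<lambda>\<omega>. map (\<lambda>i. x (\<omega> i)) [0..<N]"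
  have "inj_on ?f {\<omega>. \<omega> permutes {..<N}}"
  proof (rule inj_onI)
    fix \<omega> \<tau> assume *: "\<omega> \<in> {\<omega>. \<omega> permutes {..<N}}" "\<tau> \<in> {\<omega>. \<omega> permutes {..<N}}" "?f \<omega> = ?f \<tau>"
    show "\<omega> = \<tau>"
    proof
      fix i
      show "\<omega> i = \<tau> i"
      proof (cases "i < N")
        case True
        then have "x (\<omega> i) = x (\<tau> i)" using *(3) by simp
        moreover have "\<omega> i < N" "\<tau> i < N" using * True by (auto dest: permutes_in_image[where x = i])
        ultimately show ?thesis using assms by (auto simp: inj_on_def)
      qed (use * in \<open>simp add: permutes_def\<close>)
    qed
  qed
  moreover have "?f ` {\<omega>. \<omega> permutes {..<N}} = permutations_of_set (x ` {..<N})"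
  proof (rule card_subset_eq)
    show "?f ` {\<omega>. \<omega> permutes {..<N}} \<subseteq> permutations_of_set (x ` {..<N})"
    proof safe
      fix \<omega> assume w: "\<omega> permutes {..<N}"
      have "x ` \<omega> ` {..<N} = x ` {..<N}" using permutes_image[OF w] by simp
      moreover have "inj_on (\<lambda>i. x (\<omega> i)) {..<N}"
        using comp_inj_on[of \<omega> "{..<N}" x] assms permutes_image[OF w] permutes_inj_on[OF w]
        by (simp add: comp_def)
      ultimately show "?f \<omega> \<in> permutations_of_set (x ` {..<N})"
        by (simp add: permutations_of_set_def distinct_map image_image atLeast0LessThan)
    qed
    show "card (?f ` {\<omega>. \<omega> permutes {..<N}}) = card (permutations_of_set (x ` {..<N}))"
      using \<open>inj_on ?f _\<close> assms
      by (simp add: card_image card_permutations[of _ N] card_permutations_of_set)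
  qed simp
  ultimately show ?thesis by (subst sum.reindex[symmetric, unfolded o_def]) simp_all
qed

lemma (in rat_hom) symmetrization_eq_schur_list:
  fixes pw :: "'a \<Rightarrow> nat \<Rightarrow> 'a"
  assumes "inj_on x {..<N}" "length \<mu> \<le> N"
  shows "symmetrization pw N \<mu> x = schur_list pw \<mu> (x ` {..<N})"
proof -
  have "symmetrization pw N \<mu> x = 1 / of_nat (fact (N - length \<mu>)) *
      (\<Sum>\<omega> | \<omega> permutes {..<N}. sym_term pw \<mu> (map (\<lambda>i. x (\<omega> i)) [0..<N]))"
    unfolding symmetrization_def
  proof (intro arg_cong2[where f = "(*)"] refl sum.cong)
    fix \<omega>
    have "(\<Prod>i<length \<mu>. \<Prod>j\<in>{i<..<N}. (map (\<lambda>i. x (\<omega> i)) [0..<N] ! i + map (\<lambda>i. x (\<omega> i)) [0..<N] ! j) /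
        (map (\<lambda>i. x (\<omega> i)) [0..<N] ! i - map (\<lambda>i. x (\<omega> i)) [0..<N] ! j)) =
        (\<Prod>i<length \<mu>. \<Prod>j\<in>{i<..<N}. (x (\<omega> i) + x (\<omega> j)) / (x (\<omega> i) - x (\<omega> j)))"
      using assms(2) by (intro prod.cong refl) auto
    then show "(\<Prod>i<length \<mu>. pw (x (\<omega> i)) (\<mu> ! i)) *
        (\<Prod>i<length \<mu>. \<Prod>j\<in>{i<..<N}. (x (\<omega> i) + x (\<omega> j)) / (x (\<omega> i) - x (\<omega> j))) =
        sym_term pw \<mu> (map (\<lambda>i. x (\<omega> i)) [0..<N])"
      using assms(2) by (simp add: sym_term_eq_prod)
  qed
  also have "\<dots> = 1 / of_nat (fact (N - length \<mu>)) *
      (of_nat (fact (N - length \<mu>)) * schur_list pw \<mu> (x ` {..<N}))"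
    using assms by (simp add: sum_permutes_eq_permutations_of_set sum_sym_term_permutations card_image)
  finally show ?thesis using of_nat_neq_0[of "fact (N - length \<mu>)"] by simp
qed

subsection \<open>Strict and odd partitions\<close>

definition OP :: "nat \<Rightarrow> nat list set" where
  "OP k = {\<rho>. odd_partition \<rho> \<and> sum_list \<rho> = k}"

lemma finite_OP: "finite (OP k)"
proof (rule finite_subset)
  show "OP k \<subseteq> {\<rho>. set \<rho> \<subseteq> {..k} \<and> length \<rho> \<le> k}"
    using length_le_sum_list_partition member_le_sum_list
    by (fastforce simp: OP_def odd_partition_def)
  show "finite {\<rho>. set \<rho> \<subseteq> {..k} \<and> length \<rho> \<le> k}"
    by (rule finite_lists_length_le) simp
qed

lemma partition_eqI:
  assumes "is_partition \<rho>" "is_partition \<sigma>" "mset \<rho> = mset \<sigma>"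
  shows "\<rho> = \<sigma>"
proof -
  have "sorted (rev \<rho>)" "sorted (rev \<sigma>)" using assms by (simp_all add: is_partition_def sorted_wrt_rev)
  then have "rev \<rho> = rev \<sigma>" using assms(3) by (metis mset_rev properties_for_sort)
  then show ?thesis by simp
qed

text \<open>Orthogonality makes the matrix with entries \<open>p_vector \<rho> S\<close> left invertible; Glaisher's
  injection of strict into odd partitions shows that it has no more rows than columns, which
  turns the left inverse into a two-sided one.\<close>

definition odd_part :: "nat \<Rightarrow> nat" where
  "odd_part s = s div 2 ^ multiplicity 2 s"

definition glaisher :: "nat fset \<Rightarrow> nat multiset" where
  "glaisher S = (\<Sum>s\<in>fset S. replicate_mset (2 ^ multiplicity 2 s) (odd_part s))"

lemma odd_part_decompose:
  assumes "s > 0"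
  shows "s = odd_part s * 2 ^ multiplicity 2 s" "odd (odd_part s)"
proof -
  obtain t where t: "s = 2 ^ multiplicity 2 s * t" "\<not> 2 dvd t"
    using multiplicity_decompose'[of s 2] assms by auto
  then have "odd_part s = t" unfolding odd_part_def by (metis nonzero_mult_div_cancel_left power_not_zero zero_neq_numeral)
  then show "s = odd_part s * 2 ^ multiplicity 2 s" "odd (odd_part s)" using t by (auto simp: mult.commute)
qed

lemma odd_part_mult_power:
  assumes "odd r"
  shows "multiplicity 2 (r * 2 ^ v) = v" "odd_part (r * 2 ^ v) = r"
proof -
  show "multiplicity 2 (r * 2 ^ v) = v"
    using assms by (intro multiplicity_decomposeI[of _ _ _ r]) (auto simp: mult.commute)
  then show "odd_part (r * 2 ^ v) = r" by (simp add: odd_part_def)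
qed

text \<open>The copies of \<open>r\<close> come from the parts \<open>r * 2 ^ v\<close> of
  \<open>S\<close>, so their number has its binary digits exactly at these \<open>v\<close>. Hence
  the multiplicities determine \<open>S\<close>.\<close>

lemma count_glaisher:
  assumes "0 |\<notin>| S" "odd r"
  shows "count (glaisher S) r = set_encode {v. r * 2 ^ v \<in> fset S}"
proof -
  have "count (glaisher S) r = (\<Sum>s\<in>fset S. if odd_part s = r then 2 ^ multiplicity 2 s else 0)"
    by (auto simp: glaisher_def count_sum intro!: sum.cong)
  also have "\<dots> = (\<Sum>s | s \<in> fset S \<and> odd_part s = r. 2 ^ multiplicity 2 s)"
    by (simp add: sum.inter_filter)
  also have "\<dots> = (\<Sum>v\<in>{v. r * 2 ^ v \<in> fset S}. 2 ^ v)"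
    using assms odd_part_mult_power[OF assms(2)] odd_part_decompose(1)
    by (intro sum.reindex_bij_witness[of _ "\<lambda>v. r * 2 ^ v" "multiplicity 2"])
      (auto simp: neq0_conv[symmetric] simp del: neq0_conv, metis+)
  finally show ?thesis by (simp add: set_encode_def)
qed

lemma inj_on_glaisher: "inj_on glaisher {S. 0 |\<notin>| S}"
proof (rule inj_onI)
  fix S T assume *: "S \<in> {S. 0 |\<notin>| S}" "T \<in> {S. 0 |\<notin>| S}" "glaisher S = glaisher T"
  have eq: "{v. r * 2 ^ v \<in> fset S} = {v. r * 2 ^ v \<in> fset T}" if "odd r" for r
  proof -
    have "finite {v. r * 2 ^ v \<in> fset U}" for U
      using finite_vimageI[of "fset U" "\<lambda>v. r * 2 ^ v"] that
      by (auto simp: vimage_def inj_on_def odd_pos)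
    then show ?thesis using count_glaisher[OF _ that] * by (metis mem_Collect_eq set_encode_eq)
  qed
  have "s |\<in>| S \<longleftrightarrow> s |\<in>| T" for s
  proof (cases "s = 0")
    case False
    then show ?thesis using eq[of "odd_part s"] odd_part_decompose[of s] by (metis mem_Collect_eq neq0_conv)
  qed (use * in auto)
  then show "S = T" by auto
qed

definition glaisher_partition :: "nat fset \<Rightarrow> nat list" where
  "glaisher_partition S = rev (sorted_list_of_multiset (glaisher S))"

lemma inj_on_glaisher_partition: "inj_on glaisher_partition (strict_sets k)"
proof -
  have "mset (glaisher_partition S) = glaisher S" for S by (simp add: glaisher_partition_def)
  then show ?thesis using inj_on_glaisher unfolding inj_on_def strict_sets_def
    by (metis (mono_tags, lifting) mem_Collect_eq)
qed

lemma glaisher_partition_OP: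
  assumes "S \<in> strict_sets (int k)"
  shows "glaisher_partition S \<in> OP k"
proof -
  have pos: "s > 0" if "s |\<in>| S" for s using assms that by (auto simp: strict_sets_def intro: Nat.gr0I)
  have "sum_mset (glaisher S) = (\<Sum>s\<in>fset S. 2 ^ multiplicity 2 s * odd_part s)"
    unfolding glaisher_def by (induction rule: infinite_finite_induct) simp_all
  also have "\<dots> = \<Sum>(fset S)"
    using odd_part_decompose(1)[OF pos] by (intro sum.cong) (auto simp: mult.commute)
  also have "\<dots> = k" using assms by (simp add: strict_sets_def del: of_nat_sum)
  finally have "sum_list (glaisher_partition S) = k"
    by (simp add: glaisher_partition_def sum_list_rev flip: sum_mset_sum_list)
  moreover have "odd r" if "r \<in># glaisher S" for r
    using that odd_part_decompose(2)[OF pos] by (auto simp: glaisher_def set_mset_sum split: if_splits)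
  then have "odd r" if "r \<in> set (glaisher_partition S)" for r
    using that by (simp add: glaisher_partition_def)
  moreover have "sorted_wrt (\<ge>) (glaisher_partition S)"
    by (simp add: glaisher_partition_def sorted_wrt_rev)
  ultimately show ?thesis
    by (auto simp: OP_def odd_partition_def is_partition_def intro!: Nat.gr0I)
qed

lemma left_inverse_imp_right_inverse:
  fixes L :: "'b \<Rightarrow> 'a \<Rightarrow> 'c::field" and M :: "'a \<Rightarrow> 'b \<Rightarrow> 'c"
  assumes "finite B" and \<iota>: "inj_on \<iota> A" "\<iota> ` A \<subseteq> B"
    and LM: "\<And>\<rho> \<sigma>. \<rho> \<in> B \<Longrightarrow> \<sigma> \<in> B \<Longrightarrow> (\<Sum>S\<in>A. L \<rho> S * M S \<sigma>) = (if \<rho> = \<sigma> then 1 else 0)"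
    and "S \<in> A" "T \<in> A"
  shows "(\<Sum>\<rho>\<in>B. M S \<rho> * L \<rho> T) = (if S = T then 1 else 0)"
proof -
  define n where "n = card B"
  obtain g where g: "bij_betw g {0..<n} B"
    using ex_bij_betw_nat_finite[OF assms(1)] unfolding n_def by blast
  define \<kappa> where "\<kappa> S = inv_into {0..<n} g (\<iota> S)" for S
  have \<kappa>: "\<kappa> S < n" "g (\<kappa> S) = \<iota> S" if "S \<in> A" for S
    using bij_betw_inv_into_right[OF g, of "\<iota> S"] bij_betw_apply[OF bij_betw_inv_into[OF g], of "\<iota> S"] that \<iota>(2)
    by (auto simp: \<kappa>_def)
  have inj: "inj_on \<kappa> A" using \<kappa>(2) \<iota>(1) by (metis inj_on_def)
  define dec where "dec = inv_into A \<kappa>"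
  have dec: "dec (\<kappa> S) = S" if "S \<in> A" for S using inj that by (simp add: dec_def)
  \<comment> \<open>Zero columns of \<open>P\<close> and zero rows of \<open>Q\<close> outside the
    image of \<open>A\<close> make both matrices square without affecting the product.\<close>
  define P where "P = mat n n (\<lambda>(i, j). if j \<in> \<kappa> ` A then L (g i) (dec j) else 0)"
  define Q where "Q = mat n n (\<lambda>(j, i). if j \<in> \<kappa> ` A then M (dec j) (g i) else 0)"
  have carr: "P \<in> carrier_mat n n" "Q \<in> carrier_mat n n" by (auto simp: P_def Q_def)
  have "P * Q = 1\<^sub>m n"
  proof (rule eq_matI)
    fix i k assume "i < dim_row (1\<^sub>m n :: 'c mat)" "k < dim_col (1\<^sub>m n :: 'c mat)"
    then have ik: "i < n" "k < n" by simp_all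
    have "(P * Q) $$ (i, k) = (\<Sum>j<n. if j \<in> \<kappa> ` A then L (g i) (dec j) * M (dec j) (g k) else 0)"
      using ik by (simp add: P_def Q_def Matrix.scalar_prod_def atLeast0LessThan) (rule sum.cong, auto)
    also have "\<dots> = (\<Sum>j\<in>\<kappa> ` A. L (g i) (dec j) * M (dec j) (g k))"
      using \<kappa>(1) by (intro sum.mono_neutral_cong_right) auto
    also have "\<dots> = (\<Sum>S\<in>A. L (g i) S * M S (g k))"
      using inj dec by (subst sum.reindex) auto
    also have "\<dots> = (if i = k then 1 else 0)"
      using LM[of "g i" "g k"] ik bij_betw_apply[OF g] g by (auto simp: bij_betw_def inj_on_def)
    finally show "(P * Q) $$ (i, k) = 1\<^sub>m n $$ (i, k)" using ik by simp
  qed (simp_all add: P_def Q_def)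
  then have QP: "Q * P = 1\<^sub>m n"
    using mat_mult_left_right_inverse[OF carr] by simp
  have "(\<Sum>\<rho>\<in>B. M S \<rho> * L \<rho> T) = (\<Sum>i<n. M S (g i) * L (g i) T)"
    by (subst sum.reindex_bij_betw[OF g, symmetric]) (simp add: atLeast0LessThan)
  also have "\<dots> = (Q * P) $$ (\<kappa> S, \<kappa> T)"
    using assms(5,6) \<kappa>(1) dec by (simp add: P_def Q_def Matrix.scalar_prod_def atLeast0LessThan)
  also have "\<dots> = (if S = T then 1 else 0)"
    using inj assms(5,6) \<kappa>(1) by (auto simp: QP inj_on_def)
  finally show ?thesis .
qed

text \<open>The coordinate of P_S along p_\<rho>: the inner product of the two divided by the
  squared norm of p_\<rho>.\<close>

definition p_coeff :: "nat fset \<Rightarrow> nat list \<Rightarrow> rat" where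
  "p_coeff S \<rho> = p_vector \<rho> S * 2 ^ length \<rho> / (of_nat (z_part \<rho>) * 2 ^ fcard S)"

lemma z_part_pos: "0 \<notin> set \<rho> \<Longrightarrow> z_part \<rho> > 0"
  by (auto simp: z_part_def intro!: prod_pos Nat.gr0I)

lemma p_vector_dual_orthogonality:
  assumes "S \<in> strict_sets (int k)" "T \<in> strict_sets (int k)"
  shows "(\<Sum>\<rho>\<in>OP k. p_vector \<rho> S * p_coeff T \<rho>) = (if S = T then 1 else 0)"
proof (rule left_inverse_imp_right_inverse[OF finite_OP inj_on_glaisher_partition _ _ assms])
  show "glaisher_partition ` strict_sets (int k) \<subseteq> OP k" using glaisher_partition_OP by auto
  fix \<rho> \<sigma> assume *: "\<rho> \<in> OP k" "\<sigma> \<in> OP k"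
  then have "0 \<notin> set \<rho>" by (auto simp: OP_def odd_partition_def is_partition_def)
  then have z: "of_nat (z_part \<rho>) \<noteq> (0::rat)" using z_part_pos by simp
  have "fock_inner (int k) (p_vector \<rho>) (p_vector \<sigma>) =
      (if \<rho> = \<sigma> then of_nat (z_part \<rho>) / 2 ^ length \<rho> else 0)"
    using fock_inner_p_vector[of \<rho> \<sigma>] * partition_eqI[of \<rho> \<sigma>]
    by (auto simp: OP_def odd_partition_def)
  moreover have "(\<Sum>S\<in>strict_sets (int k). p_coeff S \<rho> * p_vector \<sigma> S) =
      2 ^ length \<rho> / of_nat (z_part \<rho>) * fock_inner (int k) (p_vector \<rho>) (p_vector \<sigma>)"
    by (simp add: fock_inner_def p_coeff_def sum_distrib_left ac_simps)
  ultimately show "(\<Sum>S\<in>strict_sets (int k). p_coeff S \<rho> * p_vector \<sigma> S) = (if \<rho> = \<sigma> then 1 else 0)"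
    using z by (cases "\<rho> = \<sigma>") simp_all
qed

subsection \<open>Expansions in power sums\<close>

text \<open>Signed Stirling numbers of the first kind.\<close>

fun fall_coeff :: "nat \<Rightarrow> nat \<Rightarrow> rat" where
  "fall_coeff 0 j = (if j = 0 then 1 else 0)"
| "fall_coeff (Suc n) j = (if j = 0 then 0 else fall_coeff n (j - 1)) - of_nat n * fall_coeff n j"

lemma fall_coeff_eq_0: "n < j \<Longrightarrow> fall_coeff n j = 0"
  by (induction n arbitrary: j) auto

lemma fall_coeff_0: "n > 0 \<Longrightarrow> fall_coeff n 0 = 0"
proof (induction n)
  case (Suc n)
  then show ?case by (cases "n = 0") simp_all
qed simp

text \<open>Expands a product of falling factorials into monomials. Exponents start at 1 because
  falling factorials of positive length have no constant term; the exponent lists thus avoid 0 but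
  may have repetitions or be out of order.\<close>

fun fall_terms :: "nat list \<Rightarrow> (rat \<times> nat list) list" where
  "fall_terms [] = [(1, [])]"
| "fall_terms (n # a) = concat (map (\<lambda>j. map (\<lambda>(c, b). (fall_coeff n j * c, j # b)) (fall_terms a)) [1..<Suc n])"

lemma fall_terms_pos: "(c, b) \<in> set (fall_terms a) \<Longrightarrow> 0 \<notin> set b"
  by (induction a arbitrary: c b) auto

text \<open>Straightens such an exponent list: the fermion relations express it through decreasing
  lists or make it vanish.\<close>

definition list_vector :: "nat list \<Rightarrow> nat fset \<Rightarrow> rat" where
  "list_vector b = foldr (\<lambda>n. fermion (int n)) b vac"

definition list_coeff :: "nat list \<Rightarrow> nat list \<Rightarrow> rat" where
  "list_coeff b \<rho> = (\<Sum>S\<in>strict_sets (int (sum_list b)). list_vector b S * p_coeff S \<rho>)"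

context rat_hom
begin

text \<open>Inverts the expansion of power sums in P-functions by means of
  \<open>p_vector_dual_orthogonality\<close>.\<close>

lemma schur_set_eq_p:
  assumes "S \<in> strict_sets (int k)" "no_antipodes X"
  shows "schur_set (^) S X = (\<Sum>\<rho>\<in>OP k. h (p_coeff S \<rho>) * (\<Prod>r\<leftarrow>\<rho>. \<Sum>x\<in>X. x ^ r))"
proof -
  have "(\<Sum>\<rho>\<in>OP k. h (p_coeff S \<rho>) * (\<Prod>r\<leftarrow>\<rho>. \<Sum>x\<in>X. x ^ r)) =
      (\<Sum>\<rho>\<in>OP k. h (p_coeff S \<rho>) * realize (^) (int k) (p_vector \<rho>) X)"
    using realize_p_vector[OF _ assms(2)] by (intro sum.cong) (auto simp: OP_def odd_partition_def)
  also have "\<dots> = (\<Sum>T\<in>strict_sets (int k). h (\<Sum>\<rho>\<in>OP k. p_vector \<rho> T * p_coeff S \<rho>) * schur_set (^) T X)"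
    unfolding realize_def sum_distrib_left sum sum_distrib_right mult
    by (subst sum.swap) (simp add: ac_simps)
  also have "\<dots> = (\<Sum>T\<in>strict_sets (int k). if T = S then schur_set (^) S X else 0)"
    using p_vector_dual_orthogonality[OF _ assms(1)]
    by (intro sum.cong) (auto simp: one zero)
  finally show ?thesis using assms(1) finite_strict_sets by simp
qed

lemma realize_list_vector:
  assumes "0 \<notin> set b" "finite X"
  shows "realize pw (int (sum_list b)) (list_vector b) X = schur_list pw b X"
  using assms
proof (induction b arbitrary: X)
  case (Cons n b)
  then have "realize pw (int (sum_list b) + int n) (fermion (int n) (list_vector b)) X =
      schur_op pw n (realize pw (int (sum_list b)) (list_vector b)) X"
    by (intro realize_fermion) auto
  also have "\<dots> = schur_op pw n (schur_list pw b) X"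
    using Cons by (intro schur_op_cong) auto
  finally show ?case by (simp add: list_vector_def schur_list_Cons add.commute)
qed (simp add: list_vector_def realize_vac)

lemma schur_list_eq_p:
  assumes "0 \<notin> set b" "no_antipodes X"
  shows "schur_list (^) b X = (\<Sum>\<rho>\<in>OP (sum_list b). h (list_coeff b \<rho>) * (\<Prod>r\<leftarrow>\<rho>. \<Sum>x\<in>X. x ^ r))"
proof -
  have "schur_list (^) b X = realize (^) (int (sum_list b)) (list_vector b) X"
    using assms by (simp add: realize_list_vector no_antipodes_def)
  also have "\<dots> = (\<Sum>S\<in>strict_sets (int (sum_list b)). \<Sum>\<rho>\<in>OP (sum_list b).
      h (list_vector b S * p_coeff S \<rho>) * (\<Prod>r\<leftarrow>\<rho>. \<Sum>x\<in>X. x ^ r))"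
    using schur_set_eq_p[OF _ assms(2)] unfolding realize_def
    by (intro sum.cong) (auto simp: sum_distrib_left mult mult.assoc)
  also have "\<dots> = (\<Sum>\<rho>\<in>OP (sum_list b). h (list_coeff b \<rho>) * (\<Prod>r\<leftarrow>\<rho>. \<Sum>x\<in>X. x ^ r))"
    unfolding list_coeff_def sum sum_distrib_right by (rule sum.swap)
  finally show ?thesis .
qed

lemma falling_eq_sum: "falling x n = (\<Sum>j\<le>n. h (fall_coeff n j) * x ^ j)"
proof (induction n)
  case (Suc n)
  have "(\<Sum>j\<le>Suc n. h (fall_coeff (Suc n) j) * x ^ j) =
      (\<Sum>j\<le>Suc n. h (if j = 0 then 0 else fall_coeff n (j - 1)) * x ^ j) -
      of_nat n * (\<Sum>j\<le>Suc n. h (fall_coeff n j) * x ^ j)"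
    by (simp only: fall_coeff.simps diff_conv_add_uminus add uminus mult of_nat distrib_right
        sum.distrib mult_minus_left sum_negf sum_distrib_left mult.assoc)
  also have "(\<Sum>j\<le>Suc n. h (if j = 0 then 0 else fall_coeff n (j - 1)) * x ^ j) =
      x * (\<Sum>j\<le>n. h (fall_coeff n j) * x ^ j)"
    by (subst sum.atMost_Suc_shift) (simp add: zero sum_distrib_left ac_simps)
  also have "(\<Sum>j\<le>Suc n. h (fall_coeff n j) * x ^ j) = (\<Sum>j\<le>n. h (fall_coeff n j) * x ^ j)"
    by (simp add: fall_coeff_eq_0 zero)
  finally show ?case using Suc by (simp add: falling_def algebra_simps)
qed (simp add: falling_def one)

lemma schur_list_falling:
  assumes "0 \<notin> set a" "finite X"
  shows "schur_list falling a X = (\<Sum>(c, b)\<leftarrow>fall_terms a. h c * schur_list (^) b X)"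
  using assms
proof (induction a arbitrary: X)
  case (Cons n a)
  have n: "falling x n = (\<Sum>j\<leftarrow>[1..<Suc n]. h (fall_coeff n j) * x ^ j)" for x
  proof -
    have "falling x n = (\<Sum>j\<in>{1..<Suc n}. h (fall_coeff n j) * x ^ j)"
      unfolding falling_eq_sum using fall_coeff_0[of n] Cons.prems(1)
      by (intro sum.mono_neutral_right) (auto simp: zero Suc_le_eq)
    then show ?thesis by (simp only: sum.distinct_set_conv_list[OF distinct_upt, symmetric] set_upt)
  qed
  have "schur_list falling (n # a) X =
      (\<Sum>x\<in>X. falling x n * (kern x X * (\<Sum>(c, b)\<leftarrow>fall_terms a. h c * schur_list (^) b (X - {x}))))"
    using Cons by (simp add: schur_list_Cons schur_op_def mult.assoc)
  also have "\<dots> = (\<Sum>x\<in>X. \<Sum>j\<leftarrow>[1..<Suc n]. \<Sum>(c, b)\<leftarrow>fall_terms a.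
      h (fall_coeff n j * c) * (x ^ j * kern x X * schur_list (^) b (X - {x})))"
  proof -
    have distrib: "(\<Sum>j\<leftarrow>ys. A j) * (k * (\<Sum>z\<leftarrow>zs. B z)) = (\<Sum>j\<leftarrow>ys. \<Sum>z\<leftarrow>zs. A j * (k * B z))"
      for ys zs and A :: "nat \<Rightarrow> 'a" and B :: "rat \<times> nat list \<Rightarrow> 'a" and k
      by (induction ys) (simp_all add: distrib_right sum_list_const_mult)
    show ?thesis unfolding n distrib
      by (intro sum.cong refl arg_cong[of _ _ sum_list] map_cong) (simp add: mult split_beta ac_simps)
  qed
  also have "\<dots> = (\<Sum>j\<leftarrow>[1..<Suc n]. \<Sum>(c, b)\<leftarrow>fall_terms a.
      h (fall_coeff n j * c) * (\<Sum>x\<in>X. x ^ j * kern x X * schur_list (^) b (X - {x})))"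
  proof -
    have swap: "(\<Sum>x\<in>X. \<Sum>y\<leftarrow>ys. g x y) = (\<Sum>y\<leftarrow>ys. \<Sum>x\<in>X. g x y)"
      for g :: "'a \<Rightarrow> 'c \<Rightarrow> 'a" and ys
      by (induction ys) (simp_all add: sum.distrib)
    show ?thesis by (simp only: swap case_prod_unfold sum_distrib_left)
  qed
  also have "\<dots> = (\<Sum>(c, b)\<leftarrow>fall_terms (n # a). h c * schur_list (^) b X)"
  proof -
    have concat: "(\<Sum>p\<leftarrow>concat xss. g p) = (\<Sum>xs\<leftarrow>xss. \<Sum>p\<leftarrow>xs. g p)"
      for g :: "rat \<times> nat list \<Rightarrow> 'a" and xss by (induction xss) simp_all
    show ?thesis unfolding fall_terms.simps concat
      by (simp add: o_def case_prod_unfold schur_list_Cons schur_op_def del: upt_Suc)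
  qed
  finally show ?case .
qed (simp add: one)

end

section \<open>Polynomials and the characters\<close>

definition monom_eval :: "(nat \<Rightarrow> rat) \<Rightarrow> (nat \<Rightarrow>\<^sub>0 nat) \<Rightarrow> rat" where
  "monom_eval \<alpha> m = (\<Prod>i\<in>Poly_Mapping.keys m. \<alpha> i ^ Poly_Mapping.lookup m i)"

lemma monom_eval_superset:
  "finite A \<Longrightarrow> Poly_Mapping.keys m \<subseteq> A \<Longrightarrow> monom_eval \<alpha> m = (\<Prod>i\<in>A. \<alpha> i ^ Poly_Mapping.lookup m i)"
  unfolding monom_eval_def by (intro prod.mono_neutral_left) (auto simp: in_keys_iff)

lemma monom_eval_add: "monom_eval \<alpha> (m + m') = monom_eval \<alpha> m * monom_eval \<alpha> m'"
proof -
  let ?A = "Poly_Mapping.keys m \<union> Poly_Mapping.keys m'"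
  have "Poly_Mapping.keys (m + m') \<subseteq> ?A" by (rule Poly_Mapping.keys_add)
  then show ?thesis
    using monom_eval_superset[of ?A m \<alpha>] monom_eval_superset[of ?A m' \<alpha>] monom_eval_superset[of ?A "m + m'" \<alpha>]
    by (simp add: lookup_add power_add prod.distrib)
qed

lemma poly_eval_superset:
  "finite A \<Longrightarrow> Poly_Mapping.keys p \<subseteq> A \<Longrightarrow> poly_eval \<alpha> p = (\<Sum>m\<in>A. Poly_Mapping.lookup p m * monom_eval \<alpha> m)"
  unfolding poly_eval_def monom_eval_def[symmetric]
  by (intro sum.mono_neutral_left) (auto simp: in_keys_iff)

lemma poly_eval_add: "poly_eval \<alpha> (p + q) = poly_eval \<alpha> p + poly_eval \<alpha> q"
proof -
  let ?A = "Poly_Mapping.keys p \<union> Poly_Mapping.keys q"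
  have "Poly_Mapping.keys (p + q) \<subseteq> ?A" by (rule Poly_Mapping.keys_add)
  then show ?thesis
    using poly_eval_superset[of ?A p \<alpha>] poly_eval_superset[of ?A q \<alpha>] poly_eval_superset[of ?A "p + q" \<alpha>]
    by (simp add: lookup_add distrib_right sum.distrib)
qed

lemma poly_eval_zero: "poly_eval \<alpha> 0 = 0"
  by (simp add: poly_eval_def)

lemma poly_eval_single: "poly_eval \<alpha> (Poly_Mapping.single m a) = a * monom_eval \<alpha> m"
  using poly_eval_superset[of "{m}" "Poly_Mapping.single m a" \<alpha>] by simp

lemma poly_eval_sum: "poly_eval \<alpha> (\<Sum>i\<in>I. p i) = (\<Sum>i\<in>I. poly_eval \<alpha> (p i))"
  by (induction I rule: infinite_finite_induct) (simp_all add: poly_eval_zero poly_eval_add)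

lemma poly_mapping_eq_sum_single:
  "p = (\<Sum>m\<in>Poly_Mapping.keys p. Poly_Mapping.single m (Poly_Mapping.lookup p m))"
  by (rule poly_mapping_eqI)
    (simp add: lookup_sum lookup_single when_def in_keys_iff)

lemma poly_eval_mult: "poly_eval \<alpha> (p * q) = poly_eval \<alpha> p * poly_eval \<alpha> q"
proof -
  have "p * q = (\<Sum>m\<in>Poly_Mapping.keys p. \<Sum>n\<in>Poly_Mapping.keys q.
      Poly_Mapping.single (m + n) (Poly_Mapping.lookup p m * Poly_Mapping.lookup q n))"
    by (subst poly_mapping_eq_sum_single[of p], subst poly_mapping_eq_sum_single[of q])
      (simp add: sum_product mult_single)
  then show ?thesis
    by (simp add: poly_eval_sum poly_eval_single monom_eval_add sum_product ac_simps
        poly_eval_def[of _ p] poly_eval_def[of _ q] flip: monom_eval_def)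
qed

lemma poly_eval_Const: "poly_eval \<alpha> (Const c) = c"
  by (simp add: Const_def poly_eval_single monom_eval_def)

lemma poly_eval_one: "poly_eval \<alpha> 1 = 1"
  using poly_eval_Const[of \<alpha> 1] by (simp add: Const_def)

lemma poly_eval_Var: "poly_eval \<alpha> (Var i) = \<alpha> i"
  by (simp add: Var_def poly_eval_single monom_eval_def)

lemma poly_eval_power: "poly_eval \<alpha> (p ^ n) = poly_eval \<alpha> p ^ n"
  by (induction n) (simp_all add: poly_eval_one poly_eval_mult)

lemma poly_eval_sum_list: "poly_eval \<alpha> (\<Sum>i\<leftarrow>xs. p i) = (\<Sum>i\<leftarrow>xs. poly_eval \<alpha> (p i))"
  by (induction xs) (simp_all add: poly_eval_zero poly_eval_add)

lemma poly_eval_p_prod: "poly_eval \<alpha> (p_prod \<rho> N) = (\<Prod>r\<leftarrow>\<rho>. \<Sum>i<N. \<alpha> i ^ r)"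
  by (induction \<rho>) (simp_all add: p_prod_def poly_eval_one poly_eval_mult power_sum_def
      poly_eval_sum poly_eval_power poly_eval_Var)

lemma Const_mult: "Const (a * b) = Const a * Const b"
  by (simp add: Const_def mult_single)

lemma Const_add: "Const (a + b) = Const a + Const b"
  by (simp add: Const_def single_add)

lemma Const_one: "Const 1 = 1"
  by (simp add: Const_def)

section \<open>Polynomials inside their field of fractions\<close>

abbreviation fr :: "mpoly \<Rightarrow> mpoly fract" where
  "fr p \<equiv> Fract p 1"

lemma fr_one: "fr 1 = 1" and fr_zero: "fr 0 = 0"
  and fr_add: "fr (p + q) = fr p + fr q" and fr_mult: "fr (p * q) = fr p * fr q"
  and fr_eq_iff: "fr p = fr q \<longleftrightarrow> p = q"
  by (simp_all add: One_fract_def Zero_fract_def eq_fract)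

lemma fr_sum: "fr (\<Sum>i\<in>I. p i) = (\<Sum>i\<in>I. fr (p i))"
  by (induction I rule: infinite_finite_induct) (simp_all add: fr_zero fr_add del: add_fract)

lemma fr_sum_list: "fr (\<Sum>i\<leftarrow>xs. p i) = (\<Sum>i\<leftarrow>xs. fr (p i))"
  by (induction xs) (simp_all only: list.map sum_list.Nil sum_list.Cons fr_zero fr_add)

lemma fr_power: "fr (p ^ n) = fr p ^ n"
  by (induction n) (simp_all only: power_0 power_Suc fr_one fr_mult)

interpretation rat_fract: rat_hom "\<lambda>c. fr (Const c)"
  by standard (simp_all only: Const_one Const_mult Const_add fr_one fr_add fr_mult)

interpretation rat_id: rat_hom "\<lambda>c. c :: rat"
  by standard simp_all

definition var_set :: "nat \<Rightarrow> mpoly fract set" where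
  "var_set N = (\<lambda>i. fr (Var i)) ` {..<N}"

lemma Var_eq_iff: "Var i = Var j \<longleftrightarrow> i = j"
proof
  assume "Var i = Var j"
  then have "poly_eval (\<lambda>k. of_nat k) (Var i) = poly_eval (\<lambda>k. of_nat k) (Var j)" by simp
  then show "i = j" by (simp add: poly_eval_Var)
qed simp

lemma inj_fr_Var: "inj (\<lambda>i. fr (Var i))"
  by (simp add: inj_def fr_eq_iff Var_eq_iff)

lemma no_antipodes_var_set: "no_antipodes (var_set N)"
proof -
  have "fr (Var i) + fr (Var j) \<noteq> 0" for i j
  proof
    assume "fr (Var i) + fr (Var j) = 0"
    then have "Var i + Var j = 0" by (simp only: fr_add[symmetric] fr_zero[symmetric] fr_eq_iff)
    \<comment> \<open>Setting all variables to 1 gives 2 on the left.\<close>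
    then have "poly_eval (\<lambda>k. 1) (Var i + Var j) = 0" by (simp add: poly_eval_zero)
    then show False by (simp add: poly_eval_add poly_eval_Var)
  qed
  then show ?thesis by (auto simp: no_antipodes_def var_set_def)
qed

lemma card_var_set: "card (var_set N) = N"
  unfolding var_set_def using inj_fr_Var by (subst card_image) (auto intro: inj_on_subset)

lemma fr_p_prod: "fr (p_prod \<rho> N) = (\<Prod>r\<leftarrow>\<rho>. \<Sum>x\<in>var_set N. x ^ r)"
proof -
  have "(\<Sum>x\<in>var_set N. x ^ r) = fr (power_sum r N)" for r
    unfolding var_set_def power_sum_def fr_sum fr_power
    using inj_fr_Var by (subst sum.reindex) (auto intro: inj_on_subset)
  then show ?thesis
    by (induction \<rho>) (simp_all only: p_prod_def list.map prod_list.Nil prod_list.Cons fr_one fr_mult)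
qed

lemma schur_list_eq_0: "finite X \<Longrightarrow> card X < length a \<Longrightarrow> schur_list pw a X = 0"
proof (induction a arbitrary: X)
  case (Cons n a)
  have "schur_list pw a (X - {x}) = 0" if "x \<in> X" for x
    using Cons.prems that card_Diff1_less[of X x] by (intro Cons.IH) auto
  then show ?case by (simp add: schur_list_Cons schur_op_def)
qed simp

text \<open>Resolves the description operator: \<open>q\<close> exists by assumption and is unique
  as \<open>fr\<close> is injective. With too few variables \<open>schur_list\<close> vanishes, in
  agreement with the convention.\<close>

lemma symmetrized_poly_eqI:
  assumes "fr q = schur_list pw \<mu> (var_set N)"
  shows "symmetrized_poly pw \<mu> N = q"
proof (cases "N < length \<mu>")
  case True
  then have "fr q = fr 0"
    using assms schur_list_eq_0[of "var_set N" \<mu> pw] no_antipodes_var_set[of N]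
    by (simp only: card_var_set fr_zero no_antipodes_def)
  then show ?thesis using True by (simp add: symmetrized_poly_def fr_eq_iff)
next
  case False
  have "symmetrization pw N \<mu> (\<lambda>i. fr (Var i)) = fr q"
    unfolding assms var_set_def using False inj_fr_Var
    by (intro rat_fract.symmetrization_eq_schur_list) (auto intro: inj_on_subset)
  then show ?thesis using False by (simp add: symmetrized_poly_def fr_eq_iff)
qed

definition p_poly :: "nat \<Rightarrow> (nat list \<Rightarrow> rat) \<Rightarrow> symfun" where
  "p_poly k c N = (\<Sum>\<rho>\<in>OP k. Const (c \<rho>) * p_prod \<rho> N)"

lemma fr_p_poly: "fr (p_poly k c N) = (\<Sum>\<rho>\<in>OP k. fr (Const (c \<rho>)) * (\<Prod>r\<leftarrow>\<rho>. \<Sum>x\<in>var_set N. x ^ r))"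
  by (simp only: p_poly_def fr_sum fr_mult fr_p_prod)

text \<open>The expansion in power sums exhibits the polynomial that the symmetrized rational
  function equals.\<close>

lemma schur_P_desc:
  assumes "S \<in> strict_sets (int k)"
  shows "schur_P (desc S) N = p_poly k (p_coeff S) N"
  unfolding schur_P_def
proof (rule symmetrized_poly_eqI)
  show "fr (p_poly k (p_coeff S) N) = schur_list (^) (desc S) (var_set N)"
    using rat_fract.schur_set_eq_p[OF assms no_antipodes_var_set]
    by (simp only: fr_p_poly rat_fract.schur_set_def)
qed

definition fall_poly :: "nat list \<Rightarrow> symfun" where
  "fall_poly \<mu> N = (\<Sum>(c, b)\<leftarrow>fall_terms \<mu>. Const c * p_poly (sum_list b) (list_coeff b) N)"

lemma factorial_P_eq:
  assumes "0 \<notin> set \<mu>"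
  shows "factorial_P \<mu> N = fall_poly \<mu> N"
  unfolding factorial_P_def
proof (rule symmetrized_poly_eqI)
  have "finite (var_set N)" using no_antipodes_var_set by (simp add: no_antipodes_def)
  then have "schur_list falling \<mu> (var_set N) =
      (\<Sum>(c, b)\<leftarrow>fall_terms \<mu>. fr (Const c) * schur_list (^) b (var_set N))"
    using rat_fract.schur_list_falling[OF assms] by simp
  also have "\<dots> = (\<Sum>(c, b)\<leftarrow>fall_terms \<mu>. fr (Const c) * fr (p_poly (sum_list b) (list_coeff b) N))"
  proof -
    have "schur_list (^) b (var_set N) = fr (p_poly (sum_list b) (list_coeff b) N)"
      if "(c, b) \<in> set (fall_terms \<mu>)" for c b
      unfolding fr_p_poly using fall_terms_pos[OF that] no_antipodes_var_set
      by (rule rat_fract.schur_list_eq_p)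
    then show ?thesis by (intro arg_cong[of _ _ sum_list] map_cong refl) auto
  qed
  also have "\<dots> = fr (fall_poly \<mu> N)"
    by (simp only: fall_poly_def fr_sum_list fr_mult case_prod_unfold)
  finally show "fr (fall_poly \<mu> N) = schur_list falling \<mu> (var_set N)" by simp
qed

text \<open>Values cannot be substituted directly into the rational function. The expansion in power
  sums has the same rational coefficients over both fields, and evaluation passes through
  it.\<close>

lemma poly_eval_factorial_P:
  assumes "0 \<notin> set \<mu>" "inj_on \<alpha> {..<N}" "no_antipodes (\<alpha> ` {..<N})"
  shows "poly_eval \<alpha> (factorial_P \<mu> N) = schur_list falling \<mu> (\<alpha> ` {..<N})"
proof -
  have p: "poly_eval \<alpha> (p_poly k c N) = (\<Sum>\<rho>\<in>OP k. c \<rho> * (\<Prod>r\<leftarrow>\<rho>. \<Sum>x\<in>\<alpha> ` {..<N}. x ^ r))" for k c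
    using assms(2) by (simp add: p_poly_def poly_eval_sum poly_eval_mult poly_eval_Const poly_eval_p_prod sum.reindex)
  have "poly_eval \<alpha> (factorial_P \<mu> N) = (\<Sum>(c, b)\<leftarrow>fall_terms \<mu>. c * poly_eval \<alpha> (p_poly (sum_list b) (list_coeff b) N))"
    by (simp add: factorial_P_eq[OF assms(1)] fall_poly_def poly_eval_sum_list poly_eval_mult poly_eval_Const case_prod_unfold)
  also have "\<dots> = (\<Sum>(c, b)\<leftarrow>fall_terms \<mu>. c * schur_list (^) b (\<alpha> ` {..<N}))"
    using fall_terms_pos rat_id.schur_list_eq_p[OF _ assms(3)]
    by (intro arg_cong[of _ _ sum_list] map_cong refl) (auto simp: p split: prod.split)
  also have "\<dots> = schur_list falling \<mu> (\<alpha> ` {..<N})"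
    using rat_id.schur_list_falling[OF assms(1)] assms(3) by (simp add: no_antipodes_def)
  finally show ?thesis .
qed

section \<open>Linear independence of power sum products\<close>

lemma lookup_p_prod:
  "Poly_Mapping.lookup (p_prod \<sigma> N) m =
    of_nat (card {f \<in> {..<length \<sigma>} \<rightarrow>\<^sub>E {..<N}. (\<Sum>j<length \<sigma>. Poly_Mapping.single (f j) (\<sigma> ! j)) = m})"
proof -
  have pow: "Var i ^ r = Poly_Mapping.single (Poly_Mapping.single i r) 1" for i r
    by (induction r) (simp_all add: Var_def mult_single flip: single_add)
  have prod: "(\<Prod>j\<in>J. Poly_Mapping.single (g j) (1::rat)) = Poly_Mapping.single (\<Sum>j\<in>J. g j) 1"
    for J and g :: "nat \<Rightarrow> nat \<Rightarrow>\<^sub>0 nat"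
    by (induction J rule: infinite_finite_induct) (simp_all add: mult_single)
  have "p_prod \<sigma> N = (\<Prod>j<length \<sigma>. \<Sum>i<N. Poly_Mapping.single (Poly_Mapping.single i (\<sigma> ! j)) 1)"
    by (simp add: p_prod_def power_sum_def pow prod.list_conv_set_nth atLeast0LessThan)
  \<comment> \<open>Expanding the product assigns to each part of \<open>\<sigma>\<close> the
    variable \<open>f j\<close> chosen from its power sum.\<close>
  also have "\<dots> = (\<Sum>f\<in>{..<length \<sigma>} \<rightarrow>\<^sub>E {..<N}. \<Prod>j<length \<sigma>. Poly_Mapping.single (Poly_Mapping.single (f j) (\<sigma> ! j)) 1)"
    by (rule prod_sum_PiE) auto
  also have "\<dots> = (\<Sum>f\<in>{..<length \<sigma>} \<rightarrow>\<^sub>E {..<N}. Poly_Mapping.single (\<Sum>j<length \<sigma>. Poly_Mapping.single (f j) (\<sigma> ! j)) 1)"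
    by (simp add: prod)
  finally show ?thesis
    by (simp add: lookup_sum lookup_single when_def sum.If_cases finite_PiE Int_def)
qed

text \<open>The coefficient of \<open>x\<^sub>1\<^bsup>\<rho>\<^sub>1\<^esup> x\<^sub>2\<^bsup>\<rho>\<^sub>2\<^esup> \<cdots>\<close> in \<open>p\<^sub>\<sigma>\<close> counts the ways of obtaining
  \<open>\<rho>\<close> from \<open>\<sigma>\<close> by merging parts; this makes the transition matrix triangular.\<close>
lemma lookup_p_prod_merge:
  assumes "is_partition \<rho>" "is_partition \<sigma>" "length \<sigma> \<le> length \<rho>"
  defines "m \<equiv> (\<Sum>j<length \<rho>. Poly_Mapping.single j (\<rho> ! j))"
  shows "Poly_Mapping.lookup (p_prod \<sigma> (length \<rho>)) m \<noteq> 0 \<longleftrightarrow> \<sigma> = \<rho>"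
proof -
  let ?M = "\<lambda>f. \<Sum>j<length \<sigma>. Poly_Mapping.single (f j) (\<sigma> ! j)"
  let ?F = "{f \<in> {..<length \<sigma>} \<rightarrow>\<^sub>E {..<length \<rho>}. ?M f = m}"
  have "?F \<noteq> {} \<longleftrightarrow> \<sigma> = \<rho>"
  proof
    assume "\<sigma> = \<rho>"
    then have "restrict id {..<length \<sigma>} \<in> ?F" by (auto simp: m_def)
    then show "?F \<noteq> {}" by blast
  next
    assume "?F \<noteq> {}"
    then obtain f where f: "f \<in> {..<length \<sigma>} \<rightarrow>\<^sub>E {..<length \<rho>}" "?M f = m" by blast
    have part: "\<rho> ! i = (\<Sum>j | j < length \<sigma> \<and> f j = i. \<sigma> ! j)" if "i < length \<rho>" for i
    proof -
      have "Poly_Mapping.lookup (?M f) i = (\<Sum>j | j < length \<sigma> \<and> f j = i. \<sigma> ! j)"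
        by (simp add: lookup_sum lookup_single when_def sum.If_cases Int_def lessThan_def)
      moreover have "Poly_Mapping.lookup m i = \<rho> ! i"
        using that by (simp add: m_def lookup_sum lookup_single when_def)
      ultimately show ?thesis using f(2) by simp
    qed
    \<comment> \<open>Each part of \<open>\<rho>\<close> is positive, so some part of
      \<open>\<sigma>\<close> is merged into it; the bound on the lengths then makes
      \<open>f\<close> a bijection.\<close>
    have surj: "f ` {..<length \<sigma>} = {..<length \<rho>}"
    proof
      show "{..<length \<rho>} \<subseteq> f ` {..<length \<sigma>}"
      proof
        fix i assume "i \<in> {..<length \<rho>}"
        then have "\<rho> ! i \<in> set \<rho>" by simp
        moreover have "0 \<notin> set \<rho>" using assms(1) by (simp add: is_partition_def)
        ultimately have "\<rho> ! i \<noteq> 0" by metis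
        then have "{j. j < length \<sigma> \<and> f j = i} \<noteq> {}"
          using part[of i] \<open>i \<in> _\<close> by (metis lessThan_iff sum.empty)
        then show "i \<in> f ` {..<length \<sigma>}" by auto
      qed
    qed (use f in auto)
    then have "length \<rho> \<le> length \<sigma>" using card_image_le[of "{..<length \<sigma>}" f] by simp
    then have len: "length \<sigma> = length \<rho>" using assms(3) by simp
    then have inj: "inj_on f {..<length \<sigma>}" using surj by (intro eq_card_imp_inj_on) simp_all
    have nth: "\<rho> ! f j = \<sigma> ! j" if "j < length \<sigma>" for j
    proof -
      have "{j'. j' < length \<sigma> \<and> f j' = f j} = {j}" using inj that by (auto simp: inj_on_def)
      then show ?thesis using part[of "f j"] surj that by auto
    qed
    have "mset \<rho> = image_mset ((!) \<rho>) (mset_set (f ` {..<length \<sigma>}))"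
      by (simp only: surj) (metis map_nth mset_map mset_upt atLeast0LessThan)
    also have "\<dots> = image_mset (\<lambda>j. \<rho> ! f j) (mset_set {..<length \<sigma>})"
      using inj by (simp add: multiset.map_comp o_def flip: image_mset_mset_set)
    also have "\<dots> = image_mset ((!) \<sigma>) (mset_set {..<length \<sigma>})"
      by (intro image_mset_cong) (simp add: nth)
    also have "\<dots> = mset \<sigma>" by (metis map_nth mset_map mset_upt atLeast0LessThan)
    finally show "\<sigma> = \<rho>" using partition_eqI[OF assms(2,1)] by simp
  qed
  moreover have "finite ?F" by (simp add: finite_PiE)
  ultimately show ?thesis by (simp add: lookup_p_prod)
qed

lemma lookup_Const_mult: "Poly_Mapping.lookup (Const c * p) m = c * Poly_Mapping.lookup p m"
proof -
  have "Const c * p = (\<Sum>k\<in>Poly_Mapping.keys p. Poly_Mapping.single k (c * Poly_Mapping.lookup p k))"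
    by (subst poly_mapping_eq_sum_single[of p]) (simp add: Const_def sum_distrib_left mult_single)
  then show ?thesis by (simp add: lookup_sum lookup_single when_def in_keys_iff)
qed

text \<open>For a longest \<open>\<rho>\<close> in the support, triangularity leaves only the
  summand of \<open>\<rho>\<close> in the coefficient of its monomial.\<close>

lemma p_comb_eq_0:
  assumes "Poly_Mapping.keys c \<subseteq> Collect odd_partition" "\<And>N. p_comb c N = 0"
  shows "c = 0"
proof (rule ccontr)
  assume "c \<noteq> 0"
  then have ne: "Poly_Mapping.keys c \<noteq> {}" by simp
  obtain \<rho> where \<rho>: "\<rho> \<in> Poly_Mapping.keys c" "\<And>\<sigma>. \<sigma> \<in> Poly_Mapping.keys c \<Longrightarrow> length \<sigma> \<le> length \<rho>"
  proof -
    have "Max (length ` Poly_Mapping.keys c) \<in> length ` Poly_Mapping.keys c" using ne by simp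
    then show ?thesis using that by (metis (no_types, lifting) Max_ge finite_imageI finite_keys imageE imageI)
  qed
  define m where "m = (\<Sum>j<length \<rho>. Poly_Mapping.single j (\<rho> ! j))"
  have part: "is_partition \<sigma>" if "\<sigma> \<in> Poly_Mapping.keys c" for \<sigma>
    using assms(1) that by (auto simp: odd_partition_def)
  have "0 = Poly_Mapping.lookup (p_comb c (length \<rho>)) m" by (simp add: assms(2))
  also have "\<dots> = (\<Sum>\<sigma>\<in>Poly_Mapping.keys c. Poly_Mapping.lookup c \<sigma> * Poly_Mapping.lookup (p_prod \<sigma> (length \<rho>)) m)"
    by (simp add: p_comb_def lookup_sum lookup_Const_mult)
  also have "\<dots> = (\<Sum>\<sigma>\<in>{\<rho>}. Poly_Mapping.lookup c \<sigma> * Poly_Mapping.lookup (p_prod \<sigma> (length \<rho>)) m)"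
    using \<rho> lookup_p_prod_merge[OF part part] unfolding m_def
    by (intro sum.mono_neutral_right) auto
  also have "\<dots> \<noteq> 0"
    using \<rho> lookup_p_prod_merge[OF part part, of \<rho> \<rho>] by (simp add: m_def in_keys_iff)
  finally show False by simp
qed

section \<open>Scalar products and characters\<close>

lemma p_coeffs_eqI:
  assumes "Poly_Mapping.keys c \<subseteq> Collect odd_partition" "f = p_comb c"
  shows "p_coeffs f = c"
  unfolding p_coeffs_def
proof (rule the_equality)
  fix d assume d: "Poly_Mapping.keys d \<subseteq> Collect odd_partition \<and> f = p_comb d"
  have "Poly_Mapping.keys (d - c) \<subseteq> Poly_Mapping.keys d \<union> Poly_Mapping.keys c" by (rule keys_diff)
  then have "Poly_Mapping.keys (d - c) \<subseteq> Collect odd_partition" using d assms(1) by blast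
  moreover have "p_comb (d - c) N = 0" for N
  proof -
    have "p_comb (d - c) N + p_comb c N = p_comb d N" by (simp flip: p_comb_add)
    then show ?thesis using assms(2) d by simp
  qed
  ultimately have "d - c = 0" by (rule p_comb_eq_0)
  then show "d = c" by simp
qed (use assms in simp)

text \<open>Pairing with p_\<rho> picks one coordinate of Q_S and multiplies it by the squared norm;
  the normalisation of \<open>p_coeff\<close> and the power of 2 in Q_S cancel.\<close>

lemma X_char_desc:
  assumes S: "S \<in> strict_sets (int k)" and \<rho>: "\<rho> \<in> OP k"
  shows "X_char (desc S) \<rho> = p_vector \<rho> S"
proof -
  define c where "c = (\<Sum>\<sigma>\<in>OP k. Poly_Mapping.single \<sigma> (2 ^ length (desc S) * p_coeff S \<sigma>))"
  have lookup: "Poly_Mapping.lookup c \<sigma> = (if \<sigma> \<in> OP k then 2 ^ length (desc S) * p_coeff S \<sigma> else 0)" for \<sigma>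
    by (simp add: c_def lookup_sum lookup_single when_def finite_OP)
  have "Poly_Mapping.keys c \<subseteq> Collect odd_partition"
    using lookup by (auto simp: in_keys_iff OP_def split: if_splits)
  moreover have "schur_Q (desc S) N = p_comb c N" for N
  proof -
    have "Const (2 ^ n) = 2 ^ n" for n
    proof (induction n)
      case (Suc n)
      have "Const 2 = 2" using Const_add[of 1 1] by (simp add: Const_one)
      then show ?case using Suc by (simp add: Const_mult)
    qed (simp add: Const_one)
    then show ?thesis
      by (simp add: c_def p_comb_sum p_comb_single schur_Q_def schur_P_desc[OF S] p_poly_def
          sum_distrib_left Const_mult mult.assoc)
  qed
  ultimately have Q: "p_coeffs (schur_Q (desc S)) = c" by (intro p_coeffs_eqI) auto
  have p: "p_coeffs (p_prod \<rho>) = Poly_Mapping.single \<rho> 1"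
    using \<rho> by (intro p_coeffs_eqI) (auto simp: OP_def fun_eq_iff p_comb_single Const_one)
  have "0 \<notin> set \<rho>" using \<rho> by (auto simp: OP_def odd_partition_def is_partition_def)
  then have z: "z_part \<rho> \<noteq> 0" using z_part_pos[of \<rho>] by simp
  have len: "length (desc S) = fcard S"
    by (simp add: desc_def fcard.rep_eq)
  show ?thesis
    using \<rho> z by (simp add: X_char_def Defs.scalar_prod_def p Q lookup p_coeff_def len)
qed

section \<open>Strict partitions as finite sets\<close>

lemma desc_SP:
  assumes "S \<in> strict_sets (int k)"
  shows "desc S \<in> SP k"
proof -
  have "sorted_wrt (\<ge>) (desc S)" "distinct (desc S)" "set (desc S) = fset S"
    by (simp_all add: desc_def sorted_wrt_rev)
  moreover from this have "sum_list (desc S) = \<Sum>(fset S)"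
    using sum.distinct_set_conv_list[of "desc S" "\<lambda>x. x"] by simp
  ultimately show ?thesis
    using assms by (auto simp: SP_def strict_partition_def is_partition_def strict_sets_def
        simp del: of_nat_sum)
qed

lemma desc_fset_of_list:
  assumes "strict_partition \<mu>"
  shows "desc (fset_of_list \<mu>) = \<mu>"
proof -
  have "sorted_wrt (>) \<mu>"
  proof -
    have "sorted (rev \<mu>)" "distinct (rev \<mu>)"
      using assms by (simp_all add: strict_partition_def is_partition_def sorted_wrt_rev)
    then have "sorted_wrt (<) (rev \<mu>)" by (simp only: strict_sorted_iff simp_thms)
    then show ?thesis by (simp add: sorted_wrt_rev)
  qed
  then show ?thesis by (intro desc_unique) (simp_all add: fset_of_list.rep_eq)
qed

lemma fset_of_list_desc: "fset_of_list (desc S) = S"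
  by (rule fset_inject[THEN iffD1]) (simp add: fset_of_list.rep_eq desc_def)

lemma fset_of_list_strict_sets:
  assumes "\<mu> \<in> SP k"
  shows "fset_of_list \<mu> \<in> strict_sets (int k)"
proof -
  have "sum_list \<mu> = \<Sum>(set \<mu>)"
    using assms sum.distinct_set_conv_list[of \<mu> "\<lambda>x. x"] by (simp add: SP_def strict_partition_def)
  then show ?thesis using assms
    by (auto simp: SP_def strict_partition_def is_partition_def strict_sets_def fset_of_list.rep_eq
        simp del: of_nat_sum)
qed

lemma sum_SP: "(\<Sum>\<mu>\<in>SP k. F \<mu>) = (\<Sum>S\<in>strict_sets (int k). F (desc S))"
  using desc_SP fset_of_list_strict_sets desc_fset_of_list fset_of_list_desc
  by (intro sum.reindex_bij_witness[of _ desc fset_of_list]) (auto simp: SP_def)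

text \<open>With as many variables as parts, the evaluation points are precisely the parts of
  \<open>T\<close>. They are distinct and nonnegative, so no two of them sum to 0.\<close>

lemma poly_eval_frak_p:
  assumes "\<rho> \<in> OP k" "T \<in> strict_sets l"
  shows "poly_eval (\<lambda>i. of_nat (desc T ! i)) (frak_p \<rho> (length (desc T))) =
    rat_id.realize falling (int k) (p_vector \<rho>) (of_nat ` fset T)"
proof -
  let ?\<alpha> = "\<lambda>i. of_nat (desc T ! i) :: rat"
  have dist: "distinct (desc T)" by (simp add: desc_def)
  have inj: "inj_on ?\<alpha> {..<length (desc T)}"
    using dist by (auto simp: inj_on_def nth_eq_iff_index_eq)
  have "(!) (desc T) ` {..<length (desc T)} = fset T"
    using nth_image[of "length (desc T)" "desc T"] by (simp add: atLeast0LessThan desc_def)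
  then have img: "?\<alpha> ` {..<length (desc T)} = of_nat ` fset T"
    by (metis image_image)
  have na: "no_antipodes (of_nat ` fset T :: rat set)"
    by (auto simp: no_antipodes_def simp flip: of_nat_add)
  have k: "sum_list \<rho> = k" using assms(1) by (simp add: OP_def)
  have "poly_eval ?\<alpha> (frak_p \<rho> (length (desc T))) =
      (\<Sum>S\<in>strict_sets (int k). X_char (desc S) \<rho> * poly_eval ?\<alpha> (factorial_P (desc S) (length (desc T))))"
    by (simp add: frak_p_def k sum_SP poly_eval_sum poly_eval_mult poly_eval_Const)
  also have "\<dots> = (\<Sum>S\<in>strict_sets (int k). p_vector \<rho> S * rat_id.schur_set falling S (of_nat ` fset T))"
  proof (intro sum.cong refl)
    fix S assume S: "S \<in> strict_sets (int k)"
    have "0 \<notin> set (desc S)" using S by (simp add: strict_sets_def desc_def)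
    then have "poly_eval ?\<alpha> (factorial_P (desc S) (length (desc T))) = schur_list falling (desc S) (of_nat ` fset T)"
      using poly_eval_factorial_P[of "desc S" ?\<alpha> "length (desc T)"] inj na by (simp add: img)
    then show "X_char (desc S) \<rho> * poly_eval ?\<alpha> (factorial_P (desc S) (length (desc T))) =
        p_vector \<rho> S * rat_id.schur_set falling S (of_nat ` fset T)"
      using X_char_desc[OF S assms(1)] by (simp add: rat_id.schur_set_def)
  qed
  finally show ?thesis by (simp add: rat_id.realize_def)
qed

section \<open>Counting shifted tableaux\<close>

text \<open>Padding by zeros treats a box in a new row like one added to an existing row.\<close>

definition part_at :: "nat list \<Rightarrow> nat \<Rightarrow> nat" where
  "part_at \<mu> i = (if i < length \<mu> then \<mu> ! i else 0)"

lemma mem_shifted_diagram: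
  "(Suc i, j) \<in> shifted_diagram \<mu> \<longleftrightarrow> i < j \<and> j \<le> part_at \<mu> i + i"
  by (auto simp: shifted_diagram_def part_at_def)

lemma shifted_diagram_row_0: "(0, j) \<notin> shifted_diagram \<mu>"
  by (simp add: shifted_diagram_def)

lemma adds_box_iff: "adds_box \<mu> \<nu> \<longleftrightarrow> (\<exists>k. part_at \<nu> = (part_at \<mu>)(k := Suc (part_at \<mu> k)))"
proof
  assume "adds_box \<mu> \<nu>"
  then obtain i0 j0 where b: "(i0, j0) \<notin> shifted_diagram \<mu>"
    "shifted_diagram \<nu> = insert (i0, j0) (shifted_diagram \<mu>)"
    unfolding adds_box_def by auto
  then have "i0 \<noteq> 0" by (metis insertI1 shifted_diagram_row_0)
  then obtain k where k: "i0 = Suc k" by (cases i0) auto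
  have row: "{j. (Suc i, j) \<in> shifted_diagram \<kappa>} = {i<..part_at \<kappa> i + i}" for \<kappa> i
    by (auto simp: mem_shifted_diagram)
  have "part_at \<nu> i = ((part_at \<mu>)(k := Suc (part_at \<mu> k))) i" for i
  proof (cases "i = k")
    case True
    have "{k<..part_at \<nu> k + k} = insert j0 {k<..part_at \<mu> k + k}"
      using b k by (auto simp: row[symmetric])
    moreover have "j0 \<notin> {k<..part_at \<mu> k + k}"
      using b k by (auto simp: mem_shifted_diagram)
    ultimately have "card {k<..part_at \<nu> k + k} = Suc (card {k<..part_at \<mu> k + k})"
      by (metis card_insert_disjoint finite_greaterThanAtMost)
    then show ?thesis using True by simp
  next
    case False
    then have "{j. (Suc i, j) \<in> shifted_diagram \<nu>} = {j. (Suc i, j) \<in> shifted_diagram \<mu>}"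
      using b k by auto
    then have "card {i<..part_at \<nu> i + i} = card {i<..part_at \<mu> i + i}" unfolding row by simp
    then show ?thesis using False by simp
  qed
  then show "\<exists>k. part_at \<nu> = (part_at \<mu>)(k := Suc (part_at \<mu> k))" by blast
next
  assume "\<exists>k. part_at \<nu> = (part_at \<mu>)(k := Suc (part_at \<mu> k))"
  then obtain k where k: "part_at \<nu> = (part_at \<mu>)(k := Suc (part_at \<mu> k))" by blast
  show "adds_box \<mu> \<nu>" unfolding adds_box_def
  proof (intro exI conjI)
    show "(Suc k, Suc (part_at \<mu> k + k)) \<notin> shifted_diagram \<mu>" by (simp add: mem_shifted_diagram)
    show "shifted_diagram \<nu> = insert (Suc k, Suc (part_at \<mu> k + k)) (shifted_diagram \<mu>)"
    proof (rule Set.set_eqI)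
      fix b :: "nat \<times> nat"
      obtain i j where b: "b = (i, j)" by (cases b) auto
      show "b \<in> shifted_diagram \<nu> \<longleftrightarrow> b \<in> insert (Suc k, Suc (part_at \<mu> k + k)) (shifted_diagram \<mu>)"
        by (cases i) (auto simp: b shifted_diagram_row_0 mem_shifted_diagram k)
    qed
  qed
qed

section \<open>Removing a box\<close>

lemma part_at_inj:
  assumes "strict_partition \<mu>" "part_at \<mu> i = part_at \<mu> j" "part_at \<mu> i \<noteq> 0"
  shows "i = j"
  using assms by (auto simp: part_at_def strict_partition_def nth_eq_iff_index_eq split: if_splits)

lemma set_eq_part_at:
  assumes "strict_partition \<mu>"
  shows "m \<in> set \<mu> \<longleftrightarrow> m \<noteq> 0 \<and> (\<exists>i. part_at \<mu> i = m)"
proof -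
  have "0 \<notin> set \<mu>" using assms by (simp add: strict_partition_def is_partition_def)
  then show ?thesis by (auto simp: part_at_def in_set_conv_nth)
qed

text \<open>The parts that can be lowered by 1 while all parts stay distinct. A part 1 qualifies
  when 0 is not in \<open>S\<close>, and lowering deletes it.\<close>

definition removable :: "nat fset \<Rightarrow> nat set" where
  "removable S = {m \<in> fset S. m - 1 |\<notin>| S}"

definition lower_part :: "nat fset \<Rightarrow> nat \<Rightarrow> nat fset" where
  "lower_part S m = (if m = 1 then S |-| {|1|} else finsert (m - 1) (S |-| {|m|}))"

lemma removable_pos: "0 |\<notin>| S \<Longrightarrow> m \<in> removable S \<Longrightarrow> m > 0"
  by (cases m) (auto simp: removable_def)

lemma adds_box_imp_lower_part:
  assumes "strict_partition \<mu>" "strict_partition \<nu>" "adds_box \<mu> \<nu>"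
  shows "\<exists>m\<in>removable (fset_of_list \<nu>). fset_of_list \<mu> = lower_part (fset_of_list \<nu>) m"
proof -
  obtain k where k: "part_at \<nu> = (part_at \<mu>)(k := Suc (part_at \<mu> k))"
    using assms(3) by (auto simp: adds_box_iff)
  define m where "m = Suc (part_at \<mu> k)"
  have m: "part_at \<nu> k = m" "part_at \<mu> k = m - 1" "m \<noteq> 0" by (simp_all add: k m_def)
  have other: "part_at \<nu> i = part_at \<mu> i" if "i \<noteq> k" for i using that by (simp add: k)
  have S: "x \<in> set \<nu> \<longleftrightarrow> x \<noteq> 0 \<and> (x = m \<or> (\<exists>i. i \<noteq> k \<and> part_at \<mu> i = x))" for x
    using m(1) other unfolding set_eq_part_at[OF assms(2)] by metis
  have T: "x \<in> set \<mu> \<longleftrightarrow> x \<noteq> 0 \<and> (x = m - 1 \<or> (\<exists>i. i \<noteq> k \<and> part_at \<mu> i = x))" for x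
    using m(2) unfolding set_eq_part_at[OF assms(1)] by metis
  have no_m: "part_at \<mu> i \<noteq> m" if "i \<noteq> k" for i
    using part_at_inj[OF assms(2), of i k] that m other by auto
  have no_m1: "part_at \<mu> i \<noteq> m - 1" if "i \<noteq> k" "m \<noteq> 1" for i
    using part_at_inj[OF assms(1), of i k] that m by auto
  have "m \<in> removable (fset_of_list \<nu>)"
    using S[of m] S[of "m - 1"] m no_m1 by (auto simp: removable_def fset_of_list.rep_eq)
  moreover have "fset_of_list \<mu> = lower_part (fset_of_list \<nu>) m"
  proof (rule fset_eqI)
    fix x
    show "x |\<in>| fset_of_list \<mu> \<longleftrightarrow> x |\<in>| lower_part (fset_of_list \<nu>) m"
      using S[of x] T[of x] m no_m by (auto simp: lower_part_def fset_of_list.rep_eq)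
  qed
  ultimately show ?thesis by blast
qed

lemma lower_part_imp_adds_box:
  assumes "strict_partition \<nu>" "m \<in> removable (fset_of_list \<nu>)"
  shows "adds_box (desc (lower_part (fset_of_list \<nu>) m)) \<nu>"
proof -
  have \<nu>: "sorted_wrt (>) \<nu>" "distinct \<nu>" "0 \<notin> set \<nu>"
    using sorted_desc[of "fset_of_list \<nu>"] desc_fset_of_list[OF assms(1)] assms(1)
    by (auto simp: strict_partition_def is_partition_def)
  have gt: "\<nu> ! j < \<nu> ! i" if "i < j" "j < length \<nu>" for i j
    using \<nu>(1) that by (simp add: sorted_wrt_iff_nth_less)
  obtain k where k: "k < length \<nu>" "\<nu> ! k = m" and m: "m - 1 \<notin> set \<nu>"
    using assms(2) by (auto simp: removable_def fset_of_list.rep_eq in_set_conv_nth)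
  have m0: "m \<noteq> 0" using k \<nu>(3) nth_mem by metis
  show ?thesis
  proof (cases "m = 1")
    case True
    \<comment> \<open>The part 1 is the smallest one and therefore stands at the end.\<close>
    have last: "k = length \<nu> - 1"
    proof (rule ccontr)
      assume "k \<noteq> length \<nu> - 1"
      then have "Suc k < length \<nu>" using k by simp
      then have "\<nu> ! Suc k < 1" using gt[of k "Suc k"] k True by simp
      moreover have "\<nu> ! Suc k \<in> set \<nu>" using \<open>Suc k < length \<nu>\<close> by simp
      ultimately show False using \<nu>(3) by simp
    qed
    have ne: "\<nu> \<noteq> []" using k by auto
    have split: "\<nu> = butlast \<nu> @ [1]"
      using k last True ne by (metis append_butlast_last_id last_conv_nth)
    have "desc (lower_part (fset_of_list \<nu>) m) = butlast \<nu>"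
    proof (rule desc_unique)
      show "sorted_wrt (>) (butlast \<nu>)" using \<nu>(1) split by (metis sorted_wrt_append)
      have "1 \<notin> set (butlast \<nu>)" using \<nu>(2) split by (metis distinct_append disjoint_insert(1) list.set(2) inf_commute)
      moreover have "set \<nu> = insert 1 (set (butlast \<nu>))"
        using arg_cong[OF split, of set] by simp
      ultimately show "set (butlast \<nu>) = fset (lower_part (fset_of_list \<nu>) m)"
        using True by (auto simp: lower_part_def fset_of_list.rep_eq)
    qed
    moreover have "part_at \<nu> = (part_at (butlast \<nu>))(k := Suc (part_at (butlast \<nu>) k))"
      using k last True by (auto simp: fun_eq_iff part_at_def nth_butlast)
    ultimately show ?thesis unfolding adds_box_iff by auto
  next
    case False
    have lower: "\<nu> ! i \<noteq> m - 1" if "i < length \<nu>" for i using m that by (metis nth_mem)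
    have "desc (lower_part (fset_of_list \<nu>) m) = \<nu>[k := m - 1]"
    proof (rule desc_unique)
      show "sorted_wrt (>) (\<nu>[k := m - 1])"
        unfolding sorted_wrt_iff_nth_less
      proof (intro allI impI)
        fix i j assume ij: "i < j" "j < length (\<nu>[k := m - 1])"
        then show "\<nu>[k := m - 1] ! j < \<nu>[k := m - 1] ! i"
          using gt[of i j] lower[of j] k m0 by (auto simp: nth_list_update)
      qed
      show "set (\<nu>[k := m - 1]) = fset (lower_part (fset_of_list \<nu>) m)"
        using set_update_distinct[OF \<nu>(2) k(1), of "m - 1"] False k
        by (simp add: lower_part_def fset_of_list.rep_eq)
    qed
    moreover have "part_at \<nu> = (part_at (\<nu>[k := m - 1]))(k := Suc (part_at (\<nu>[k := m - 1]) k))"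
      using k m0 by (auto simp: fun_eq_iff part_at_def)
    ultimately show ?thesis unfolding adds_box_iff by auto
  qed
qed

lemma adds_box_sum_list:
  assumes "strict_partition \<mu>" "strict_partition \<nu>" "adds_box \<mu> \<nu>"
  shows "sum_list \<nu> = Suc (sum_list \<mu>)"
proof -
  obtain b where "b \<notin> shifted_diagram \<mu>" "shifted_diagram \<nu> = insert b (shifted_diagram \<mu>)"
    using assms(3) unfolding adds_box_def by auto
  then show ?thesis
    using card_shifted_diagram[of \<mu>] card_shifted_diagram[of \<nu>] assms(1,2)
    by (auto simp: strict_partition_def)
qed

lemma inj_on_lower_part: "0 |\<notin>| S \<Longrightarrow> inj_on (lower_part S) (removable S)"
proof (rule inj_onI)
  fix m n assume *: "0 |\<notin>| S" "m \<in> removable S" "n \<in> removable S" "lower_part S m = lower_part S n"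
  have "m \<noteq> 0" using * by (auto simp: removable_def intro: Nat.gr0I)
  then have "m |\<notin>| lower_part S m" by (auto simp: lower_part_def)
  then have "m |\<notin>| lower_part S n" using * by simp
  then show "m = n" using *(2) by (auto simp: lower_part_def removable_def split: if_splits)
qed

text \<open>Dropping the last entry of a chain leaves a chain to a partition with one box
  fewer.\<close>

lemma g_count_Suc:
  assumes "S \<in> strict_sets (int (Suc n))"
  shows "g_count (desc S) = (\<Sum>m\<in>removable S. g_count (desc (lower_part S m)))"
proof -
  let ?\<nu> = "desc S"
  have \<nu>: "?\<nu> \<in> SP (Suc n)" "strict_partition ?\<nu>" "sum_list ?\<nu> = Suc n"
    using desc_SP[OF assms] by (auto simp: SP_def)
  let ?M = "{\<mu> \<in> SP n. adds_box \<mu> ?\<nu>}"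
  have "Defs.chains ?\<nu> = (\<Union>\<mu>\<in>?M. (\<lambda>c. c @ [?\<nu>]) ` Defs.chains \<mu>)"
  proof (intro equalityI subsetI)
    fix c assume c: "c \<in> Defs.chains ?\<nu>"
    then have len: "length c = Suc (Suc n)" and last: "c ! Suc n = ?\<nu>" and strict: "\<forall>\<kappa>\<in>set c. strict_partition \<kappa>"
      and box: "\<And>k. k < Suc n \<Longrightarrow> adds_box (c ! k) (c ! Suc k)" and first: "c ! 0 = []"
      by (auto simp: chains_def \<nu>(3))
    define \<mu> where "\<mu> = c ! n"
    have \<mu>: "strict_partition \<mu>" "adds_box \<mu> ?\<nu>" using strict box[of n] len last by (auto simp: \<mu>_def)
    then have sum: "sum_list \<mu> = n" using adds_box_sum_list[OF \<mu>(1) \<nu>(2) \<mu>(2)] \<nu>(3) by simp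
    have "c = butlast c @ [?\<nu>]"
      using len last by (metis append_butlast_last_id diff_Suc_1 last_conv_nth length_0_conv nat.distinct(1))
    moreover have "butlast c \<in> Defs.chains \<mu>"
      using len strict first box
      by (auto simp: chains_def sum nth_butlast \<mu>_def[symmetric] dest: in_set_butlastD)
    ultimately show "c \<in> (\<Union>\<mu>\<in>?M. (\<lambda>c. c @ [?\<nu>]) ` Defs.chains \<mu>)"
      using \<mu> sum by (auto simp: SP_def)
  next
    fix c assume "c \<in> (\<Union>\<mu>\<in>?M. (\<lambda>c. c @ [?\<nu>]) ` Defs.chains \<mu>)"
    then obtain \<mu> d where \<mu>: "\<mu> \<in> SP n" "adds_box \<mu> ?\<nu>" and d: "d \<in> Defs.chains \<mu>" "c = d @ [?\<nu>]" by blast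
    have sum: "sum_list \<mu> = n" using \<mu>(1) by (simp add: SP_def)
    have "adds_box (c ! k) (c ! Suc k)" if "k < Suc n" for k
      using d \<mu>(2) that by (cases "k = n") (auto simp: chains_def sum nth_append)
    then show "c \<in> Defs.chains ?\<nu>"
      using d \<nu>(2) by (auto simp: chains_def sum \<nu>(3) nth_append)
  qed
  moreover have "card \<dots> = (\<Sum>\<mu>\<in>?M. card ((\<lambda>c. c @ [?\<nu>]) ` Defs.chains \<mu>))"
  proof (rule card_UN_disjoint)
    show "finite ?M" using finite_SP by simp
    show "\<forall>\<mu>\<in>?M. \<forall>\<mu>'\<in>?M. \<mu> \<noteq> \<mu>' \<longrightarrow>
        (\<lambda>c. c @ [?\<nu>]) ` Defs.chains \<mu> \<inter> (\<lambda>c. c @ [?\<nu>]) ` Defs.chains \<mu>' = {}"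
      by (auto simp: SP_def chains_def)
  qed (simp add: finite_chains)
  ultimately have "g_count ?\<nu> = (\<Sum>\<mu>\<in>?M. g_count \<mu>)"
    by (simp add: g_count_def card_image inj_on_def)
  also have "?M = (\<lambda>m. desc (lower_part S m)) ` removable S"
  proof (intro equalityI subsetI)
    fix \<mu> assume \<mu>: "\<mu> \<in> ?M"
    then obtain m where "m \<in> removable S" "fset_of_list \<mu> = lower_part S m"
      using adds_box_imp_lower_part[of \<mu> ?\<nu>] \<nu>(2) by (auto simp: SP_def fset_of_list_desc)
    moreover have "\<mu> = desc (fset_of_list \<mu>)" using \<mu> by (simp add: SP_def desc_fset_of_list)
    ultimately show "\<mu> \<in> (\<lambda>m. desc (lower_part S m)) ` removable S" by auto
  next
    fix \<mu> assume "\<mu> \<in> (\<lambda>m. desc (lower_part S m)) ` removable S"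
    then obtain m where m: "m \<in> removable S" "\<mu> = desc (lower_part S m)" by blast
    then have box: "adds_box \<mu> ?\<nu>"
      using lower_part_imp_adds_box[OF \<nu>(2)] by (simp add: fset_of_list_desc)
    have "0 |\<notin>| lower_part S m" using m(1) assms removable_pos[of S m]
      by (auto simp: lower_part_def strict_sets_def removable_def)
    then have "lower_part S m \<in> strict_sets (int (\<Sum>(fset (lower_part S m))))" by (simp add: strict_sets_def)
    from desc_SP[OF this] have "strict_partition \<mu>" using m(2) by (simp add: SP_def)
    then show "\<mu> \<in> ?M" using box adds_box_sum_list[OF _ \<nu>(2) box] \<nu>(3) by (simp add: SP_def)
  qed
  also have "(\<Sum>\<mu>\<in>\<dots>. g_count \<mu>) = (\<Sum>m\<in>removable S. g_count (desc (lower_part S m)))"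
  proof (subst sum.reindex)
    have "inj desc" by (metis fset_of_list_desc injI)
    moreover have "inj_on (lower_part S) (removable S)"
      using assms by (intro inj_on_lower_part) (simp add: strict_sets_def)
    ultimately show "inj_on (\<lambda>m. desc (lower_part S m)) (removable S)" by (auto simp: inj_on_def)
  qed simp
  finally show ?thesis .
qed

section \<open>Tableau numbers from the current of index 1\<close>

lemma lower_part_strict_sets:
  assumes "S \<in> strict_sets (int (Suc n))" "m \<in> removable S"
  shows "lower_part S m \<in> strict_sets (int n)"
proof -
  have m: "m |\<in>| S" "m - 1 |\<notin>| S" "m > 0" "0 |\<notin>| S"
    using assms by (auto simp: strict_sets_def removable_def intro: Nat.gr0I)
  have 1: "S |-| {|m|} \<in> strict_sets (int (Suc n) - int m)"
    using fminus_strict_sets[of m S "int (Suc n) - int m"] m assms(1) by simp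
  show ?thesis
  proof (cases "m = 1")
    case False
    then have "m - 1 > 0" using m(3) by linarith
    moreover have "m - 1 |\<notin>| S |-| {|m|}" using m(2) by simp
    ultimately show ?thesis
      using finsert_strict_sets[of "m - 1" "S |-| {|m|}" "int (Suc n) - int m"] m(3) 1 False
      by (simp add: lower_part_def of_nat_diff)
  qed (use 1 in \<open>simp add: lower_part_def\<close>)
qed

text \<open>The summands for \<open>j\<close> and \<open>1 - j\<close> agree. The pair containing
  \<open>j = - a\<close> turns a part \<open>a\<close> into \<open>a + 1\<close>, or creates the
  part 1 if \<open>a = 0\<close>; no part lies strictly between, so all signs cancel and each
  coefficient is 1.\<close>

lemma current_1:
  assumes "0 |\<notin>| S"
  shows "current 1 f S = (\<Sum>m\<in>removable S. f (lower_part S m))"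
proof -
  define M where "M = nat (current_bound 1 S)"
  have M: "int M = current_bound 1 S" using current_bound_nonneg[of 1 S] by (simp add: M_def)
  let ?t = "\<lambda>j. alt_sign j * fermion (1 - j) (fermion j f) S"
  have sym: "?t (1 - j) = ?t j" for j
    using clifford_move[of j "1 - j" f S] by (simp add: alt_sign_def)
  \<comment> \<open>The range is enlarged to be symmetric under exchanging \<open>j\<close> and
    \<open>1 - j\<close>.\<close>
  have "current 1 f S = sum ?t {- int M..int (Suc M)}"
    using M by (intro current_eq) auto
  also have "{- int M..int (Suc M)} = (\<lambda>a. - int a) ` {..M} \<union> (\<lambda>a. 1 + int a) ` {..M}"
  proof (intro equalityI subsetI)
    fix j assume j: "j \<in> {- int M..int (Suc M)}"
    show "j \<in> (\<lambda>a. - int a) ` {..M} \<union> (\<lambda>a. 1 + int a) ` {..M}"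
    proof (cases "j \<le> 0")
      case True
      then have "j = - int (nat (- j))" "nat (- j) \<le> M" using j by auto
      then show ?thesis by blast
    next
      case False
      then have "j = 1 + int (nat (j - 1))" "nat (j - 1) \<le> M" using j by auto
      then show ?thesis by blast
    qed
  qed auto
  also have "sum ?t \<dots> = (\<Sum>a\<le>M. ?t (- int a)) + (\<Sum>a\<le>M. ?t (1 + int a))"
    by (subst sum.union_disjoint) (auto simp: sum.reindex inj_on_def)
  also have "(\<Sum>a\<le>M. ?t (1 + int a)) = (\<Sum>a\<le>M. ?t (- int a))"
    using sym[of "- int _"] by (intro sum.cong) simp_all
  also have "(\<Sum>a\<le>M. ?t (- int a)) + (\<Sum>a\<le>M. ?t (- int a)) = (\<Sum>a\<le>M. 2 * ?t (- int a))"
    by (simp flip: sum_distrib_left)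
  also have "\<dots> = (\<Sum>a\<le>M. if Suc a \<in> removable S then f (lower_part S (Suc a)) else 0)"
  proof (intro sum.cong refl)
    fix a
    show "2 * ?t (- int a) = (if Suc a \<in> removable S then f (lower_part S (Suc a)) else 0)"
    proof (cases "Suc a |\<in>| S")
      case True
      show ?thesis
      proof (cases "a = 0")
        case z: True
        \<comment> \<open>The remaining parts all exceed 1, so the parity operator
          \<open>fermion 0\<close> cancels the sign of creating the part 1.\<close>
        have "{m \<in> fset S. 1 < m} = fset S - {1}" using assms by (auto intro: Suc_lessI Nat.gr0I)
        then have "card {m \<in> fset S. 1 < m} = fcard (S |-| {|1|})"
          by (simp add: fcard.rep_eq)
        then have "above_sign 1 S * (-1) ^ fcard (S |-| {|1|}) = 1"
          by (simp add: above_sign_def flip: power_mult_distrib)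
        then show ?thesis
          using True z assms fermion_pos[of 1 "fermion 0 f" S]
          by (simp add: fermion_0 removable_def lower_part_def mult.assoc[symmetric]
              del: fcard_fminus_finsert)
      next
        case nz: False
        have "{m \<in> fset S. a < m} = insert (Suc a) {m \<in> fset S. Suc a < m}" using True by auto
        then have "above_sign a S = - above_sign (Suc a) S" by (simp add: above_sign_def)
        then have "above_sign (Suc a) S * above_sign a (S |-| {|Suc a|}) = 1"
          using True by (simp add: above_sign_fminus)
        moreover have "fermion (1 + int a) (fermion (- int a) f) S =
            above_sign (Suc a) S * fermion (- int a) f (S |-| {|Suc a|})"
          using fermion_pos[of "Suc a" "fermion (- int a) f" S] True by simp
        ultimately show ?thesis
          using True nz by (simp add: fermion_neg removable_def lower_part_def mult.commute mult.left_commute)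
      qed
    next
      case False
      then show ?thesis using fermion_pos[of "Suc a" "fermion (- int a) f" S] by (simp add: removable_def)
    qed
  qed
  also have "\<dots> = (\<Sum>a | Suc a \<in> removable S. f (lower_part S (Suc a)))"
  proof -
    have "a \<le> M" if "Suc a \<in> removable S" for a
      using le_current_bound[of "Suc a" S 1] that M by (simp add: removable_def)
    then have "{..M} \<inter> {a. Suc a \<in> removable S} = {a. Suc a \<in> removable S}" by auto
    then show ?thesis by (simp add: sum.If_cases)
  qed
  also have "\<dots> = (\<Sum>m\<in>removable S. f (lower_part S m))"
    using removable_pos[OF assms]
    by (intro sum.reindex_bij_witness[of _ "\<lambda>m. m - 1" Suc]) simp_all
  finally show ?thesis .
qed

text \<open>Tableau numbers and iterates of \<open>current 1\<close> on the vacuum satisfy the same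
  recursion, by \<open>g_count_Suc\<close> and \<open>current_1\<close>.\<close>

lemma g_count_desc: "S \<in> strict_sets (int n) \<Longrightarrow> of_nat (g_count (desc S)) = p_vector (replicate n 1) S"
proof (induction n arbitrary: S)
  case 0
  then have "x = 0" "0 |\<notin>| S" if "x |\<in>| S" for x
    using that by (auto simp: strict_sets_def simp del: of_nat_sum)
  then have "S = {||}" by (metis all_not_fin_conv)
  moreover have "Defs.chains [] = {[[]]}"
    by (auto simp: chains_def strict_partition_def is_partition_def length_Suc_conv)
  ultimately show ?case by (simp add: desc_def g_count_def vac_def)
next
  case (Suc n)
  have "0 |\<notin>| S" using Suc.prems by (simp add: strict_sets_def)
  then show ?case
    using Suc.IH lower_part_strict_sets[OF Suc.prems] by (simp add: g_count_Suc[OF Suc.prems] current_1)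
qed

section \<open>The orthogonality relation\<close>

lemma falling_of_nat:
  "falling (of_nat n) k = (if k \<le> n then fact n / fact (n - k) else (0::rat))"
proof (induction k)
  case (Suc k)
  have step: "falling (of_nat n) (Suc k) = falling (of_nat n) k * (of_nat n - of_nat k :: rat)"
    by (simp add: falling_def)
  consider "Suc k \<le> n" | "k = n" | "k > n" by linarith
  then show ?case
  proof cases
    case 1
    then have "fact (n - k) = (of_nat n - of_nat k :: rat) * fact (n - Suc k)"
      by (simp add: fact_reduce[of "n - k"] of_nat_diff)
    then show ?thesis using 1 Suc.IH by (simp add: step)
  next
    case 2
    then show ?thesis unfolding step by simp
  next
    case 3
    then show ?thesis using Suc.IH by (simp add: step)
  qed
qed (simp add: falling_def)

text \<open>A nonzero summand assigns distinct elements of \<open>Z\<close> to the entries of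
  \<open>a\<close>, and a nonzero falling factorial forces every entry to be at most its element.
  Equal sums force equality everywhere and use up all of \<open>Z\<close>.\<close>

lemma schur_list_falling_vanishing:
  assumes "finite Z" "0 \<notin> Z" "schur_list falling a (of_nat ` Z :: rat set) \<noteq> 0"
  shows "sum_list a \<le> \<Sum>Z \<and> (sum_list a = \<Sum>Z \<longrightarrow> set a = Z)"
  using assms
proof (induction a arbitrary: Z)
  case Nil
  then show ?case by (auto simp: eq_commute[of 0])
next
  case (Cons n a)
  obtain x where x: "x \<in> Z" "falling (of_nat x) n \<noteq> (0::rat)"
    "schur_list falling a (of_nat ` Z - {of_nat x} :: rat set) \<noteq> 0"
  proof -
    have "\<not> (\<forall>y\<in>of_nat ` Z. falling y n * kern y (of_nat ` Z) * schur_list falling a (of_nat ` Z - {y}) = (0::rat))"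
      using Cons.prems(3) unfolding schur_list_Cons schur_op_def by (metis (no_types, lifting) sum.neutral)
    then show ?thesis using that by auto
  qed
  have "of_nat ` Z - {of_nat x} = (of_nat ` (Z - {x}) :: rat set)" by auto
  then have IH: "sum_list a \<le> \<Sum>(Z - {x})" "sum_list a = \<Sum>(Z - {x}) \<longrightarrow> set a = Z - {x}"
    using Cons.IH[of "Z - {x}"] Cons.prems x(3) by auto
  have n: "n \<le> x" using x(2) by (simp add: falling_of_nat split: if_splits)
  have sum: "\<Sum>Z = x + \<Sum>(Z - {x})" using Cons.prems(1) x(1) by (simp add: sum.remove)
  show ?case
  proof (intro conjI impI)
    show "sum_list (n # a) \<le> \<Sum>Z" using n sum IH by simp
    assume "sum_list (n # a) = \<Sum>Z"
    then have "n = x" "sum_list a = \<Sum>(Z - {x})" using n sum IH by simp_all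
    then show "set (n # a) = Z" using IH x(1) by auto
  qed
qed

lemma sum_list_desc: "S \<in> strict_sets (int k) \<Longrightarrow> sum_list (desc S) = k"
  using desc_SP by (auto simp: SP_def)

lemma schur_set_falling_eq_0:
  assumes "S \<in> strict_sets (int k)" "T \<in> strict_sets (int n)" "n \<le> k" "S \<noteq> T"
  shows "rat_id.schur_set falling S (of_nat ` fset T) = 0"
proof (rule ccontr)
  assume "rat_id.schur_set falling S (of_nat ` fset T) \<noteq> 0"
  then have *: "sum_list (desc S) \<le> \<Sum>(fset T)" "sum_list (desc S) = \<Sum>(fset T) \<longrightarrow> fset S = fset T"
    using schur_list_falling_vanishing[of "fset T" "desc S"] assms(2)
    by (simp_all add: rat_id.schur_set_def strict_sets_def desc_def)
  have "\<Sum>(fset T) = n" using assms(2) by (simp add: strict_sets_def del: of_nat_sum)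
  then show False using * assms sum_list_desc[OF assms(1)] by (simp add: fset_inject)
qed

lemma realize_falling_top:
  assumes "T \<in> strict_sets (int n)"
  shows "rat_id.realize falling (int n) f (of_nat ` fset T) = f T * rat_id.schur_set falling T (of_nat ` fset T)"
proof -
  have "rat_id.realize falling (int n) f (of_nat ` fset T) =
      (\<Sum>S\<in>{T}. f S * rat_id.schur_set falling S (of_nat ` fset T))"
    unfolding rat_id.realize_def using assms schur_set_falling_eq_0[OF _ assms]
    by (intro sum.mono_neutral_right) (auto simp: finite_strict_sets)
  then show ?thesis by simp
qed

lemma no_antipodes_of_nat: "no_antipodes (of_nat ` fset T :: rat set)"
  by (auto simp: no_antipodes_def simp flip: of_nat_add)

text \<open>At \<open>T\<close> the value of p_1 is \<open>n\<close>, so each application of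
  \<open>current 1\<close> in degree k multiplies the value by n - k. Climbing to degree
  \<open>n\<close> collects \<open>fact j\<close>, and there only the term of \<open>T\<close>
  survives.\<close>

lemma realize_falling_p_vector:
  assumes "T \<in> strict_sets (int n)" "sum_list \<rho> + j = n"
  shows "fact j * rat_id.realize falling (int (sum_list \<rho>)) (p_vector \<rho>) (of_nat ` fset T) =
    p_vector (replicate j 1 @ \<rho>) T * rat_id.schur_set falling T (of_nat ` fset T)"
  using assms(2)
proof (induction j arbitrary: \<rho>)
  case 0
  then show ?case using realize_falling_top[OF assms(1)] by simp
next
  case (Suc j)
  have "(\<Sum>x\<in>of_nat ` fset T. x :: rat) = of_nat (\<Sum>(fset T))"
    by (subst sum.reindex) (simp_all add: inj_on_def)
  also have "\<Sum>(fset T) = n" using assms(1) by (simp add: strict_sets_def del: of_nat_sum)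
  finally have "(\<Sum>x\<in>of_nat ` fset T. x :: rat) - of_int (int (sum_list \<rho>)) = of_nat (Suc j)"
    using Suc.prems by simp
  then have "of_nat (Suc j) * rat_id.realize falling (int (sum_list \<rho>)) (p_vector \<rho>) (of_nat ` fset T) =
      rat_id.realize falling (int (sum_list (1 # \<rho>))) (p_vector (1 # \<rho>)) (of_nat ` fset T)"
    using rat_id.realize_current_falling[OF homog_p_vector[of \<rho>] no_antipodes_of_nat[of T]]
    by (simp add: add.commute)
  then have "fact (Suc j) * rat_id.realize falling (int (sum_list \<rho>)) (p_vector \<rho>) (of_nat ` fset T) =
      fact j * rat_id.realize falling (int (sum_list (1 # \<rho>))) (p_vector (1 # \<rho>)) (of_nat ` fset T)"
    by (simp only: fact_Suc of_nat_mult of_nat_fact mult.assoc mult.left_commute)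
  also have "\<dots> = p_vector (replicate j 1 @ 1 # \<rho>) T * rat_id.schur_set falling T (of_nat ` fset T)"
    using Suc.prems by (intro Suc.IH) simp
  also have "replicate j 1 @ 1 # \<rho> = replicate (Suc j) 1 @ \<rho>"
    by (metis append_Cons append_assoc append_Nil replicate_Suc replicate_append_same)
  finally show ?case .
qed

text \<open>The unknown value of the factorial P-function of \<open>T\<close> at \<open>T\<close> is
  eliminated by comparing the case of \<open>\<rho>\<close> with that of the empty partition, which
  says that its product with the tableau number is \<open>fact n\<close>.\<close>

lemma g_count_mult_frak_p:
  assumes T: "T \<in> strict_sets (int n)" and \<rho>: "\<rho> \<in> OP k"
  shows "of_nat (g_count (desc T)) * rat_id.realize falling (int k) (p_vector \<rho>) (of_nat ` fset T) =
    (if k \<le> n then fact n / fact (n - k) * p_vector (replicate (n - k) 1 @ \<rho>) T else 0)"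
proof (cases "k \<le> n")
  case True
  let ?H = "rat_id.schur_set falling T (of_nat ` fset T)"
  have k: "sum_list \<rho> = k" using \<rho> by (simp add: OP_def)
  have "fact n = of_nat (g_count (desc T)) * ?H"
    using realize_falling_p_vector[OF T, of "[]" n] g_count_desc[OF T] by (simp add: rat_id.realize_vac)
  moreover have "fact (n - k) * rat_id.realize falling (int k) (p_vector \<rho>) (of_nat ` fset T) =
      p_vector (replicate (n - k) 1 @ \<rho>) T * ?H"
    using realize_falling_p_vector[OF T, of \<rho> "n - k"] True k by simp
  ultimately have "fact (n - k) * (of_nat (g_count (desc T)) * rat_id.realize falling (int k) (p_vector \<rho>) (of_nat ` fset T)) =
      fact n * p_vector (replicate (n - k) 1 @ \<rho>) T" by simp
  then show ?thesis using True by (simp add: field_simps)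
next
  case False
  have "rat_id.schur_set falling S (of_nat ` fset T) = 0" if "S \<in> strict_sets (int k)" for S
  proof -
    have "S \<noteq> T" using sum_list_desc[OF that] sum_list_desc[OF T] False by auto
    then show ?thesis using schur_set_falling_eq_0[OF that T] False by simp
  qed
  then show ?thesis using False by (simp add: rat_id.realize_def)
qed

lemma z_part_replicate_1: "1 \<notin> set \<rho> \<Longrightarrow> z_part (replicate j 1 @ \<rho>) = fact j * z_part \<rho>"
proof (induction j)
  case (Suc j)
  have "count_list (replicate j 1 @ \<rho>) 1 = j"
    using Suc.prems by (induction j) simp_all
  then show ?case using Suc by (simp add: z_part_Cons algebra_simps)
qed simp

text \<open>The parts different from 1 recover the original partition, so padding with ones
  preserves distinctness.\<close>

lemma mset_replicate_1_cancel:
  assumes "1 \<notin> set \<rho>" "1 \<notin> set \<sigma>" "mset (replicate i 1 @ \<rho>) = mset (replicate j 1 @ \<sigma>)"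
  shows "mset \<rho> = mset \<sigma>"
proof -
  have "filter_mset (\<lambda>r. r \<noteq> 1) (mset (replicate l 1 @ \<tau>)) = mset \<tau>" if "1 \<notin> set \<tau>" for l \<tau>
    using that by (induction l) (auto simp: filter_mset_eq_conv)
  then show ?thesis using assms by metis
qed

theorem theorem4p4:
  fixes \<rho> \<sigma> :: "nat list" and n :: nat
  assumes "odd_partition \<rho>" and "odd_partition \<sigma>"
    and "1 \<notin> set \<rho>" and "1 \<notin> set \<sigma>"
  shows "E_strict n (sym_eval (\<lambda>N. frak_p \<rho> N * frak_p \<sigma> N)) =
    (if \<rho> = \<sigma> then 2 ^ (sum_list \<rho> - length \<rho>) * of_nat (z_part \<rho>) * falling (of_nat n) (sum_list \<rho>)
     else 0)"
proof -
  define k l where "k = sum_list \<rho>" and "l = sum_list \<sigma>"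
  have OP: "\<rho> \<in> OP k" "\<sigma> \<in> OP l" using assms by (auto simp: OP_def k_def l_def)
  let ?R = "\<lambda>\<rho> T. rat_id.realize falling (int (sum_list \<rho>)) (p_vector \<rho>) (of_nat ` fset T)"
  let ?g = "\<lambda>T. of_nat (g_count (desc T)) :: rat"
  let ?Y = "\<lambda>\<rho>. p_vector (replicate (n - sum_list \<rho>) 1 @ \<rho>)"
  \<comment> \<open>One tableau number is given to each of the two functions, so that
    \<open>g_count_mult_frak_p\<close> applies to both.\<close>
  have "E_strict n (sym_eval (\<lambda>N. frak_p \<rho> N * frak_p \<sigma> N)) =
      (\<Sum>T\<in>strict_sets (int n). 2 ^ (n - fcard T) / fact n * ((?g T * ?R \<rho> T) * (?g T * ?R \<sigma> T)))"
    unfolding E_strict_def sum_SP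
  proof (intro sum.cong refl)
    fix T assume T: "T \<in> strict_sets (int n)"
    have "length (desc T) = fcard T" by (simp add: desc_def fcard.rep_eq)
    then show "2 ^ (n - length (desc T)) * (?g T)\<^sup>2 / fact n * sym_eval (\<lambda>N. frak_p \<rho> N * frak_p \<sigma> N) (desc T) =
        2 ^ (n - fcard T) / fact n * ((?g T * ?R \<rho> T) * (?g T * ?R \<sigma> T))"
      using poly_eval_frak_p[OF OP(1) T] poly_eval_frak_p[OF OP(2) T]
      by (simp add: sym_eval_def poly_eval_mult power2_eq_square k_def l_def)
  qed
  \<comment> \<open>One of the two factors \<open>fact n\<close> cancels against the weight, and the
    power of 2 splits into \<open>2 ^ n\<close> and the weight of \<open>fock_inner\<close>. If
    \<open>k\<close> or \<open>l\<close> exceeds \<open>n\<close>, the corresponding factor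
    vanishes.\<close>
  also have "\<dots> = (if k \<le> n \<and> l \<le> n then
      2 ^ n * fact n / (fact (n - k) * fact (n - l)) * fock_inner (int n) (?Y \<rho>) (?Y \<sigma>) else 0)"
  proof (cases "k \<le> n \<and> l \<le> n")
    case True
    have "2 ^ (n - fcard T) / fact n * ((?g T * ?R \<rho> T) * (?g T * ?R \<sigma> T)) =
        2 ^ n * fact n / (fact (n - k) * fact (n - l)) * (?Y \<rho> T * ?Y \<sigma> T / 2 ^ fcard T)"
      if T: "T \<in> strict_sets (int n)" for T
    proof -
      have "is_partition (desc T)" using desc_SP[OF T] by (simp add: SP_def strict_partition_def)
      then have "fcard T \<le> n"
        using length_le_sum_list_partition[of "desc T"] sum_list_desc[OF T] by (simp add: desc_def fcard.rep_eq)
      then have "(2::rat) ^ (n - fcard T) = 2 ^ n / 2 ^ fcard T" by (simp add: power_diff)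
      then show ?thesis
        using g_count_mult_frak_p[OF T OP(1)] g_count_mult_frak_p[OF T OP(2)] True
        by (simp add: k_def l_def ac_simps)
    qed
    then show ?thesis using True by (simp add: fock_inner_def sum_distrib_left)
  next
    case False
    then show ?thesis
      using g_count_mult_frak_p[OF _ OP(1)] g_count_mult_frak_p[OF _ OP(2)]
      by (auto simp: k_def l_def intro!: sum.neutral)
  qed
  also have "\<dots> = (if \<rho> = \<sigma> then 2 ^ (k - length \<rho>) * of_nat (z_part \<rho>) * falling (of_nat n) k else 0)"
  proof (cases "k \<le> n \<and> l \<le> n")
    case True
    let ?\<rho> = "replicate (n - k) 1 @ \<rho>" and ?\<sigma> = "replicate (n - l) 1 @ \<sigma>"
    have "odd r" if "odd_partition \<tau>" "r \<in> set (replicate m 1 @ \<tau>)" for r m \<tau>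
    proof -
      have "r = 1 \<or> r \<in> set \<tau>" using that(2) by (simp add: set_replicate_conv_if split: if_splits)
      then show ?thesis using that(1) unfolding odd_partition_def by (metis odd_one)
    qed
    then have odd: "\<forall>r\<in>set ?\<rho>. odd r" "\<forall>s\<in>set ?\<sigma>. odd s"
      using assms(1,2) by blast+
    have sum: "sum_list ?\<rho> = n" using True by (simp add: k_def sum_list_replicate)
    have "fock_inner (int n) (?Y \<rho>) (?Y \<sigma>) =
        (if mset ?\<rho> = mset ?\<sigma> then of_nat (z_part ?\<rho>) / 2 ^ length ?\<rho> else 0)"
      using fock_inner_p_vector[OF odd] unfolding sum unfolding k_def l_def .
    moreover have "mset ?\<rho> = mset ?\<sigma> \<longleftrightarrow> \<rho> = \<sigma>"
    proof
      assume "mset ?\<rho> = mset ?\<sigma>"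
      then have "mset \<rho> = mset \<sigma>" by (rule mset_replicate_1_cancel[OF assms(3,4)])
      then show "\<rho> = \<sigma>" using partition_eqI assms(1,2) by (simp add: odd_partition_def)
    qed (simp add: k_def l_def)
    moreover have "length \<rho> \<le> k"
      using assms(1) length_le_sum_list_partition by (simp add: odd_partition_def k_def)
    then have "(2::rat) ^ n = 2 ^ (k - length \<rho>) * 2 ^ length ?\<rho>"
      using True by (simp flip: power_add)
    \<comment> \<open>The added ones contribute \<open>fact (n - k)\<close> to
      \<open>z_part\<close>, which leaves the falling factorial
      \<open>fact n / fact (n - k)\<close>.\<close>
    ultimately show ?thesis
      using True z_part_replicate_1[OF assms(3)] by (auto simp: falling_of_nat k_def l_def)
  next
    case False
    \<comment> \<open>If \<open>\<rho> = \<sigma>\<close>, then \<open>k = l\<close> exceeds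
      \<open>n\<close> and the falling factorial is 0.\<close>
    then show ?thesis by (auto simp: falling_of_nat k_def l_def)
  qed
  finally show ?thesis by (simp add: k_def)
qed

end
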